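(* If there exists an integer $n_0\geq 7$ such that all indecomposable tournaments with at least $n_0$ vertices are $\{-3\}$-reconstructible, then all tournaments with at least $n_0+2$ vertices are $\{-3\}$-reconstructible.
   Context: All tournaments are finite: a tournament $T=(V,A)$ consists of a finite vertex set $V$ and a set $A$ of ordered pairs of distinct vertices such that for all $x\neq y$ in $V$, exactly one of $(x,y),(y,x)$ is in $A$; $x$ dominates $y$ if $(x,y)\in A$. For $X\subseteq V$, $T[X]$ is the induced subtournament. A subset $I\subseteq V$ is an interval of $T$ if every $x\in V\setminus I$ either dominates all elements of $I$ or is dominated by all elements of $I$. The sets $\emptyset$, $V$, $\{x\}$ ($x\in V$) are the trivial intervals. $T$ is indecomposable if all its intervals are trivial. Two tournaments $T,T'$ on the same vertex set $V$ are $\{-3\}$-hypomorphic if $T[V\setminus X]$ and $T'[V\setminus X]$ are isomorphic for every $X\subseteq V$ with $|X|=3$. $T$ is $\{-3\}$-reconstructible if every tournament $\{-3\}$-hypomorphic to $T$ is isomorphic to $T$. *)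

theory Defs
  imports Graph_Theory.Pair_Digraph Graph_Theory.Digraph_Isomorphism
begin

text \<open>
  The parent locale \<^locale>\<open>pair_digraph\<close> supplies finiteness, arcs between vertices only, and
  the absence of loops. An arc \<open>(x, y)\<close> means that \<open>x\<close> dominates \<open>y\<close>.
\<close>

locale tournament = pair_digraph T for T :: "'a pair_pre_digraph" +
  assumes exactly_one_arc:
    "\<lbrakk>x \<in> pverts T; y \<in> pverts T; x \<noteq> y\<rbrakk> \<Longrightarrow> (x, y) \<in> parcs T \<longleftrightarrow> (y, x) \<notin> parcs T"

definition tournament_interval :: "'a pair_pre_digraph \<Rightarrow> 'a set \<Rightarrow> bool" where
  "tournament_interval T I \<longleftrightarrow> I \<subseteq> pverts T \<and>
     (\<forall>x \<in> pverts T - I. (\<forall>y \<in> I. (x, y) \<in> parcs T) \<or> (\<forall>y \<in> I. (y, x) \<in> parcs T))"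

definition trivial_interval :: "'a pair_pre_digraph \<Rightarrow> 'a set \<Rightarrow> bool" where
  "trivial_interval T I \<longleftrightarrow> I = {} \<or> I = pverts T \<or> (\<exists>x \<in> pverts T. I = {x})"

definition indecomposable :: "'a pair_pre_digraph \<Rightarrow> bool" where
  "indecomposable T \<longleftrightarrow> (\<forall>I. tournament_interval T I \<longrightarrow> trivial_interval T I)"

definition minus3_hypomorphic :: "'a pair_pre_digraph \<Rightarrow> 'a pair_pre_digraph \<Rightarrow> bool" where
  "minus3_hypomorphic T T' \<longleftrightarrow> pverts T = pverts T' \<and>
     (\<forall>X. X \<subseteq> pverts T \<and> card X = 3 \<longrightarrow>
        digraph_iso (with_proj T \<restriction> (pverts T - X)) (with_proj T' \<restriction> (pverts T - X)))"

definition minus3_reconstructible :: "'a pair_pre_digraph \<Rightarrow> bool" where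
  "minus3_reconstructible T \<longleftrightarrow>
     (\<forall>T'. tournament T' \<and> minus3_hypomorphic T T' \<longrightarrow> digraph_iso (with_proj T') (with_proj T))"

text \<open>
  The library isomorphisms carry separate components for vertices, arcs, tails and heads. For
  well-formed digraphs whose arcs are pairs they amount to arc-preserving vertex bijections:
\<close>

lemma digraph_iso_with_proj_iff:
  assumes "pair_wf_digraph G" "pair_wf_digraph H"
  shows "digraph_iso (with_proj G) (with_proj H) \<longleftrightarrow>
    (\<exists>f. bij_betw f (pverts G) (pverts H) \<and>
      (\<forall>x \<in> pverts G. \<forall>y \<in> pverts G. (x, y) \<in> parcs G \<longleftrightarrow> (f x, f y) \<in> parcs H))"
    (is "?L \<longleftrightarrow> ?R")
proof
  interpret G: pair_wf_digraph G by fact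
  assume ?L
  then obtain h where h: "pre_digraph.digraph_isomorphism (with_proj G) h"
    and H: "with_proj H = app_iso h (with_proj G)"
    unfolding digraph_iso_def by blast
  have V: "pverts H = iso_verts h ` pverts G" and A: "parcs H = iso_arcs h ` parcs G"
    and tl: "iso_tail h = fst" and hd: "iso_head h = snd"
    using H unfolding with_proj_def app_iso_def by simp_all
  have inj: "inj_on (iso_verts h) (pverts G)"
    and arc: "\<And>a. a \<in> parcs G \<Longrightarrow> iso_arcs h a = (iso_verts h (fst a), iso_verts h (snd a))"
    using h unfolding pre_digraph.digraph_isomorphism_def tl hd with_proj_simps
    by (simp_all add: prod_eq_iff)
  have "(x, y) \<in> parcs G \<longleftrightarrow> (iso_verts h x, iso_verts h y) \<in> parcs H"
    if "x \<in> pverts G" "y \<in> pverts G" for x y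
  proof
    assume "(x, y) \<in> parcs G"
    then show "(iso_verts h x, iso_verts h y) \<in> parcs H"
      unfolding A using arc by (metis fst_conv imageI snd_conv)
  next
    assume "(iso_verts h x, iso_verts h y) \<in> parcs H"
    then obtain a where a: "a \<in> parcs G" "iso_arcs h a = (iso_verts h x, iso_verts h y)"
      unfolding A by (metis imageE)
    then have "fst a = x" "snd a = y"
      using arc[OF a(1)] that inj G.arc_fst_in_verts[OF a(1)] G.arc_snd_in_verts[OF a(1)]
      by (simp_all add: inj_on_eq_iff)
    then show "(x, y) \<in> parcs G" using a(1) by (metis prod.collapse)
  qed
  then show ?R using V inj unfolding bij_betw_def by blast
next
  interpret G: pair_wf_digraph G by fact
  interpret H: pair_wf_digraph H by fact
  assume ?R
  then obtain f where f: "bij_betw f (pverts G) (pverts H)"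
    and iff: "\<And>x y. x \<in> pverts G \<Longrightarrow> y \<in> pverts G \<Longrightarrow> (x, y) \<in> parcs G \<longleftrightarrow> (f x, f y) \<in> parcs H"
    by blast
  define h where "h = \<lparr>iso_verts = f, iso_arcs = map_prod f f, iso_head = snd, iso_tail = fst\<rparr>"
  have inj: "inj_on f (pverts G)" and img: "f ` pverts G = pverts H"
    using f by (auto simp: bij_betw_def)
  have "inj_on (map_prod f f) (parcs G)"
    by (rule inj_on_subset[OF map_prod_inj_on[OF inj inj]])
       (metis G.arc_fst_in_verts G.arc_snd_in_verts mem_Times_iff subsetI)
  then have "pre_digraph.digraph_isomorphism (with_proj G) h"
    using inj G.wf_digraph unfolding pre_digraph.digraph_isomorphism_def h_def by simp
  moreover have "parcs H = map_prod f f ` parcs G"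
  proof (intro equalityI subsetI)
    fix e assume e: "e \<in> parcs H"
    obtain x y where "x \<in> pverts G" "y \<in> pverts G" "e = (f x, f y)"
      using H.arc_fst_in_verts[OF e] H.arc_snd_in_verts[OF e] img
      by (metis imageE prod.collapse)
    then show "e \<in> map_prod f f ` parcs G"
      using e iff by (metis imageI map_prod_simp)
  next
    fix e assume "e \<in> map_prod f f ` parcs G"
    then obtain x y where "(x, y) \<in> parcs G" "e = (f x, f y)"
      by (metis imageE map_prod_simp surj_pair)
    then show "e \<in> parcs H" using iff G.in_arcsD1 G.in_arcsD2 by metis
  qed
  then have "with_proj H = app_iso h (with_proj G)"
    by (simp add: with_proj_def app_iso_def h_def img)
  ultimately show ?L unfolding digraph_iso_def by blast
qed

end

theory Submission
  imports Defs
begin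

text \<open>
  Write \<open>r\<close> and \<open>r'\<close> for the two arc relations. By Kelly's lemma they have, through any three
  points, equally many subtournaments of each type on at most \<open>n - 3\<close> points; in particular they have
  the same 3-cycles. Hence the classes of the graph of pairs on which \<open>r\<close> and \<open>r'\<close> differ are common
  intervals, and counting type by type shows that \<open>r\<close> and \<open>r'\<close> are isomorphic on each class with at most
  \<open>n - 3\<close> points and hypomorphic on every class \<open>N\<close>. If they are not isomorphic on \<open>N\<close>, then \<open>N\<close> has at
  least \<open>n - 2\<close> points and carries a strong tournament, and the pairs of \<open>N\<close> on which \<open>r\<close> and \<open>r'\<close> agree
  form a disconnected graph. The hypothesis excludes the indecomposable case. Otherwise \<open>N\<close> has a
  nontrivial interval all of whose outer arcs are reversed. Counting 4- and 5-point subtournaments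
  through two points of that interval shows that no point of \<open>N\<close> dominates, or is dominated by, a
  3-cycle, and that \<open>r'\<close> is a copy of the dual of \<open>r\<close> on \<open>N\<close> and on all its subsets. Such a locally
  transitive tournament is determined by two chains: the neighbourhood \<open>A\<close> of a vertex of minimum
  degree and its complement. The self-dual cards force these chains to match under reversal, so
  \<open>r\<close> is isomorphic to its dual, and hence to \<open>r'\<close>, on \<open>N\<close>.
\<close>

section \<open>Tournaments as relations\<close>

text \<open>Counting reaches sets of at most \<open>n - 3\<close> points, so a class with fewer than
  \<open>n - 2\<close> points is settled by its own count; this is where the loss of 2 comes from,
  and 9 = 7 + 2 leaves at least 7 points in \<open>N\<close>. Two obstacles shape the rest. The
  isomorphisms obtained from counts need not fix the points through which the sets are counted, so
  every local argument must locate these points in the image. And passing to the converse preserves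
  all 3-cycles, so nothing built on 3-cycles alone separates \<open>r'\<close> from the dual of
  \<open>r\<close>. A reversed interval helps because two of its points look alike from outside:
  sets through both of them and one outer point are counted within the limit of three prescribed
  points. For a tournament whose cards are self-dual, deleting three points of \<open>A\<close>
  works from minimum degree 4 on. For smaller degree all of \<open>A\<close> but one point is
  deleted together with some points of its complement. With 8 or 7 points in \<open>N\<close> this
  leaves too little room, but then cards missing only 2 or 1 points are known as well, as they have
  6 points.\<close>

type_synonym 'a arcs = "'a \<Rightarrow> 'a \<Rightarrow> bool"

abbreviation opp :: "'a arcs \<Rightarrow> 'a arcs" where "opp r \<equiv> r\<inverse>\<inverse>"

definition tour :: "'a arcs \<Rightarrow> 'a set \<Rightarrow> bool" where
  "tour r V \<longleftrightarrow> finite V \<and> (\<forall>x \<in> V. \<not> r x x) \<and>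
     (\<forall>x \<in> V. \<forall>y \<in> V. x \<noteq> y \<longrightarrow> (r x y \<longleftrightarrow> \<not> r y x))"

text \<open>The two vertex types may differ, so that a tournament can be compared with its copy on
  the natural numbers.\<close>

definition isom :: "'a arcs \<Rightarrow> 'a set \<Rightarrow> 'b arcs \<Rightarrow> 'b set \<Rightarrow> bool" where
  "isom r S r' S' \<longleftrightarrow> (\<exists>f. bij_betw f S S' \<and> (\<forall>x \<in> S. \<forall>y \<in> S. r x y \<longleftrightarrow> r' (f x) (f y)))"

lemma tour_finite: "tour r V \<Longrightarrow> finite V"
  by (simp add: tour_def)

lemma tour_irrefl: "tour r V \<Longrightarrow> x \<in> V \<Longrightarrow> \<not> r x x"
  by (simp add: tour_def)

lemma tour_flip: "tour r V \<Longrightarrow> x \<in> V \<Longrightarrow> y \<in> V \<Longrightarrow> x \<noteq> y \<Longrightarrow> \<not> r x y \<longleftrightarrow> r y x"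
  unfolding tour_def by blast

lemma tour_asym: "tour r V \<Longrightarrow> x \<in> V \<Longrightarrow> y \<in> V \<Longrightarrow> r x y \<Longrightarrow> \<not> r y x"
  unfolding tour_def by metis

lemma tour_subset: "tour r V \<Longrightarrow> W \<subseteq> V \<Longrightarrow> tour r W"
  unfolding tour_def by (meson finite_subset subsetD)

lemma tour_dual_imp: "tour r V \<Longrightarrow> tour (opp r) V"
  unfolding tour_def conversep_iff by (metis (full_types))

lemma tour_dual [simp]: "tour (opp r) V \<longleftrightarrow> tour r V"
  using tour_dual_imp[of r V] tour_dual_imp[of "opp r" V] by (simp only: conversep_conversep) blast

lemma isomI:
  "bij_betw f S S' \<Longrightarrow> (\<And>x y. x \<in> S \<Longrightarrow> y \<in> S \<Longrightarrow> r x y \<longleftrightarrow> r' (f x) (f y)) \<Longrightarrow> isom r S r' S'"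
  unfolding isom_def by blast

lemma isomE:
  assumes "isom r S r' S'"
  obtains f where "bij_betw f S S'" "\<And>x y. x \<in> S \<Longrightarrow> y \<in> S \<Longrightarrow> r x y \<longleftrightarrow> r' (f x) (f y)"
  using assms unfolding isom_def by blast

lemma isom_refl: "isom r S r S"
  by (rule isomI[of id]) auto

lemma isom_sym:
  assumes "isom r S r' S'" shows "isom r' S' r S"
proof -
  from assms obtain f where f: "bij_betw f S S'"
    "\<And>x y. x \<in> S \<Longrightarrow> y \<in> S \<Longrightarrow> r x y \<longleftrightarrow> r' (f x) (f y)"
    by (rule isomE) blast
  show ?thesis
  proof (rule isomI[of "inv_into S f"])
    show "bij_betw (inv_into S f) S' S" using f(1) by (rule bij_betw_inv_into)
    fix x y assume xy: "x \<in> S'" "y \<in> S'"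
    have *: "inv_into S f z \<in> S" "f (inv_into S f z) = z" if "z \<in> S'" for z
      using f(1) that by (auto simp: bij_betw_def f_inv_into_f inv_into_into)
    show "r' x y \<longleftrightarrow> r (inv_into S f x) (inv_into S f y)"
      using f(2)[OF *(1)[OF xy(1)] *(1)[OF xy(2)]] *(2)[OF xy(1)] *(2)[OF xy(2)] by simp
  qed
qed

lemma isom_trans:
  assumes "isom r S r' S'" "isom r' S' r'' S''" shows "isom r S r'' S''"
proof -
  from assms(1) obtain f where f: "bij_betw f S S'"
    "\<And>x y. x \<in> S \<Longrightarrow> y \<in> S \<Longrightarrow> r x y \<longleftrightarrow> r' (f x) (f y)" by (rule isomE) blast
  from assms(2) obtain g where g: "bij_betw g S' S''"
    "\<And>x y. x \<in> S' \<Longrightarrow> y \<in> S' \<Longrightarrow> r' x y \<longleftrightarrow> r'' (g x) (g y)" by (rule isomE) blast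
  show ?thesis
  proof (rule isomI[of "g \<circ> f"])
    show "bij_betw (g \<circ> f) S S''" using f(1) g(1) by (rule bij_betw_trans)
    fix x y assume xy: "x \<in> S" "y \<in> S"
    then have "f x \<in> S'" "f y \<in> S'" using bij_betwE[OF f(1)] by auto
    then show "r x y \<longleftrightarrow> r'' ((g \<circ> f) x) ((g \<circ> f) y)"
      using f(2)[OF xy] g(2) by simp
  qed
qed

lemma isom_dual: "isom (opp r) S (opp r') S' \<longleftrightarrow> isom r S r' S'"
  unfolding isom_def conversep_iff by blast

lemma isom_card: "isom r S r' S' \<Longrightarrow> card S = card S'"
  unfolding isom_def by (metis bij_betw_same_card)

text \<open>The isomorphism type as an equivalence class of relation-set pairs over one vertex type;
  counts for \<open>r\<close> and \<open>r'\<close> can then be indexed by the same values.\<close>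

definition itype :: "'a arcs \<Rightarrow> 'a set \<Rightarrow> ('a arcs \<times> 'a set) set" where
  "itype r S = {(w, W). isom r S w W}"

lemma itype_eq_iff:
  fixes r r' :: "'a arcs"
  shows "itype r S = itype r' S' \<longleftrightarrow> isom r S r' S'"
proof
  assume "itype r S = itype r' S'"
  then have "(r', S') \<in> itype r S" by (simp add: itype_def isom_refl)
  then show "isom r S r' S'" by (simp add: itype_def)
next
  assume i: "isom r S r' S'"
  have "isom r S w W \<longleftrightarrow> isom r' S' w W"
    for w :: "'a arcs" and W
    using isom_trans[OF i] isom_trans[OF isom_sym[OF i]] by blast
  then show "itype r S = itype r' S'" unfolding itype_def by (intro Collect_cong) auto
qed

section \<open>Counting subtournaments of a given type\<close>

definition fam :: "'a set \<Rightarrow> 'a set \<Rightarrow> 'a set \<Rightarrow> nat \<Rightarrow> 'a set set" where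
  "fam V Y Z k = {S. Y \<subseteq> S \<and> S \<subseteq> V - Z \<and> card S = k}"

text \<open>Equality of counts for every type at once. On a finite family it amounts to a
  permutation of the family that sends each set to one on which \<open>r'\<close> is isomorphic to
  \<open>r\<close> on the given set.\<close>

definition eqc :: "'a arcs \<Rightarrow> 'a arcs \<Rightarrow> 'a set set \<Rightarrow> bool" where
  "eqc r r' \<S> \<longleftrightarrow> (\<forall>\<tau>. card {S \<in> \<S>. itype r S = \<tau>} = card {S \<in> \<S>. itype r' S = \<tau>})"

lemma finite_fam: "finite V \<Longrightarrow> finite (fam V Y Z k)"
  unfolding fam_def by (rule finite_subset[of _ "Pow V"]) auto

text \<open>Fibres of \<open>f\<close> and \<open>g\<close> over the same value have equal size;
  bijections between them glue, since different fibres have disjoint images.\<close>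

lemma bij_of_equal_counts:
  fixes f g :: "'a \<Rightarrow> 'b"
  assumes fin: "finite A" and eq: "\<And>t. card {x \<in> A. f x = t} = card {x \<in> A. g x = t}"
  shows "\<exists>\<beta>. bij_betw \<beta> A A \<and> (\<forall>x \<in> A. g (\<beta> x) = f x)"
proof -
  have "\<exists>h. bij_betw h {x \<in> A. f x = t} {x \<in> A. g x = t}" for t
    using fin eq by (intro finite_same_card_bij) auto
  then obtain h where h: "\<And>t. bij_betw (h t) {x \<in> A. f x = t} {x \<in> A. g x = t}"
    by metis
  define \<beta> where "\<beta> x = h (f x) x" for x
  have mem: "\<beta> x \<in> A \<and> g (\<beta> x) = f x" if "x \<in> A" for x
    using bij_betwE[OF h[of "f x"]] that unfolding \<beta>_def by auto
  have "inj_on \<beta> A"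
  proof (rule inj_onI)
    fix x y assume xy: "x \<in> A" "y \<in> A" "\<beta> x = \<beta> y"
    then have "f x = f y" using mem by metis
    then show "x = y"
      using xy bij_betw_imp_inj_on[OF h[of "f x"]] unfolding \<beta>_def inj_on_def by auto
  qed
  moreover have "\<beta> ` A \<subseteq> A" using mem by auto
  ultimately have "bij_betw \<beta> A A"
    using fin by (simp add: bij_betw_def endo_inj_surj)
  then show ?thesis using mem by blast
qed

lemma eqc_bij:
  assumes "finite \<S>" "eqc r r' \<S>"
  shows "\<exists>\<beta>. bij_betw \<beta> \<S> \<S> \<and> (\<forall>S \<in> \<S>. isom r S r' (\<beta> S))"
proof -
  have "\<exists>\<beta>. bij_betw \<beta> \<S> \<S> \<and> (\<forall>S \<in> \<S>. itype r' (\<beta> S) = itype r S)"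
    using assms by (intro bij_of_equal_counts) (auto simp: eqc_def)
  then obtain \<beta> where \<beta>: "bij_betw \<beta> \<S> \<S>" "\<forall>S \<in> \<S>. itype r' (\<beta> S) = itype r S" by blast
  then have "\<forall>S \<in> \<S>. isom r S r' (\<beta> S)" by (simp add: itype_eq_iff[symmetric])
  with \<beta>(1) show ?thesis by blast
qed

lemma card_bij_filter:
  assumes "bij_betw \<beta> A A" "\<And>x. x \<in> A \<Longrightarrow> Q (\<beta> x) \<longleftrightarrow> P x"
  shows "card {x \<in> A. P x} = card {x \<in> A. Q x}"
proof -
  have im: "\<beta> ` A = A" and inj: "inj_on \<beta> A" using assms(1) by (auto simp: bij_betw_def)
  have "\<beta> ` {x \<in> A. P x} = {x \<in> A. Q x}"
  proof (intro equalityI subsetI)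
    fix y assume y: "y \<in> {x \<in> A. Q x}"
    then obtain x where "x \<in> A" "y = \<beta> x" using im by blast
    then show "y \<in> \<beta> ` {x \<in> A. P x}" using y assms(2) by auto
  qed (use assms(2) im in auto)
  moreover have "inj_on \<beta> {x \<in> A. P x}" by (rule inj_on_subset[OF inj]) auto
  ultimately show ?thesis by (metis card_image)
qed

lemma bij_eqc:
  assumes "bij_betw \<beta> \<S> \<S>" "\<And>S. S \<in> \<S> \<Longrightarrow> isom r S r' (\<beta> S)"
  shows "eqc r r' \<S>"
  unfolding eqc_def
proof
  fix \<tau>
  have "itype r' (\<beta> S) = itype r S" if "S \<in> \<S>" for S
    using assms(2)[OF that] itype_eq_iff[of r S r' "\<beta> S"] by simp
  then show "card {S \<in> \<S>. itype r S = \<tau>} = card {S \<in> \<S>. itype r' S = \<tau>}"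
    by (intro card_bij_filter[OF assms(1)]) simp
qed

text \<open>Lets one count any isomorphism-invariant property, such as containing a sink of a
  3-cycle, without naming types.\<close>

lemma eqc_card:
  assumes "finite \<S>" "eqc r r' \<S>"
    and inv: "\<And>S S'. S \<in> \<S> \<Longrightarrow> S' \<in> \<S> \<Longrightarrow> isom r S r' S' \<Longrightarrow> P S \<longleftrightarrow> P' S'"
  shows "card {S \<in> \<S>. P S} = card {S \<in> \<S>. P' S}"
proof -
  obtain \<beta> where \<beta>: "bij_betw \<beta> \<S> \<S>" "\<And>S. S \<in> \<S> \<Longrightarrow> isom r S r' (\<beta> S)"
    using eqc_bij[OF assms(1,2)] by blast
  show ?thesis
  proof (rule card_bij_filter[OF \<beta>(1)])
    fix S assume S: "S \<in> \<S>"
    then show "P' (\<beta> S) \<longleftrightarrow> P S" using inv[OF S _ \<beta>(2)[OF S]] bij_betwE[OF \<beta>(1)] by blast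
  qed
qed

text \<open>The main use of counts: a configuration of \<open>r\<close> through prescribed points
  reappears for \<open>r'\<close> through the same points, which may however play other roles in
  it.\<close>

lemma eqc_ex:
  assumes "finite \<S>" "eqc r r' \<S>" "S \<in> \<S>"
  shows "\<exists>S' \<in> \<S>. isom r S r' S'"
  using eqc_bij[OF assms(1,2)] assms(3) bij_betwE by blast

lemma eqc_singleton: "eqc r r' {S} \<Longrightarrow> isom r S r' S"
  using eqc_ex[of "{S}"] by auto

lemma eqc_dual:
  assumes "finite \<S>" "eqc r r' \<S>" shows "eqc (opp r) (opp r') \<S>"
  using eqc_bij[OF assms] bij_eqc[of _ \<S> "opp r" "opp r'"] by (auto simp: isom_dual)

lemma card_itype_Un:
  assumes "finite \<A>" "finite \<B>" "\<A> \<inter> \<B> = {}"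
  shows "card {S \<in> \<A> \<union> \<B>. P S} = card {S \<in> \<A>. P S} + card {S \<in> \<B>. P S}"
proof -
  have "{S \<in> \<A> \<union> \<B>. P S} = {S \<in> \<A>. P S} \<union> {S \<in> \<B>. P S}" by auto
  then show ?thesis using assms by (simp add: card_Un_disjoint disjoint_iff)
qed

lemma eqc_diff:
  assumes "finite \<A>" "finite \<B>" "\<A> \<inter> \<B> = {}" "eqc r r' (\<A> \<union> \<B>)" "eqc r r' \<A>"
  shows "eqc r r' \<B>"
  using assms unfolding eqc_def card_itype_Un[OF assms(1-3)] by auto

lemma fam_split:
  "y \<in> V \<Longrightarrow> y \<notin> Z \<Longrightarrow> fam V Y Z k = fam V (insert y Y) Z k \<union> fam V Y (insert y Z) k"
  "fam V (insert y Y) Z k \<inter> fam V Y (insert y Z) k = {}"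
  unfolding fam_def by auto

section \<open>Averaging and inclusion-exclusion for counts\<close>

lemma sum_card_containing:
  assumes "finite B" "finite \<S>" "\<And>S. S \<in> \<S> \<Longrightarrow> S \<subseteq> B \<and> card S = k"
  shows "(\<Sum>a \<in> B. card {S \<in> \<S>. a \<in> S}) = k * card \<S>"
proof -
  have "(\<Sum>a \<in> B. card {S \<in> \<S>. a \<in> S}) = (\<Sum>a \<in> B. \<Sum>S \<in> \<S>. if a \<in> S then 1 else 0)"
    using assms(2) by (simp add: sum.If_cases Int_def)
  also have "\<dots> = (\<Sum>S \<in> \<S>. \<Sum>a \<in> B. if a \<in> S then 1 else 0)" by (rule sum.swap)
  also have "\<dots> = (\<Sum>S \<in> \<S>. k)"
  proof (rule sum.cong)
    fix S assume "S \<in> \<S>"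
    then have "B \<inter> S = S" "card S = k" using assms(3) by auto
    then show "(\<Sum>a \<in> B. if a \<in> S then 1 else 0) = k"
      using assms(1) by (simp add: sum.If_cases Int_def[symmetric])
  qed simp
  finally show ?thesis by simp
qed

lemma eqc_average_containing:
  assumes "finite B" "k > 0" "\<And>a. a \<in> B \<Longrightarrow> eqc r r' (fam B {a} {} k)"
  shows "eqc r r' (fam B {} {} k)"
  unfolding eqc_def
proof
  fix \<tau>
  have *: "k * card {S \<in> fam B {} {} k. itype q S = \<tau>}
      = (\<Sum>a \<in> B. card {S \<in> fam B {a} {} k. itype q S = \<tau>})" for q
  proof -
    have "{S \<in> {S \<in> fam B {} {} k. itype q S = \<tau>}. a \<in> S} = {S \<in> fam B {a} {} k. itype q S = \<tau>}" for a
      by (auto simp: fam_def)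
    moreover have "(\<Sum>a \<in> B. card {S \<in> {S \<in> fam B {} {} k. itype q S = \<tau>}. a \<in> S})
        = k * card {S \<in> fam B {} {} k. itype q S = \<tau>}"
    proof (rule sum_card_containing[OF assms(1)])
      show "finite {S \<in> fam B {} {} k. itype q S = \<tau>}"
        using finite_fam[OF assms(1)] by simp
    qed (auto simp: fam_def)
    ultimately show ?thesis by (simp only:)
  qed
  have "k * card {S \<in> fam B {} {} k. itype r S = \<tau>} = k * card {S \<in> fam B {} {} k. itype r' S = \<tau>}"
    unfolding * using assms(3) by (intro sum.cong) (auto simp: eqc_def)
  then show "card {S \<in> fam B {} {} k. itype r S = \<tau>} = card {S \<in> fam B {} {} k. itype r' S = \<tau>}"
    using assms(2) by simp
qed

text \<open>A \<open>k\<close>-set outside \<open>Z\<close> is avoided by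
  \<open>card V - card Z - k\<close> further points, a positive number by assumption; the sum over
  \<open>z\<close> counts it that often.\<close>

lemma eqc_average_avoiding:
  assumes "finite V" "Z \<subseteq> V" "k + card Z < card V"
    and "\<And>z. z \<in> V - Z \<Longrightarrow> eqc r r' (fam V {} (insert z Z) k)"
  shows "eqc r r' (fam V {} Z k)"
  unfolding eqc_def
proof
  fix \<tau>
  let ?m = "card V - card Z"
  have *: "(\<Sum>z \<in> V - Z. card {S \<in> fam V {} (insert z Z) k. itype q S = \<tau>})
      = (?m - k) * card {S \<in> fam V {} Z k. itype q S = \<tau>}" for q
  proof -
    let ?\<S> = "{S \<in> fam V {} Z k. itype q S = \<tau>}"
    \<comment> \<open>Complements in \<open>V - Z\<close> turn avoiding \<open>z\<close> into
      containing \<open>z\<close>, so that \<open>sum_card_containing\<close> applies.\<close>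
    let ?\<C> = "(\<lambda>S. (V - Z) - S) ` ?\<S>"
    have fin: "finite ?\<S>" using assms(1) by (simp add: finite_fam)
    have inj: "inj_on (\<lambda>S. (V - Z) - S) ?\<S>"
      unfolding inj_on_def fam_def by blast
    have "card {S \<in> fam V {} (insert z Z) k. itype q S = \<tau>} = card {S \<in> ?\<C>. z \<in> S}"
      if z: "z \<in> V - Z" for z
    proof -
      have "{S \<in> ?\<C>. z \<in> S} = (\<lambda>S. (V - Z) - S) ` {S \<in> fam V {} (insert z Z) k. itype q S = \<tau>}"
        using z unfolding fam_def by auto
      moreover have "inj_on (\<lambda>S. (V - Z) - S) {S \<in> fam V {} (insert z Z) k. itype q S = \<tau>}"
        by (rule inj_on_subset[OF inj]) (auto simp: fam_def)
      ultimately show ?thesis by (simp add: card_image)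
    qed
    then have "(\<Sum>z \<in> V - Z. card {S \<in> fam V {} (insert z Z) k. itype q S = \<tau>})
        = (\<Sum>z \<in> V - Z. card {S \<in> ?\<C>. z \<in> S})" by (rule sum.cong[OF refl])
    also have "\<dots> = (?m - k) * card ?\<C>"
    proof (rule sum_card_containing)
      show "finite (V - Z)" using assms(1) by simp
      show "finite ?\<C>" using fin by simp
      fix S assume "S \<in> ?\<C>"
      then obtain S' where "S = (V - Z) - S'" "S' \<subseteq> V - Z" "card S' = k" by (auto simp: fam_def)
      then show "S \<subseteq> V - Z \<and> card S = ?m - k"
        using assms(1,2) by (simp add: card_Diff_subset finite_subset)
    qed
    also have "card ?\<C> = card ?\<S>" by (rule card_image[OF inj])
    finally show ?thesis .
  qed
  have "(?m - k) * card {S \<in> fam V {} Z k. itype r S = \<tau>}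
      = (?m - k) * card {S \<in> fam V {} Z k. itype r' S = \<tau>}"
    unfolding *[symmetric] using assms(4) by (intro sum.cong) (auto simp: eqc_def)
  then show "card {S \<in> fam V {} Z k. itype r S = \<tau>} = card {S \<in> fam V {} Z k. itype r' S = \<tau>}"
    using assms(3) by simp
qed

text \<open>Inclusion-exclusion opposite to \<open>kelly\<close>: the sets avoiding \<open>z\<close>
  are all sets minus those containing \<open>z\<close>, so one point after another moves from the
  forbidden to the required side.\<close>

lemma eqc_avoid:
  assumes "finite V" "Y \<subseteq> V" "Z \<subseteq> V" "Y \<inter> Z = {}" "finite Z"
    and "\<And>Y'. Y \<subseteq> Y' \<Longrightarrow> Y' \<subseteq> Y \<union> Z \<Longrightarrow> eqc r r' (fam V Y' {} k)"
  shows "eqc r r' (fam V Y Z k)"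
  using assms(5,1-4,6)
proof (induction Z arbitrary: Y rule: finite_induct)
  case empty
  then show ?case by simp
next
  case (insert z Z)
  have z: "z \<in> V" "z \<notin> Z" using insert by auto
  have 1: "eqc r r' (fam V Y Z k)"
  proof (rule insert.IH)
    fix Y' assume "Y \<subseteq> Y'" "Y' \<subseteq> Y \<union> Z"
    then show "eqc r r' (fam V Y' {} k)" by (intro insert.prems(5)) auto
  qed (use insert.prems in auto)
  have 2: "eqc r r' (fam V (insert z Y) Z k)"
  proof (rule insert.IH)
    fix Y' assume "insert z Y \<subseteq> Y'" "Y' \<subseteq> insert z Y \<union> Z"
    then show "eqc r r' (fam V Y' {} k)" by (intro insert.prems(5)) auto
  qed (use insert.prems insert.hyps in auto)
  show ?case
    by (rule eqc_diff[OF finite_fam finite_fam fam_split(2) _ 2])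
       (use 1[unfolded fam_split(1)[OF z, of Y k]] insert.prems(1) in simp_all)
qed

text \<open>Kelly's lemma: sets avoiding given points are counted by averaging over the cards, and sets
  containing given points by inclusion-exclusion.\<close>

lemma kelly_avoiding:
  assumes "finite V" "\<And>X. X \<subseteq> V \<Longrightarrow> card X = q \<Longrightarrow> isom r (V - X) r' (V - X)"
    and "k + q \<le> card V" "Z \<subseteq> V" "card Z \<le> q"
  shows "eqc r r' (fam V {} Z k)"
  using assms(4,5)
proof (induction "q - card Z" arbitrary: Z)
  case 0
  \<comment> \<open>The whole family now lies in one card, whose isomorphism permutes the
    \<open>k\<close>-subsets.\<close>
  then have cZ: "card Z = q" by simp
  from assms(2)[OF 0(2) cZ] obtain f where f: "bij_betw f (V - Z) (V - Z)"
    "\<And>x y. x \<in> V - Z \<Longrightarrow> y \<in> V - Z \<Longrightarrow> r x y \<longleftrightarrow> r' (f x) (f y)"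
    by (rule isomE) blast
  have bP: "bij_betw ((`) f) (Pow (V - Z)) (Pow (V - Z))"
    by (rule bij_betw_Pow[OF f(1)])
  have cf: "card (f ` S) = card S" if "S \<subseteq> V - Z" for S
    by (rule card_image) (use f(1) that in \<open>auto simp: bij_betw_def intro: inj_on_subset\<close>)
  show ?case
  proof (rule bij_eqc[of "(`) f"])
    show "bij_betw ((`) f) (fam V {} Z k) (fam V {} Z k)"
      unfolding bij_betw_def
    proof
      show "inj_on ((`) f) (fam V {} Z k)"
        by (rule inj_on_subset[OF bij_betw_imp_inj_on[OF bP]]) (auto simp: fam_def)
      show "(`) f ` fam V {} Z k = fam V {} Z k"
      proof (intro equalityI subsetI)
        fix S assume "S \<in> fam V {} Z k"
        then have S: "S \<in> Pow (V - Z)" "card S = k" by (auto simp: fam_def)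
        have "S \<in> (`) f ` Pow (V - Z)"
          unfolding bij_betw_imp_surj_on[OF bP] by (rule S(1))
        then obtain S' where "S' \<in> Pow (V - Z)" "S = f ` S'" by (rule imageE)
        then show "S \<in> (`) f ` fam V {} Z k" using S cf unfolding fam_def by auto
      next
        fix S assume "S \<in> (`) f ` fam V {} Z k"
        then obtain S' where "S' \<subseteq> V - Z" "card S' = k" "S = f ` S'" by (auto simp: fam_def)
        then show "S \<in> fam V {} Z k" using cf bij_betwE[OF f(1)] unfolding fam_def by auto
      qed
    qed
    fix S assume "S \<in> fam V {} Z k"
    then have S: "S \<subseteq> V - Z" by (simp add: fam_def)
    show "isom r S r' (f ` S)"
      by (rule isomI[of f])
         (use f S in \<open>auto simp: bij_betw_def intro: inj_on_subset\<close>)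
  qed
next
  case (Suc m)
  show ?case
  proof (rule eqc_average_avoiding[OF assms(1)])
    show "Z \<subseteq> V" by fact
    show "k + card Z < card V" using Suc.hyps(2) assms(3) by linarith
    fix z assume z: "z \<in> V - Z"
    have fZ: "finite Z" using Suc.prems(1) assms(1) finite_subset by blast
    show "eqc r r' (fam V {} (insert z Z) k)"
      by (rule Suc.hyps(1)) (use z fZ Suc.hyps(2) Suc.prems in auto)
  qed
qed

lemma kelly:
  assumes "finite V" "\<And>X. X \<subseteq> V \<Longrightarrow> card X = q \<Longrightarrow> isom r (V - X) r' (V - X)"
    and "k + q \<le> card V" "Y \<subseteq> V" "Z \<subseteq> V" "Y \<inter> Z = {}" "card Y + card Z \<le> q"
  shows "eqc r r' (fam V Y Z k)"
proof -
  have "finite Y" using assms(1,4) finite_subset by blast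
  then show ?thesis using assms(4-7)
  proof (induction Y arbitrary: Z rule: finite_induct)
    case empty
    show ?case
      by (rule kelly_avoiding[where q = q]) (use assms(1-3) empty.prems in auto)
  next
    case (insert y Y)
    have y: "y \<in> V" "y \<notin> Z" using insert.prems by auto
    have fZ: "finite Z" using insert.prems(2) assms(1) finite_subset by blast
    have 1: "eqc r r' (fam V Y Z k)"
      by (rule insert.IH) (use insert.prems insert.hyps in auto)
    have 2: "eqc r r' (fam V Y (insert y Z) k)"
      by (rule insert.IH) (use insert.prems insert.hyps y fZ in auto)
    show ?case
      by (rule eqc_diff[OF finite_fam finite_fam _ _ 2])
         (use 1[unfolded fam_split(1)[OF y, of Y k]] fam_split(2)[of V y Y Z k] assms(1)
           in \<open>simp_all add: Un_commute Int_commute\<close>)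
  qed
qed

section \<open>Partitions into common intervals\<close>

text \<open>With \<open>x = x'\<close> and \<open>y = y'\<close> the condition says that the
  relations agree between different blocks; letting the points vary makes every block an interval of
  both.\<close>

definition blocks :: "'a arcs \<Rightarrow> 'a arcs \<Rightarrow> 'a set \<Rightarrow> 'a set set \<Rightarrow> bool" where
  "blocks r r' V \<P> \<longleftrightarrow> \<Union>\<P> = V \<and> (\<forall>B \<in> \<P>. \<forall>C \<in> \<P>. B \<noteq> C \<longrightarrow> B \<inter> C = {} \<and>
     (\<forall>x \<in> B. \<forall>x' \<in> B. \<forall>y \<in> C. \<forall>y' \<in> C. r x y \<longleftrightarrow> r' x' y'))"

lemma blocks_Union: "blocks r r' V \<P> \<Longrightarrow> \<Union>\<P> = V"
  by (simp add: blocks_def)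

lemma blocks_disjoint:
  "blocks r r' V \<P> \<Longrightarrow> B \<in> \<P> \<Longrightarrow> C \<in> \<P> \<Longrightarrow> x \<in> B \<Longrightarrow> x \<in> C \<Longrightarrow> B = C"
  unfolding blocks_def by (metis IntI empty_iff)

lemma blocks_across:
  assumes "blocks r r' V \<P>" "B \<in> \<P>" "C \<in> \<P>" "B \<noteq> C" "x \<in> B" "x' \<in> B" "y \<in> C" "y' \<in> C"
  shows "r x y \<longleftrightarrow> r' x' y'"
proof -
  have "\<forall>x \<in> B. \<forall>x' \<in> B. \<forall>y \<in> C. \<forall>y' \<in> C. r x y \<longleftrightarrow> r' x' y'"
    using bspec[OF bspec[OF conjunct2[OF assms(1)[unfolded blocks_def]] assms(2)] assms(3)] assms(4)
    by (elim impE conjE)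
  from bspec[OF bspec[OF bspec[OF bspec[OF this assms(5)] assms(6)] assms(7)] assms(8)]
  show ?thesis .
qed

text \<open>The pieces are matched within their blocks, and arcs between two blocks depend on the
  blocks alone.\<close>

lemma blocks_glue:
  assumes bl: "blocks r r' V \<P>" and S: "S \<subseteq> V" "S' \<subseteq> V"
    and glue: "\<And>C. C \<in> \<P> \<Longrightarrow> isom r (S \<inter> C) r' (S' \<inter> C)"
  shows "isom r S r' S'"
proof -
  have "\<forall>C \<in> \<P>. \<exists>f. bij_betw f (S \<inter> C) (S' \<inter> C) \<and>
      (\<forall>x \<in> S \<inter> C. \<forall>y \<in> S \<inter> C. r x y \<longleftrightarrow> r' (f x) (f y))"
    using glue unfolding isom_def by blast
  from bchoice[OF this] obtain f where "\<forall>C \<in> \<P>. bij_betw (f C) (S \<inter> C) (S' \<inter> C) \<and>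
      (\<forall>x \<in> S \<inter> C. \<forall>y \<in> S \<inter> C. r x y \<longleftrightarrow> r' (f C x) (f C y))" ..
  then have f: "\<And>C. C \<in> \<P> \<Longrightarrow> bij_betw (f C) (S \<inter> C) (S' \<inter> C)"
    "\<And>C x y. C \<in> \<P> \<Longrightarrow> x \<in> S \<inter> C \<Longrightarrow> y \<in> S \<inter> C \<Longrightarrow> r x y \<longleftrightarrow> r' (f C x) (f C y)"
    by simp_all
  have U: "\<Union>\<P> = V" using bl by (rule blocks_Union)
  note disj = blocks_disjoint[OF bl] and across = blocks_across[OF bl]
  define c where "c x = (THE C. C \<in> \<P> \<and> x \<in> C)" for x
  have c: "c x = C" if "C \<in> \<P>" "x \<in> C" for x C
    unfolding c_def using that disj by (intro the_equality) auto
  have cP: "c x \<in> \<P>" "x \<in> c x" if "x \<in> V" for x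
    using that U c by auto
  define g where "g x = f (c x) x" for x
  have g: "g x \<in> S' \<inter> c x" if "x \<in> S" for x
  proof -
    have "x \<in> S \<inter> c x" using that S(1) cP(2) by blast
    then show ?thesis unfolding g_def using bij_betwE[OF f(1)[OF cP(1)]] that S(1) by blast
  qed
  have cg: "c (g x) = c x" if "x \<in> S" for x
    using g[OF that] c cP(1) that S(1) by blast
  show ?thesis
  proof (rule isomI[of g])
    show "bij_betw g S S'"
      unfolding bij_betw_def
    proof
      show "inj_on g S"
      proof (rule inj_onI)
        fix x y assume xy: "x \<in> S" "y \<in> S" "g x = g y"
        then have e: "c x = c y" using cg by metis
        have m: "x \<in> S \<inter> c x" "y \<in> S \<inter> c x" using xy S(1) cP(2) e by auto
        have "f (c x) x = f (c x) y" using xy(3) e unfolding g_def by simp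
        with m show "x = y"
          using bij_betw_imp_inj_on[OF f(1)[OF cP(1)]] xy(1) S(1) unfolding inj_on_def by blast
      qed
      show "g ` S = S'"
      proof (intro equalityI subsetI)
        fix y assume y: "y \<in> S'"
        then have cy: "c y \<in> \<P>" "y \<in> S' \<inter> c y" using S(2) cP by auto
        then obtain x where x: "x \<in> S \<inter> c y" "y = f (c y) x"
          using bij_betw_imp_surj_on[OF f(1)[OF cy(1)]] by blast
        then have "c x = c y" using c cy(1) by blast
        then show "y \<in> g ` S" using x unfolding g_def by (intro image_eqI[of _ _ x]) simp_all
      qed (use g in auto)
    qed
    fix x y assume xy: "x \<in> S" "y \<in> S"
    have V: "x \<in> V" "y \<in> V" using xy S(1) by auto
    show "r x y \<longleftrightarrow> r' (g x) (g y)"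
    proof (cases "c x = c y")
      case True
      have m: "x \<in> S \<inter> c x" "y \<in> S \<inter> c x" using xy V cP(2) True by auto
      show ?thesis using f(2)[OF cP(1)[OF V(1)] m] True unfolding g_def by simp
    next
      case False
      have "g x \<in> c x" "g y \<in> c y" using g xy by auto
      then show ?thesis using across[OF cP(1)[OF V(1)] cP(1)[OF V(2)] False] cP(2) V by blast
    qed
  qed
qed

lemma blocks_isom:
  assumes bl: "blocks r r' V \<P>" and "\<And>C. C \<in> \<P> \<Longrightarrow> isom r C r' C"
  shows "isom r V r' V"
proof (rule blocks_glue[OF bl])
  fix C assume C: "C \<in> \<P>"
  then have "V \<inter> C = C" using blocks_Union[OF bl] by blast
  then show "isom r (V \<inter> C) r' (V \<inter> C)" using assms(2)[OF C] by simp
qed simp_all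

section \<open>Counting inside a single block\<close>

lemma eqc_Un:
  assumes "finite \<A>" "finite \<B>" "\<A> \<inter> \<B> = {}" "eqc r r' \<A>" "eqc r r' \<B>"
  shows "eqc r r' (\<A> \<union> \<B>)"
  using assms(4,5) unfolding eqc_def card_itype_Un[OF assms(1-3)] by auto

lemma eqc_lower:
  assumes "finite C" "\<And>j. j < k \<Longrightarrow> eqc r r' (fam C Y {} j)"
  shows "eqc r r' {S. Y \<subseteq> S \<and> S \<subseteq> C \<and> card S < k}"
  using assms(2)
proof (induction k)
  case 0
  then show ?case by (simp add: eqc_def)
next
  case (Suc k)
  have e: "{S. Y \<subseteq> S \<and> S \<subseteq> C \<and> card S < Suc k}
      = {S. Y \<subseteq> S \<and> S \<subseteq> C \<and> card S < k} \<union> fam C Y {} k"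
    by (auto simp: fam_def)
  show ?case
    unfolding e
  proof (rule eqc_Un)
    show "finite {S. Y \<subseteq> S \<and> S \<subseteq> C \<and> card S < k}"
      by (rule finite_subset[of _ "Pow C"]) (use assms(1) in auto)
    show "finite (fam C Y {} k)" by (rule finite_fam[OF assms(1)])
    show "{S. Y \<subseteq> S \<and> S \<subseteq> C \<and> card S < k} \<inter> fam C Y {} k = {}"
      by (auto simp: fam_def)
  qed (use Suc in auto)
qed

text \<open>Since \<open>Y\<close> is nonempty, a set that contains it and leaves \<open>B\<close>
  has fewer than \<open>k\<close> points in every block. Permuting the small subsets of each block
  type by type, with \<open>Y\<close> kept inside those of \<open>B\<close>, and reassembling the
  pieces permutes the crossing sets.\<close>

lemma eqc_crossing:
  assumes fin: "finite V" and bl: "blocks r r' V \<P>" and B: "B \<in> \<P>" "Y \<subseteq> B" "Y \<noteq> {}"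
    and low: "\<And>C j. C \<in> \<P> \<Longrightarrow> j < k \<Longrightarrow> eqc r r' (fam C (if C = B then Y else {}) {} j)"
  shows "eqc r r' {S \<in> fam V Y {} k. \<not> S \<subseteq> B}"
proof -
  have U: "\<Union>\<P> = V" using bl by (rule blocks_Union)
  note disj = blocks_disjoint[OF bl]
  have finC: "finite C" if "C \<in> \<P>" for C using that U fin by (meson Union_upper finite_subset)
  define Yc where "Yc C = (if C = B then Y else {})" for C
  define D where "D C = {S. Yc C \<subseteq> S \<and> S \<subseteq> C \<and> card S < k}" for C
  have "\<forall>C \<in> \<P>. \<exists>\<beta>. bij_betw \<beta> (D C) (D C) \<and> (\<forall>S \<in> D C. isom r S r' (\<beta> S))"
  proof
    fix C assume C: "C \<in> \<P>"
    show "\<exists>\<beta>. bij_betw \<beta> (D C) (D C) \<and> (\<forall>S \<in> D C. isom r S r' (\<beta> S))"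
    proof (rule eqc_bij)
      show "finite (D C)"
        by (rule finite_subset[of _ "Pow C"]) (use finC[OF C] in \<open>auto simp: D_def\<close>)
      show "eqc r r' (D C)"
        unfolding D_def
        by (rule eqc_lower[OF finC[OF C]]) (use low[OF C] in \<open>simp add: Yc_def\<close>)
    qed
  qed
  from bchoice[OF this] obtain \<beta>
    where "\<forall>C \<in> \<P>. bij_betw (\<beta> C) (D C) (D C) \<and> (\<forall>S \<in> D C. isom r S r' (\<beta> C S))" ..
  then have \<beta>: "\<And>C. C \<in> \<P> \<Longrightarrow> bij_betw (\<beta> C) (D C) (D C)"
    "\<And>C S. C \<in> \<P> \<Longrightarrow> S \<in> D C \<Longrightarrow> isom r S r' (\<beta> C S)"
    by simp_all
  let ?X = "{S \<in> fam V Y {} k. \<not> S \<subseteq> B}"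
  define \<Phi> where "\<Phi> S = (\<Union>C \<in> \<P>. \<beta> C (S \<inter> C))" for S
  have SD: "S \<inter> C \<in> D C" if S: "S \<in> ?X" and C: "C \<in> \<P>" for S C
  proof -
    have S': "Y \<subseteq> S" "S \<subseteq> V" "card S = k" "\<not> S \<subseteq> B" using S by (auto simp: fam_def)
    have "S \<inter> C \<noteq> S"
    proof
      assume "S \<inter> C = S"
      then have "Y \<subseteq> C" "S \<subseteq> C" using S'(1) by auto
      then have "C = B" using B disj C by blast
      then show False using \<open>S \<subseteq> C\<close> S'(4) by simp
    qed
    then have "card (S \<inter> C) < k"
      using S'(2,3) fin by (metis Int_lower1 finite_subset psubsetI psubset_card_mono)
    then show ?thesis using S'(1) B(2) by (auto simp: D_def Yc_def)
  qed
  have \<beta>D: "\<beta> C (S \<inter> C) \<in> D C" if "S \<in> ?X" "C \<in> \<P>" for S C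
    using bij_betwE[OF \<beta>(1)] SD that by blast
  have \<Phi>C: "\<Phi> S \<inter> C = \<beta> C (S \<inter> C)" if S: "S \<in> ?X" and C: "C \<in> \<P>" for S C
  proof
    show "\<beta> C (S \<inter> C) \<subseteq> \<Phi> S \<inter> C"
      using \<beta>D[OF S C] C by (auto simp: \<Phi>_def D_def)
    show "\<Phi> S \<inter> C \<subseteq> \<beta> C (S \<inter> C)"
    proof
      fix x assume "x \<in> \<Phi> S \<inter> C"
      then obtain C' where C': "C' \<in> \<P>" "x \<in> \<beta> C' (S \<inter> C')" "x \<in> C" by (auto simp: \<Phi>_def)
      then have "x \<in> C'" using \<beta>D[OF S C'(1)] by (auto simp: D_def)
      then show "x \<in> \<beta> C (S \<inter> C)" using disj C C' by blast
    qed
  qed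
  have \<Phi>V: "\<Phi> S \<subseteq> V" if S: "S \<in> ?X" for S
    using \<beta>D[OF S] U unfolding \<Phi>_def D_def by blast
  have iso: "isom r S r' (\<Phi> S)" if S: "S \<in> ?X" for S
  proof (rule blocks_glue[OF bl])
    show "S \<subseteq> V" using S by (auto simp: fam_def)
    fix C assume C: "C \<in> \<P>"
    show "isom r (S \<inter> C) r' (\<Phi> S \<inter> C)"
      unfolding \<Phi>C[OF S C] by (rule \<beta>(2)[OF C SD[OF S C]])
  qed (rule \<Phi>V[OF S])
  have im: "\<Phi> S \<in> ?X" if S: "S \<in> ?X" for S
  proof -
    have S': "Y \<subseteq> S" "S \<subseteq> V" "card S = k" "\<not> S \<subseteq> B" using S by (auto simp: fam_def)
    have "Y \<subseteq> \<Phi> S" using \<Phi>C[OF S B(1)] \<beta>D[OF S B(1)] by (auto simp: D_def Yc_def)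
    moreover have "card (\<Phi> S) = k" using isom_card[OF iso[OF S]] S'(3) by simp
    moreover have "\<not> \<Phi> S \<subseteq> B"
    proof -
      obtain x C where x: "x \<in> S" "x \<notin> B" "C \<in> \<P>" "x \<in> C" using S'(2,4) U by blast
      have "card (\<Phi> S \<inter> C) = card (S \<inter> C)"
        unfolding \<Phi>C[OF S x(3)] using isom_card[OF \<beta>(2)[OF x(3) SD[OF S x(3)]]] by simp
      moreover have "card (S \<inter> C) > 0" using x finC by (auto simp: card_gt_0_iff)
      ultimately obtain z where "z \<in> \<Phi> S" "z \<in> C" by (metis Int_iff card_gt_0_iff ex_in_conv)
      moreover have "z \<notin> B" using disj[OF B(1) x(3)] x \<open>z \<in> C\<close> by blast
      ultimately show ?thesis by blast
    qed
    ultimately show ?thesis using \<Phi>V[OF S] by (simp add: fam_def)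
  qed
  have inj: "inj_on \<Phi> ?X"
  proof (rule inj_onI)
    fix S S' assume S: "S \<in> ?X" and S': "S' \<in> ?X" and e: "\<Phi> S = \<Phi> S'"
    have "S \<inter> C = S' \<inter> C" if C: "C \<in> \<P>" for C
    proof -
      have "\<beta> C (S \<inter> C) = \<beta> C (S' \<inter> C)" using \<Phi>C[OF S C] \<Phi>C[OF S' C] e by simp
      then show ?thesis
        using bij_betw_imp_inj_on[OF \<beta>(1)[OF C]] SD[OF S C] SD[OF S' C] by (meson inj_onD)
    qed
    moreover have "S \<subseteq> V" "S' \<subseteq> V" using S S' by (auto simp: fam_def)
    ultimately show "S = S'" using U by blast
  qed
  have "finite ?X" using finite_fam[OF fin] by simp
  then have "\<Phi> ` ?X = ?X" by (rule endo_inj_surj) (use inj im in blast)+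
  then have "bij_betw \<Phi> ?X ?X" using inj by (simp add: bij_betw_def)
  then show ?thesis by (rule bij_eqc) (rule iso)
qed

text \<open>Induction on \<open>k\<close> for all blocks at once: the sets through \<open>Y\<close>
  in \<open>V\<close> split into those inside \<open>B\<close> and the crossing ones, which are
  settled by smaller sizes. As crossing sets need a nonempty \<open>Y\<close>, the empty one is
  obtained by averaging over single points.\<close>

lemma blocks_eqc:
  assumes fin: "finite V" and bl: "blocks r r' V \<P>"
    and K: "\<And>Y k. Y \<subseteq> V \<Longrightarrow> card Y \<le> 3 \<Longrightarrow> k \<le> K \<Longrightarrow> eqc r r' (fam V Y {} k)"
    and B: "B \<in> \<P>" "Y \<subseteq> B" "card Y \<le> 3" and k: "k \<le> K"
  shows "eqc r r' (fam B Y {} k)"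
  using B k
proof (induction k arbitrary: B Y rule: less_induct)
  case (less k)
  have U: "\<Union>\<P> = V" using bl unfolding blocks_def by blast
  have main: "eqc r r' (fam B Y {} k)" if Y: "Y \<subseteq> B" "card Y \<le> 3" "Y \<noteq> {}" for Y
  proof (rule eqc_diff)
    show "finite {S \<in> fam V Y {} k. \<not> S \<subseteq> B}" using finite_fam[OF fin] by simp
    show "finite (fam B Y {} k)"
      using less.prems(1) U fin by (meson Union_upper finite_subset finite_fam)
    show "{S \<in> fam V Y {} k. \<not> S \<subseteq> B} \<inter> fam B Y {} k = {}" by (auto simp: fam_def)
    have e: "{S \<in> fam V Y {} k. \<not> S \<subseteq> B} \<union> fam B Y {} k = fam V Y {} k"
      using less.prems(1) U by (auto simp: fam_def)
    show "eqc r r' ({S \<in> fam V Y {} k. \<not> S \<subseteq> B} \<union> fam B Y {} k)"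
      unfolding e by (rule K) (use Y less.prems U in auto)
    show "eqc r r' {S \<in> fam V Y {} k. \<not> S \<subseteq> B}"
    proof (rule eqc_crossing[OF fin bl less.prems(1) Y(1,3)])
      fix C j assume "C \<in> \<P>" "j < k"
      then show "eqc r r' (fam C (if C = B then Y else {}) {} j)"
        using less.IH[of j C] Y less.prems(4) by auto
    qed
  qed
  show ?case
  proof (cases "Y = {}")
    case False
    then show ?thesis using main less.prems by blast
  next
    case True
    show ?thesis
    proof (cases "k = 0")
      case True
      have fB: "finite B" using less.prems(1) U fin by (meson Union_upper finite_subset)
      have "fam B {} {} 0 = {{}}"
        unfolding fam_def using fB finite_subset[of _ B] by auto
      moreover have "isom r {} r' {}" by (rule isomI[of id]) (simp_all add: bij_betw_def)
      then have "eqc r r' {{}}" by (intro bij_eqc[of id]) auto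
      ultimately show ?thesis using \<open>Y = {}\<close> True by simp
    next
      case False
      show ?thesis
        unfolding \<open>Y = {}\<close>
      proof (rule eqc_average_containing)
        show "finite B" using less.prems(1) U fin by (meson Union_upper finite_subset)
        show "0 < k" using False by simp
        fix a assume "a \<in> B"
        then show "eqc r r' (fam B {a} {} k)" by (intro main) auto
      qed
    qed
  qed
qed

section \<open>Tournaments with the same 3-cycles\<close>

definition cyc3 :: "'a arcs \<Rightarrow> 'a \<Rightarrow> 'a \<Rightarrow> 'a \<Rightarrow> bool" where
  "cyc3 r a b c \<longleftrightarrow> (r a b \<and> r b c \<and> r c a) \<or> (r b a \<and> r c b \<and> r a c)"

definition same3 :: "'a arcs \<Rightarrow> 'a arcs \<Rightarrow> 'a set \<Rightarrow> bool" where
  "same3 r r' V \<longleftrightarrow> (\<forall>a \<in> V. \<forall>b \<in> V. \<forall>c \<in> V. cyc3 r a b c \<longleftrightarrow> cyc3 r' a b c)"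

definition interval :: "'a arcs \<Rightarrow> 'a set \<Rightarrow> 'a set \<Rightarrow> bool" where
  "interval r V J \<longleftrightarrow> J \<subseteq> V \<and>
     (\<forall>x \<in> V - J. \<forall>a \<in> J. \<forall>b \<in> J. (r x a \<longleftrightarrow> r x b) \<and> (r a x \<longleftrightarrow> r b x))"

definition agr :: "'a arcs \<Rightarrow> 'a arcs \<Rightarrow> 'a \<Rightarrow> 'a \<Rightarrow> bool" where
  "agr r r' x y \<longleftrightarrow> x \<noteq> y \<and> (r x y \<longleftrightarrow> r' x y)"

definition rvs :: "'a arcs \<Rightarrow> 'a arcs \<Rightarrow> 'a \<Rightarrow> 'a \<Rightarrow> bool" where
  "rvs r r' x y \<longleftrightarrow> x \<noteq> y \<and> (r x y \<longleftrightarrow> \<not> r' x y)"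

text \<open>Strong connectivity in cut form; applied to the complement of a set it also gives an arc
  leaving that set.\<close>

definition strong :: "'a arcs \<Rightarrow> 'a set \<Rightarrow> bool" where
  "strong r V \<longleftrightarrow> (\<forall>U \<subseteq> V. U \<noteq> {} \<longrightarrow> U \<noteq> V \<longrightarrow> (\<exists>u \<in> U. \<exists>w \<in> V - U. r w u))"

definition conn :: "'a arcs \<Rightarrow> 'a set \<Rightarrow> bool" where
  "conn g V \<longleftrightarrow> (\<forall>U \<subseteq> V. U \<noteq> {} \<longrightarrow> U \<noteq> V \<longrightarrow> (\<exists>u \<in> U. \<exists>w \<in> V - U. g u w))"

definition cls :: "'a arcs \<Rightarrow> 'a set \<Rightarrow> 'a \<Rightarrow> 'a set" where
  "cls g V v = {w. (v, w) \<in> {(a, b). a \<in> V \<and> b \<in> V \<and> g a b}\<^sup>*}"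

lemma strongD: "strong r V \<Longrightarrow> U \<subseteq> V \<Longrightarrow> U \<noteq> {} \<Longrightarrow> U \<noteq> V \<Longrightarrow> \<exists>u \<in> U. \<exists>w \<in> V - U. r w u"
  by (simp add: strong_def)

lemma connD: "conn g V \<Longrightarrow> U \<subseteq> V \<Longrightarrow> U \<noteq> {} \<Longrightarrow> U \<noteq> V \<Longrightarrow> \<exists>u \<in> U. \<exists>w \<in> V - U. g u w"
  by (simp add: conn_def)

lemma same3D: "same3 r r' V \<Longrightarrow> a \<in> V \<Longrightarrow> b \<in> V \<Longrightarrow> c \<in> V \<Longrightarrow> cyc3 r a b c \<longleftrightarrow> cyc3 r' a b c"
  by (simp add: same3_def)

lemma same3_subset: "same3 r r' V \<Longrightarrow> W \<subseteq> V \<Longrightarrow> same3 r r' W"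
  unfolding same3_def by blast

lemma cyc3_dual: "cyc3 (opp r) a b c \<longleftrightarrow> cyc3 r a b c"
  unfolding cyc3_def conversep_iff by blast

lemma interval_dual [simp]: "interval (opp r) V J \<longleftrightarrow> interval r V J"
  unfolding interval_def conversep_iff by blast

lemma intervalD:
  assumes "interval r V J" "x \<in> V" "x \<notin> J" "a \<in> J" "b \<in> J"
  shows "r x a \<longleftrightarrow> r x b" "r a x \<longleftrightarrow> r b x"
  using assms unfolding interval_def by blast+

lemma intervalI:
  assumes "tour r V" "J \<subseteq> V" "\<And>x a b. x \<in> V \<Longrightarrow> x \<notin> J \<Longrightarrow> a \<in> J \<Longrightarrow> b \<in> J \<Longrightarrow> r x a \<Longrightarrow> r x b"
  shows "interval r V J"
  unfolding interval_def
proof (intro conjI ballI assms(2))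
  fix x a b assume x: "x \<in> V - J" and ab: "a \<in> J" "b \<in> J"
  show e: "r x a \<longleftrightarrow> r x b" using assms(3)[of x a b] assms(3)[of x b a] x ab by blast
  have "r a x \<longleftrightarrow> \<not> r x a" "r b x \<longleftrightarrow> \<not> r x b"
    using tour_flip[OF assms(1), of x a] tour_flip[OF assms(1), of x b] x ab assms(2) by blast+
  with e show "r a x \<longleftrightarrow> r b x" by simp
qed

lemma interval_trans:
  assumes "interval r V N" "interval r N J" shows "interval r V J"
  unfolding interval_def
proof (intro conjI ballI)
  have JN: "J \<subseteq> N" "N \<subseteq> V" using assms by (auto simp: interval_def)
  then show "J \<subseteq> V" by simp
  fix x a b assume x: "x \<in> V - J" and ab: "a \<in> J" "b \<in> J"
  then have m: "x \<in> V" "x \<notin> J" "a \<in> N" "b \<in> N" using JN by auto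
  show "r x a \<longleftrightarrow> r x b"
    using intervalD(1)[OF assms(1) m(1) _ m(3,4)] intervalD(1)[OF assms(2) _ m(2) ab] by blast
  show "r a x \<longleftrightarrow> r b x"
    using intervalD(2)[OF assms(1) m(1) _ m(3,4)] intervalD(2)[OF assms(2) _ m(2) ab] by blast
qed

lemma agr_sym: "tour r V \<Longrightarrow> tour r' V \<Longrightarrow> x \<in> V \<Longrightarrow> y \<in> V \<Longrightarrow> agr r r' x y \<longleftrightarrow> agr r r' y x"
  unfolding agr_def using tour_flip[of r V x y] tour_flip[of r' V x y] by blast

lemma rvs_sym: "tour r V \<Longrightarrow> tour r' V \<Longrightarrow> x \<in> V \<Longrightarrow> y \<in> V \<Longrightarrow> rvs r r' x y \<longleftrightarrow> rvs r r' y x"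
  unfolding rvs_def using tour_flip[of r V x y] tour_flip[of r' V x y] by blast

lemma rvs_iff: "x \<noteq> y \<Longrightarrow> rvs r r' x y \<longleftrightarrow> \<not> agr r r' x y"
  by (simp add: rvs_def agr_def)

lemma agr_dual: "tour r' V \<Longrightarrow> x \<in> V \<Longrightarrow> y \<in> V \<Longrightarrow> agr r (opp r') x y \<longleftrightarrow> rvs r r' x y"
  unfolding agr_def rvs_def conversep_iff using tour_flip[of r' V x y] by blast

lemma rvs_dual: "tour r' V \<Longrightarrow> x \<in> V \<Longrightarrow> y \<in> V \<Longrightarrow> rvs r (opp r') x y \<longleftrightarrow> agr r r' x y"
  unfolding agr_def rvs_def conversep_iff using tour_flip[of r' V x y] by blast

lemma same3_dual_right: "same3 r (opp r') V \<longleftrightarrow> same3 r r' V"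
  by (simp add: same3_def cyc3_dual)

lemma conn_cong: "(\<And>x y. x \<in> V \<Longrightarrow> y \<in> V \<Longrightarrow> g x y \<longleftrightarrow> h x y) \<Longrightarrow> conn g V \<longleftrightarrow> conn h V"
  unfolding conn_def by (intro all_cong imp_cong refl bex_cong) auto

section \<open>Components of a graph on the vertices and when they are intervals\<close>

lemma cls_self: "v \<in> cls g V v"
  by (simp add: cls_def)

lemma cls_subset: "v \<in> V \<Longrightarrow> cls g V v \<subseteq> V"
proof
  fix w assume "w \<in> cls g V v" "v \<in> V"
  then have "(v, w) \<in> {(a, b). a \<in> V \<and> b \<in> V \<and> g a b}\<^sup>*" by (simp add: cls_def)
  then show "w \<in> V" using \<open>v \<in> V\<close> by induction auto
qed

lemma cls_step: "a \<in> cls g V v \<Longrightarrow> v \<in> V \<Longrightarrow> b \<in> V \<Longrightarrow> g a b \<Longrightarrow> b \<in> cls g V v"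
  using cls_subset[of v V g] unfolding cls_def by (auto intro: rtrancl_into_rtrancl)

lemma cls_induct [consumes 1, case_names self step]:
  assumes "w \<in> cls g V v" "P v"
    and "\<And>a b. a \<in> cls g V v \<Longrightarrow> a \<in> V \<Longrightarrow> b \<in> V \<Longrightarrow> g a b \<Longrightarrow> P a \<Longrightarrow> P b"
  shows "P w"
proof -
  have "(v, w) \<in> {(a, b). a \<in> V \<and> b \<in> V \<and> g a b}\<^sup>*" using assms(1) by (simp add: cls_def)
  then show ?thesis
    by (induction rule: rtrancl_induct) (use assms(2,3) in \<open>auto simp: cls_def\<close>)
qed

lemma cls_eq:
  assumes "\<And>a b. a \<in> V \<Longrightarrow> b \<in> V \<Longrightarrow> g a b \<Longrightarrow> g b a" "w \<in> cls g V v"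
  shows "cls g V w = cls g V v"
proof -
  let ?R = "{(a, b). a \<in> V \<and> b \<in> V \<and> g a b}"
  have "sym ?R" using assms(1) by (auto simp: sym_def)
  then have s: "sym (?R\<^sup>*)" by (rule sym_rtrancl)
  have vw: "(v, w) \<in> ?R\<^sup>*" using assms(2) by (simp add: cls_def)
  then have "(w, v) \<in> ?R\<^sup>*" using s by (simp add: sym_def)
  with vw show ?thesis unfolding cls_def by (auto intro: rtrancl_trans)
qed

lemma cls_Union: "\<Union> (cls g V ` V) = V"
  using cls_subset[of _ V g] cls_self[of _ g V] by blast

lemma cls_disjoint:
  assumes "\<And>a b. a \<in> V \<Longrightarrow> b \<in> V \<Longrightarrow> g a b \<Longrightarrow> g b a" "cls g V u \<noteq> cls g V v"
  shows "cls g V u \<inter> cls g V v = {}"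
proof (rule ccontr)
  assume "\<not> ?thesis"
  then obtain z where z: "z \<in> cls g V u" "z \<in> cls g V v" by blast
  from cls_eq[OF assms(1) z(1)] cls_eq[OF assms(1) z(2)] show False using assms(2) by simp
qed

lemma cls_conn:
  assumes "v \<in> V" "cls g V v = V" "\<And>a b. a \<in> V \<Longrightarrow> b \<in> V \<Longrightarrow> g a b \<Longrightarrow> g b a"
  shows "conn g V"
  unfolding conn_def
proof (intro allI impI)
  fix U assume U: "U \<subseteq> V" "U \<noteq> {}" "U \<noteq> V"
  obtain u where u: "u \<in> U" using U(2) by blast
  have "cls g V u = cls g V v"
    by (rule cls_eq[OF assms(3)]) (use u U(1) assms(2) in auto)
  then have cu: "cls g V u = V" using assms(2) by simp
  show "\<exists>u \<in> U. \<exists>w \<in> V - U. g u w"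
  proof (rule ccontr)
    assume n: "\<not> ?thesis"
    have "w \<in> U" if "w \<in> cls g V u" for w
      using that
    proof (induction rule: cls_induct)
      case (step a b)
      then show ?case using n by blast
    qed (rule u)
    then show False using cu U by blast
  qed
qed

text \<open>A point outside the component is adjacent to none of it, so the forcing rule carries its
  arc direction along paths. This serves the difference graph, the agreement graph and the graph of
  pairs lying on a common 3-cycle.\<close>

lemma cls_interval:
  assumes T: "tour r V" and v: "v \<in> V"
    and s: "\<And>a b. a \<in> V \<Longrightarrow> b \<in> V \<Longrightarrow> g a b \<Longrightarrow> g b a"
    and g: "\<And>a b x. a \<in> V \<Longrightarrow> b \<in> V \<Longrightarrow> x \<in> V \<Longrightarrow> x \<noteq> a \<Longrightarrow> x \<noteq> b \<Longrightarrow> g a b \<Longrightarrow>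
      \<not> g x a \<Longrightarrow> \<not> g x b \<Longrightarrow> r x a \<longleftrightarrow> r x b"
  shows "interval r V (cls g V v)"
proof (rule intervalI[OF T cls_subset[OF v]])
  have *: "r x w = r x v" if x: "x \<in> V" "x \<notin> cls g V v" and w: "w \<in> cls g V v" for x w
    using w
  proof (induction rule: cls_induct)
    case (step a b)
    then have b: "b \<in> cls g V v" using cls_step v by metis
    have ne: "x \<noteq> a" "x \<noteq> b" using x(2) step(1) b by auto
    have n: "\<not> g x a" "\<not> g x b"
      using cls_step[OF step(1) v x(1)] cls_step[OF b v x(1)] s[OF x(1)] x(2) step(2,3) by blast+
    show ?case using g[OF step(2,3) x(1) ne step(4) n] step(5) by simp
  qed simp
  fix x a b assume "x \<in> V" "x \<notin> cls g V v" "a \<in> cls g V v" "b \<in> cls g V v" "r x a"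
  then show "r x b" using *[of x a] *[of x b] by simp
qed

text \<open>If \<open>x\<close> were between \<open>a\<close> and \<open>b\<close>, reversing only
  the arc \<open>ab\<close> would make the triple a 3-cycle in exactly one of the two
  relations.\<close>

lemma rvs_forces:
  assumes "tour r V" "tour r' V" "same3 r r' V" "a \<in> V" "b \<in> V" "x \<in> V" "x \<noteq> a" "x \<noteq> b"
    and "rvs r r' a b" "\<not> rvs r r' x a" "\<not> rvs r r' x b"
  shows "r x a \<longleftrightarrow> r x b"
proof -
  have ab: "a \<noteq> b" using assms(9) by (simp add: rvs_def)
  note f = tour_flip[OF assms(1)] tour_flip[OF assms(2)]
  have "r b a \<longleftrightarrow> \<not> r a b" "r a x \<longleftrightarrow> \<not> r x a" "r b x \<longleftrightarrow> \<not> r x b"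
    "r' b a \<longleftrightarrow> \<not> r' a b" "r' a x \<longleftrightarrow> \<not> r' x a" "r' b x \<longleftrightarrow> \<not> r' x b"
    using f(1)[of b a] f(1)[of a x] f(1)[of b x] f(2)[of b a] f(2)[of a x] f(2)[of b x] ab assms(4-8) by blast+
  then show ?thesis
    using same3D[OF assms(3-6)] assms(7-11) ab unfolding cyc3_def rvs_def by auto
qed

text \<open>Replacing \<open>r'\<close> by its converse exchanges agreement and reversal and keeps
  the 3-cycles.\<close>

lemma agr_forces:
  assumes "tour r V" "tour r' V" "same3 r r' V" "a \<in> V" "b \<in> V" "x \<in> V" "x \<noteq> a" "x \<noteq> b"
    and "agr r r' a b" "\<not> agr r r' x a" "\<not> agr r r' x b"
  shows "r x a \<longleftrightarrow> r x b"
  using rvs_forces[of r V "opp r'" a b x] assms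
  by (simp add: same3_dual_right rvs_dual[of r' V])

lemma rvs_cls_interval:
  assumes "tour r V" "tour r' V" "same3 r r' V" "v \<in> V"
  shows "interval r V (cls (rvs r r') V v)"
proof (rule cls_interval[OF assms(1,4)])
  show "rvs r r' b a" if "a \<in> V" "b \<in> V" "rvs r r' a b" for a b
    using rvs_sym[OF assms(1,2) that(1,2)] that(3) by simp
qed (rule rvs_forces[OF assms(1-3)])

lemma agr_cls_interval:
  assumes "tour r V" "tour r' V" "same3 r r' V" "v \<in> V"
  shows "interval r V (cls (agr r r') V v)"
proof (rule cls_interval[OF assms(1,4)])
  show "agr r r' b a" if "a \<in> V" "b \<in> V" "agr r r' a b" for a b
    using agr_sym[OF assms(1,2) that(1,2)] that(3) by simp
qed (rule agr_forces[OF assms(1-3)])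

lemma same3_sym: "same3 r r' V \<longleftrightarrow> same3 r' r V"
  unfolding same3_def by blast

lemma rvs_commute: "rvs r r' = rvs r' r"
  by (intro ext) (auto simp: rvs_def)

lemma agr_commute: "agr r r' = agr r' r"
  by (intro ext) (auto simp: agr_def)

subsection \<open>Strong tournaments\<close>

lemma strong_insert:
  assumes "strong r S" "S \<noteq> {}" "x \<notin> S" "a \<in> S" "r x a" "b \<in> S" "r b x"
  shows "strong r (insert x S)"
  unfolding strong_def
proof (intro allI impI)
  fix U assume U: "U \<subseteq> insert x S" "U \<noteq> {}" "U \<noteq> insert x S"
  consider "U \<inter> S = {}" | "S \<subseteq> U" | "U \<inter> S \<noteq> {}" "U \<inter> S \<noteq> S" by blast
  then show "\<exists>u \<in> U. \<exists>w \<in> insert x S - U. r w u"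
  proof cases
    case 1
    then have "U = {x}" using U by blast
    then show ?thesis using assms by auto
  next
    case 2
    then have "U = S" using U by blast
    then show ?thesis using assms by auto
  next
    case 3
    then have "\<exists>u \<in> U \<inter> S. \<exists>w \<in> S - U \<inter> S. r w u"
      by (intro strongD[OF assms(1)]) auto
    then show ?thesis by blast
  qed
qed

text \<open>Every point of \<open>P\<close> lies on a 3-cycle with \<open>a\<close> and
  \<open>b\<close>, whatever the arcs inside \<open>P\<close> are.\<close>

lemma strong_three_parts:
  assumes "P \<noteq> {}" "\<And>p. p \<in> P \<Longrightarrow> r a p" "\<And>p. p \<in> P \<Longrightarrow> r p b" "r b a"
  shows "strong r (insert a (insert b P))"
  unfolding strong_def
proof (intro allI impI)
  fix U assume U: "U \<subseteq> insert a (insert b P)" "U \<noteq> {}" "U \<noteq> insert a (insert b P)"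
  show "\<exists>u \<in> U. \<exists>w \<in> insert a (insert b P) - U. r w u"
  proof (rule ccontr)
    assume n: "\<not> ?thesis"
    show False
    proof (cases "a \<in> U")
      case True
      then have "b \<in> U" using n assms(4) by blast
      then have "P \<subseteq> U" using n assms(3) by blast
      then show False using True \<open>b \<in> U\<close> U by blast
    next
      case False
      then have "P \<inter> U = {}" using n assms(2) by blast
      then have "U = {b}" using False U by blast
      then show False using n assms(1,3) \<open>P \<inter> U = {}\<close> by blast
    qed
  qed
qed

text \<open>An arc leaving the out-neighbourhood of \<open>v\<close> cannot end in \<open>v\<close>,
  hence ends in an in-neighbour of \<open>v\<close> and closes a 3-cycle.\<close>

lemma strong_cycle:
  assumes T: "tour r V" and "strong r V" "card V \<ge> 2"
  obtains a b c where "a \<in> V" "b \<in> V" "c \<in> V" "r a b" "r b c" "r c a"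
proof -
  obtain v where v: "v \<in> V" using assms(3) by fastforce
  define O1 where "O1 = {w \<in> V. r v w}"
  have "V - {v} \<noteq> {}"
  proof
    assume "V - {v} = {}"
    then have "V = {v}" using v by blast
    then show False using assms(3) by simp
  qed
  then have "\<exists>u \<in> V - {v}. \<exists>w \<in> V - (V - {v}). r w u"
    by (intro strongD[OF assms(2)]) (use v in auto)
  then have O: "O1 \<noteq> {}" using v by (auto simp: O1_def)
  have "V - O1 \<noteq> {}" using v tour_irrefl[OF T] by (auto simp: O1_def)
  then have "\<exists>u \<in> V - O1. \<exists>w \<in> V - (V - O1). r w u"
    by (intro strongD[OF assms(2)]) (use O in \<open>auto simp: O1_def\<close>)
  then obtain u w where uw: "u \<in> V" "\<not> r v u" "w \<in> V" "r v w" "r w u" by (auto simp: O1_def)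
  have "u \<noteq> v" using uw tour_asym[OF T] v by blast
  then have "r u v" using tour_flip[OF T v uw(1)] uw(2) by blast
  then show thesis using that v uw by blast
qed

text \<open>Take a largest proper strong subset \<open>S\<close>. Unless it misses a single point,
  each outer point dominates \<open>S\<close> or is dominated by it, since otherwise it could be
  added.\<close>

lemma strong_delete:
  assumes T: "tour r V" and st: "strong r V" and c4: "card V \<ge> 4"
  obtains v where "v \<in> V" "strong r (V - {v})"
proof -
  have fin: "finite V" using T by (rule tour_finite)
  obtain a b c where abc: "a \<in> V" "b \<in> V" "c \<in> V" "r a b" "r b c" "r c a"
    by (rule strong_cycle[OF T st]) (use c4 in auto)
  define Q where "Q S \<longleftrightarrow> S \<subseteq> V \<and> S \<noteq> V \<and> card S \<ge> 3 \<and> strong r S" for S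
  have ne: "a \<noteq> b" "b \<noteq> c" "a \<noteq> c" using abc tour_irrefl[OF T] tour_asym[OF T] by blast+
  have "strong r (insert c (insert b {a}))"
    by (rule strong_three_parts) (use abc in auto)
  moreover have "card (insert c (insert b {a})) = 3" using ne by simp
  moreover have "insert c (insert b {a}) \<noteq> V" using c4 calculation(2) by auto
  ultimately have Q0: "Q (insert c (insert b {a}))" using abc by (simp add: Q_def)
  have "\<exists>S. Q S \<and> (\<forall>S'. Q S' \<longrightarrow> card S' \<le> card S)"
  proof (rule ex_has_greatest_nat[where P = Q])
    show "\<forall>S. Q S \<longrightarrow> card S < Suc (card V)" using fin by (auto simp: Q_def less_Suc_eq_le card_mono)
  qed (rule Q0)
  then obtain S where S: "Q S" "\<And>S'. Q S' \<Longrightarrow> card S' \<le> card S" by blast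
  have SV: "S \<subseteq> V" "S \<noteq> V" "card S \<ge> 3" "strong r S" using S(1) by (auto simp: Q_def)
  have fS: "finite S" using SV(1) fin finite_subset by blast
  have Sne: "S \<noteq> {}" using SV(3) by auto
  show thesis
  proof (cases "\<exists>v. v \<in> V \<and> V - {v} = S")
    case True
    then show thesis using that SV(4) by blast
  next
    case False
    have dich: "(\<forall>s \<in> S. r x s) \<or> (\<forall>s \<in> S. r s x)" if x: "x \<in> V - S" for x
    proof (rule ccontr)
      assume "\<not> ?thesis"
      then obtain s t where st: "s \<in> S" "\<not> r x s" "t \<in> S" "\<not> r t x" by blast
      then have "r s x" "r x t" using tour_flip[OF T] x SV(1) by blast+
      then have "strong r (insert x S)"
        using strong_insert[OF SV(4) Sne _ st(3) _ st(1)] x by blast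
      moreover have "insert x S \<noteq> V" using False x by blast
      moreover have "card (insert x S) = Suc (card S)" using x fS by simp
      ultimately have "Q (insert x S)" using x SV by (simp add: Q_def)
      then show False using S(2)[of "insert x S"] \<open>card (insert x S) = Suc (card S)\<close> by simp
    qed
    define A where "A = {x \<in> V - S. \<forall>s \<in> S. r x s}"
    define B where "B = {x \<in> V - S. \<forall>s \<in> S. r s x}"
    have AB: "V = S \<union> A \<union> B" using dich SV(1) by (auto simp: A_def B_def)
    have "\<exists>u \<in> S. \<exists>w \<in> V - S. r w u"
      by (rule strongD[OF st SV(1) Sne SV(2)])
    then obtain u w where "u \<in> S" "w \<in> V - S" "r w u" by blast
    then have Ane: "A \<noteq> {}"
      using dich[of w] tour_asym[OF T, of w u] SV(1) by (auto simp: A_def)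
    have "A \<subseteq> V" "A \<noteq> V" using Sne SV(1) by (auto simp: A_def)
    then have "\<exists>u \<in> A. \<exists>w \<in> V - A. r w u" using strongD[OF st] Ane by blast
    then obtain p q where pq: "p \<in> A" "q \<in> V" "q \<notin> A" "r q p" by blast
    have "q \<notin> S" using pq tour_asym[OF T, of q p] by (auto simp: A_def)
    then have q: "q \<in> B" using pq AB by blast
    have "strong r (insert p (insert q S))"
      by (rule strong_three_parts) (use Sne pq q in \<open>auto simp: A_def B_def\<close>)
    moreover have "card S < card (insert p (insert q S))"
      using fS pq(1) by (intro psubset_card_mono) (auto simp: A_def)
    ultimately have "insert p (insert q S) = V"
      using S(2)[of "insert p (insert q S)"] pq q SV unfolding Q_def A_def B_def by auto
    moreover obtain s where s: "s \<in> S" using Sne by blast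
    moreover have "p \<noteq> s" "q \<noteq> s" using s pq q by (auto simp: A_def B_def)
    ultimately have V: "V - {s} = insert p (insert q (S - {s}))" by blast
    have "S - {s} \<noteq> {}"
    proof
      assume "S - {s} = {}"
      then have "S = {s}" using s by blast
      then show False using SV(3) by simp
    qed
    then have "strong r (V - {s})"
      unfolding V by (rule strong_three_parts) (use pq q in \<open>auto simp: A_def B_def\<close>)
    then show thesis using that s SV(1) by blast
  qed
qed

text \<open>The arcs from \<open>v\<close> to the pieces of \<open>V - {v}\<close> would make one piece dominate, or be dominated by,
  all others.\<close>

lemma not_both_connected_step:
  assumes T: "tour r V" "tour r' V" and s3: "same3 r r' V" and v: "v \<in> V" "V \<noteq> {v}"
    and st: "strong r (V - {v})" and nc: "\<not> conn (rvs r r') (V - {v})"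
    and ca: "conn (agr r r') V" and cr: "conn (rvs r r') V"
  shows False
proof -
  let ?W = "V - {v}"
  let ?C = "cls (rvs r r') ?W"
  have T': "tour r ?W" "tour r' ?W" and s3': "same3 r r' ?W"
    using T s3 by (auto intro: tour_subset same3_subset)
  have sym: "rvs r r' b a" if "a \<in> ?W" "b \<in> ?W" "rvs r r' a b" for a b
    using rvs_sym[OF T'(1,2) that(1,2)] that(3) by simp
  have CW: "?C w \<noteq> ?W" if "w \<in> ?W" for w
  proof
    assume "?C w = ?W"
    from cls_conn[OF that this sym] show False using nc by simp
  qed
  have sub: "?C w \<subseteq> ?W" if "w \<in> ?W" for w using cls_subset[OF that] .
  have int: "interval r ?W (?C w)" if "w \<in> ?W" for w
    by (rule rvs_cls_interval[OF T' s3' that])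
  have "\<exists>u \<in> {v}. \<exists>w \<in> V - {v}. agr r r' u w"
    by (rule connD[OF ca]) (use v in auto)
  then obtain u where u: "u \<in> ?W" "agr r r' v u" by blast
  \<comment> \<open>Connectedness on \<open>V\<close> must leave each component of
    \<open>V - {v}\<close>, and the only way out is through \<open>v\<close>.\<close>
  have touch: "\<exists>c \<in> ?C w. rvs r r' c v" if w: "w \<in> ?W" for w
  proof -
    have "\<exists>c \<in> ?C w. \<exists>z \<in> V - ?C w. rvs r r' c z"
      by (rule connD[OF cr]) (use sub[OF w] cls_self[of w] v in auto)
    then obtain c z where c: "c \<in> ?C w" "z \<in> V" "z \<notin> ?C w" "rvs r r' c z" by blast
    have "z = v" using cls_step[OF c(1) w, of z] c by blast
    then show ?thesis using c by blast
  qed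
  \<comment> \<open>In the triple \<open>v\<close>, \<open>u\<close>, \<open>c\<close> only the arc
    between \<open>c\<close> and \<open>v\<close> is reversed, so \<open>u\<close> sees both alike;
    the component of \<open>c\<close> is an interval, which carries this over to
    \<open>w\<close>.\<close>
  have key: "r v u \<longleftrightarrow> r w u" if w: "w \<in> ?W" "w \<notin> ?C u" for w
  proof -
    obtain c where c: "c \<in> ?C w" "rvs r r' c v" using touch[OF w(1)] by blast
    have uw: "u \<notin> ?C w"
    proof
      assume "u \<in> ?C w"
      from cls_eq[OF sym this] have "?C u = ?C w" .
      then show False using w(2) cls_self by metis
    qed
    have cW: "c \<in> ?W" using c(1) sub[OF w(1)] by blast
    have cu: "c \<noteq> u" using c(1) uw by blast
    have "\<not> rvs r r' c u" using cls_step[OF c(1) w(1) u(1)] uw by blast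
    then have a: "agr r r' c u" using rvs_iff[OF cu] by blast
    have V: "c \<in> V" "u \<in> V" "v \<in> V" "c \<noteq> v" "u \<noteq> v" using cW u v by auto
    have "r u v \<longleftrightarrow> \<not> r v u" "r v c \<longleftrightarrow> \<not> r c v" "r u c \<longleftrightarrow> \<not> r c u"
      "r' u v \<longleftrightarrow> \<not> r' v u" "r' v c \<longleftrightarrow> \<not> r' c v" "r' u c \<longleftrightarrow> \<not> r' c u"
      using tour_flip[OF T(1)] tour_flip[OF T(2)] V cu by blast+
    then have "r v u \<longleftrightarrow> r c u"
      using same3D[OF s3 V(3,2,1)] a c(2) u(2) unfolding cyc3_def agr_def rvs_def by auto
    moreover have "r c u \<longleftrightarrow> r w u"
      using intervalD(2)[OF int[OF w(1)] u(1) uw c(1) cls_self] .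
    ultimately show ?thesis by simp
  qed
  have uu: "u \<in> ?C u" by (rule cls_self)
  show False
  proof (cases "r v u")
    case True
    have "\<exists>x \<in> ?W - ?C u. \<exists>y \<in> ?W - (?W - ?C u). r y x"
      by (rule strongD[OF st]) (use CW[OF u(1)] sub[OF u(1)] uu u(1) in auto)
    then obtain x y where xy: "x \<in> ?W" "x \<notin> ?C u" "y \<in> ?C u" "r y x" by blast
    have "r x u" using key[OF xy(1,2)] True by simp
    then have "r x y" using intervalD(1)[OF int[OF u(1)] xy(1,2) uu xy(3)] by simp
    then show False using tour_asym[OF T'(1) xy(1) _ \<open>r x y\<close>] xy(3,4) sub[OF u(1)] by blast
  next
    case False
    have "\<exists>x \<in> ?C u. \<exists>y \<in> ?W - ?C u. r y x"
      by (rule strongD[OF st]) (use CW[OF u(1)] sub[OF u(1)] uu in auto)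
    then obtain x y where xy: "x \<in> ?C u" "y \<in> ?W" "y \<notin> ?C u" "r y x" by blast
    have "r y u" using intervalD(1)[OF int[OF u(1)] xy(2,3) xy(1) uu] xy(4) by simp
    then show False using key[OF xy(2,3)] False by simp
  qed
qed

text \<open>Induction by deleting a vertex that leaves a strong tournament, one of whose two graphs
  is then disconnected; if it is the agreement graph, dualising \<open>r'\<close> exchanges the
  graphs. At three points \<open>V\<close> is a 3-cycle, where all pairs agree or all are
  reversed.\<close>

lemma not_both_connected:
  assumes "tour r V" "tour r' V" "same3 r r' V" "strong r V" "card V \<ge> 2"
  shows "\<not> (conn (agr r r') V \<and> conn (rvs r r') V)"
  using assms
proof (induction "card V" arbitrary: V r' rule: less_induct)
  case less
  note T = less.prems(1,2) and s3 = less.prems(3) and st = less.prems(4)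
  have fin: "finite V" using T(1) by (rule tour_finite)
  show ?case
  proof (cases "card V \<ge> 4")
    case True
    obtain v where v: "v \<in> V" "strong r (V - {v})" by (rule strong_delete[OF T(1) st True])
    have c: "card (V - {v}) = card V - 1" using v fin by simp
    have T': "tour r (V - {v})" "tour r' (V - {v})" and s3': "same3 r r' (V - {v})"
      using T s3 by (auto intro: tour_subset same3_subset)
    have Vv: "V \<noteq> {v}" using True by auto
    have "\<not> (conn (agr r r') (V - {v}) \<and> conn (rvs r r') (V - {v}))"
      by (rule less.hyps[OF _ T' s3' v(2)]) (use c True in auto)
    then consider "\<not> conn (rvs r r') (V - {v})" | "\<not> conn (agr r r') (V - {v})" by blast
    then show ?thesis
    proof cases
      case 1
      then show ?thesis using not_both_connected_step[OF T s3 v(1) Vv v(2) 1] by blast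
    next
      case 2
      have e: "conn (rvs r (opp r')) U \<longleftrightarrow> conn (agr r r') U" "conn (agr r (opp r')) U \<longleftrightarrow> conn (rvs r r') U"
        if "U \<subseteq> V" for U
        using rvs_dual[OF tour_subset[OF T(2) that]] agr_dual[OF tour_subset[OF T(2) that]]
        by (auto intro!: conn_cong)
      have n: "\<not> conn (rvs r (opp r')) (V - {v})" using 2 e[of "V - {v}"] by blast
      have "\<not> (conn (agr r (opp r')) V \<and> conn (rvs r (opp r')) V)"
        using not_both_connected_step[OF T(1) _ _ v(1) Vv v(2) n] T(2) s3
        by (auto simp: same3_dual_right)
      then show ?thesis using e[of V] by blast
    qed
  next
    case False
    obtain a b c where abc: "a \<in> V" "b \<in> V" "c \<in> V" "r a b" "r b c" "r c a"
      by (rule strong_cycle[OF T(1) st less.prems(5)])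
    have ne: "a \<noteq> b" "b \<noteq> c" "a \<noteq> c"
      using abc tour_irrefl[OF T(1)] tour_asym[OF T(1)] by blast+
    have "card {a, b, c} = 3" using ne by simp
    then have V: "V = {a, b, c}"
      using False abc fin card_subset_eq[of V "{a, b, c}"] card_mono[of V "{a, b, c}"] by auto
    have aV: "{a} \<subseteq> V" "V \<noteq> {a}" using ne abc by blast+
    have "cyc3 r' a b c" using same3D[OF s3 abc(1-3)] abc by (simp add: cyc3_def)
    then consider "r' a b" "r' b c" "r' c a" | "r' b a" "r' c b" "r' a c" by (auto simp: cyc3_def)
    then show ?thesis
    proof cases
      case 1
      then have "\<not> rvs r r' x y" if "x \<in> V" "y \<in> V" for x y
        using that abc ne tour_asym[OF T(1)] tour_asym[OF T(2)] unfolding V rvs_def by blast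
      then show ?thesis using connD[of "rvs r r'" V "{a}"] aV by blast
    next
      case 2
      then have "\<not> agr r r' x y" if "x \<in> V" "y \<in> V" for x y
        using that abc ne tour_asym[OF T(1)] tour_asym[OF T(2)] unfolding V agr_def by blast
      then show ?thesis using connD[of "agr r r'" V "{a}"] aV by blast
    qed
  qed
qed

section \<open>Common intervals containing a 3-cycle\<close>

text \<open>For \<open>r\<close> the set \<open>{a, b, c, x}\<close> is a 3-cycle with a sink. A set
  of this type for \<open>r'\<close> through \<open>a\<close>, \<open>b\<close>, \<open>x\<close>
  must have \<open>x\<close> on its cycle, because \<open>x\<close> dominates \<open>a\<close> and
  \<open>b\<close> there.\<close>

lemma interval_3cycle_agrees_half:
  assumes T: "tour r V" "tour r' V" and J': "interval r' V J"
    and abc: "a \<in> J" "b \<in> J" "c \<in> J" "a \<noteq> b" "r a b" "r b c" "r c a"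
    and x: "x \<in> V" "x \<notin> J" and ax: "r a x" "r b x" "r c x" and xa: "r' x a"
    and e: "eqc r r' (fam V {a, b, x} {} 4)"
  shows False
proof -
  have JV: "J \<subseteq> V" using J' by (simp add: interval_def)
  have V: "a \<in> V" "b \<in> V" "c \<in> V" using abc JV by auto
  have ne: "a \<noteq> b" "b \<noteq> c" "a \<noteq> c" "x \<noteq> a" "x \<noteq> b" "x \<noteq> c"
    using abc x V tour_irrefl[OF T(1)] tour_asym[OF T(1)] by blast+
  have "{a, b, c, x} \<in> fam V {a, b, x} {} 4" using V x ne by (auto simp: fam_def)
  then obtain S where S: "S \<in> fam V {a, b, x} {} 4" "isom r {a, b, c, x} r' S"
    using eqc_ex[OF finite_fam[OF tour_finite[OF T(1)]] e] by blast
  then obtain f where f: "bij_betw f {a, b, c, x} S"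
    "\<And>p q. p \<in> {a, b, c, x} \<Longrightarrow> q \<in> {a, b, c, x} \<Longrightarrow> r p q \<longleftrightarrow> r' (f p) (f q)"
    by (auto elim!: isomE)
  have Seq: "S = {f a, f b, f c, f x}" using bij_betw_imp_surj_on[OF f(1)] by auto
  have SV: "S \<subseteq> V" and abx: "a \<in> S" "b \<in> S" "x \<in> S" using S(1) by (auto simp: fam_def)
  have R: "r' (f a) (f b)" "r' (f b) (f c)" "r' (f c) (f a)" "r' (f a) (f x)" "r' (f b) (f x)" "r' (f c) (f x)"
    using f(2) abc ax by simp_all
  have xJ: "r' x z" if "z \<in> J" for z
    using intervalD(1)[OF J' x abc(1) that] xa by simp
  \<comment> \<open>On the cycle of \<open>S\<close>, \<open>p\<close> precedes and \<open>q\<close>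
    follows \<open>x\<close>; \<open>s\<close> is the sink. As \<open>p\<close> dominates
    \<open>x\<close> it is outside \<open>J\<close>, so \<open>a\<close> and \<open>b\<close> are
    \<open>q\<close> and \<open>s\<close>, which \<open>p\<close> treats differently.\<close>
  have H: False
    if h: "r' p x" "r' x q" "r' q p" "r' p s" "S = {p, x, q, s}" for p q s
  proof -
    have pV: "p \<in> V" using h(5) SV by auto
    have pJ: "p \<notin> J" using xJ tour_asym[OF T(2) pV x(1)] h(1) by blast
    have "a \<in> {q, s}" "b \<in> {q, s}" using abx abc pJ x h(5) by auto
    then have "q \<in> J" "s \<in> J" using abc by auto
    then have "r' p q" using intervalD(1)[OF J' pV pJ] h(4) by blast
    then show False using tour_asym[OF T(2) pV, of q] h SV by blast
  qed
  have "x \<noteq> f x"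
  proof
    assume xx: "x = f x"
    have "a \<in> {f a, f b, f c}" using abx(1) ne xx Seq by auto
    then have "r' a x" using R xx by auto
    then show False using xa tour_asym[OF T(2) V(1) x(1)] by blast
  qed
  then consider "x = f a" | "x = f b" | "x = f c" using abx Seq by auto
  then show False
  proof cases
    case 1 show False by (rule H[of "f c" "f b" "f x"]) (use R 1 Seq in auto)
  next
    case 2 show False by (rule H[of "f a" "f c" "f x"]) (use R 2 Seq in auto)
  next
    case 3 show False by (rule H[of "f b" "f a" "f x"]) (use R 3 Seq in auto)
  qed
qed

lemma interval_3cycle_agrees:
  assumes T: "tour r V" "tour r' V" and J: "interval r V J" "interval r' V J"
    and abc: "a \<in> J" "b \<in> J" "c \<in> J" "r a b" "r b c" "r c a"
    and x: "x \<in> V" "x \<notin> J" and z: "z \<in> J"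
    and e: "\<And>Y. Y \<subseteq> V \<Longrightarrow> card Y \<le> 3 \<Longrightarrow> eqc r r' (fam V Y {} 4)"
  shows "r z x \<longleftrightarrow> r' z x"
proof -
  have JV: "J \<subseteq> V" using J by (simp add: interval_def)
  have V: "a \<in> V" "b \<in> V" "c \<in> V" using abc JV by auto
  have ne: "a \<noteq> b" "x \<noteq> a" using abc V x tour_irrefl[OF T(1)] by blast+
  have e': "eqc r r' (fam V {a, b, x} {} 4)"
    by (rule e) (use V x in \<open>auto simp: card_insert_if\<close>)
  have e'': "eqc (opp r) (opp r') (fam V {b, a, x} {} 4)"
    using eqc_dual[OF finite_fam[OF tour_finite[OF T(1)]] e'] by (simp add: insert_commute)
  note i = intervalD[OF J(1) x] and i' = intervalD[OF J(2) x]
  have "r a x \<longleftrightarrow> r' a x"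
  proof (rule ccontr)
    assume n: "\<not> ?thesis"
    show False
    proof (cases "r a x")
      case True
      have "r' x a" using n True tour_flip[OF T(2) V(1) x(1)] ne by blast
      then show False
        using interval_3cycle_agrees_half[OF T J(2) abc(1-3) ne(1) abc(4-6) x] i(2)[OF abc(1)] True e' abc
        by blast
    next
      case False
      then have ra: "r x a" "r' a x" using n tour_flip[OF T(1) V(1) x(1)] ne by blast+
      then have "r' b x" using i'(2)[OF abc(1,2)] by simp
      then show False
        using interval_3cycle_agrees_half[of "opp r" V "opp r'" J b a c x] T J abc ne x e''
          i(1)[OF abc(1,1)] i(1)[OF abc(1,2)] i(1)[OF abc(1,3)] ra by auto
    qed
  qed
  then show ?thesis using i(2)[OF abc(1) z] i'(2)[OF abc(1) z] by simp
qed

section \<open>An interval whose outer arcs are all reversed\<close>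

text \<open>Every in-neighbourhood is acyclic; for the converse relation the same holds of the
  out-neighbourhoods. Both together are local transitivity.\<close>

definition out3 :: "'a arcs \<Rightarrow> 'a set \<Rightarrow> bool" where
  "out3 r V \<longleftrightarrow> (\<forall>a \<in> V. \<forall>b \<in> V. \<forall>c \<in> V. \<forall>x \<in> V. r a b \<longrightarrow> r b c \<longrightarrow> r c a \<longrightarrow>
     \<not> (r a x \<and> r b x \<and> r c x))"

lemma out3D:
  "out3 r V \<Longrightarrow> a \<in> V \<Longrightarrow> b \<in> V \<Longrightarrow> c \<in> V \<Longrightarrow> x \<in> V \<Longrightarrow> r a b \<Longrightarrow> r b c \<Longrightarrow> r c a \<Longrightarrow>
   r a x \<Longrightarrow> r b x \<Longrightarrow> r c x \<Longrightarrow> False"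
  unfolding out3_def by blast

definition sink4 :: "'a arcs \<Rightarrow> 'a set \<Rightarrow> bool" where
  "sink4 w S \<longleftrightarrow> (\<exists>a b c d. S = {a, b, c, d} \<and> w a b \<and> w b c \<and> w c a \<and> w a d \<and> w b d \<and> w c d)"

text \<open>A strong 4-set, one vertex of which is the doubled vertex \<open>u, u'\<close>, dominating a fifth point.\<close>

definition sink5 :: "'a arcs \<Rightarrow> 'a set \<Rightarrow> bool" where
  "sink5 w S \<longleftrightarrow> (\<exists>u u' a b d. S = {u, u', a, b, d} \<and> w u a \<and> w u' a \<and> w a b \<and> w b u \<and> w b u' \<and>
     w u d \<and> w u' d \<and> w a d \<and> w b d)"

lemma sink4_isom:
  assumes "isom w S w' S'" "sink4 w S" shows "sink4 w' S'"
proof -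
  from assms(1) obtain f where f: "bij_betw f S S'"
    "\<And>x y. x \<in> S \<Longrightarrow> y \<in> S \<Longrightarrow> w x y \<longleftrightarrow> w' (f x) (f y)" by (rule isomE) blast
  from assms(2) obtain a b c d where S: "S = {a, b, c, d}"
    and R: "w a b" "w b c" "w c a" "w a d" "w b d" "w c d" by (auto simp: sink4_def)
  show ?thesis
    unfolding sink4_def
    by (rule exI[of _ "f a"], rule exI[of _ "f b"], rule exI[of _ "f c"], rule exI[of _ "f d"])
       (use R f(2) S bij_betw_imp_surj_on[OF f(1)] in auto)
qed

lemma sink5_isom:
  assumes "isom w S w' S'" "sink5 w S" shows "sink5 w' S'"
proof -
  from assms(1) obtain f where f: "bij_betw f S S'"
    "\<And>x y. x \<in> S \<Longrightarrow> y \<in> S \<Longrightarrow> w x y \<longleftrightarrow> w' (f x) (f y)" by (rule isomE) blast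
  from assms(2) obtain u u' a b d where S: "S = {u, u', a, b, d}"
    and R: "w u a" "w u' a" "w a b" "w b u" "w b u'" "w u d" "w u' d" "w a d" "w b d"
    by (auto simp: sink5_def)
  show ?thesis
    unfolding sink5_def
    by (rule exI[of _ "f u"], rule exI[of _ "f u'"], rule exI[of _ "f a"], rule exI[of _ "f b"],
        rule exI[of _ "f d"])
       (use R f(2) S bij_betw_imp_surj_on[OF f(1)] in auto)
qed

text \<open>Each of \<open>p\<close>, \<open>q\<close>, \<open>s\<close> dominates another one of
  them, so none is the sink: the sink is the fourth point, a common out-neighbour.\<close>

lemma card_sink4:
  assumes T: "tour w V" and pqs: "p \<in> V" "q \<in> V" "s \<in> V" "cyc3 w p q s"
  shows "card {S \<in> fam V {p, q, s} {} 4. sink4 w S} = card {y \<in> V. w p y \<and> w q y \<and> w s y}"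
    (is "card ?\<S> = card ?D")
proof -
  have asym: "\<not> w y z" if "w z y" "z \<in> V" "y \<in> V" for y z using tour_asym[OF T] that by blast
  have irr: "\<not> w y y" if "y \<in> V" for y using tour_irrefl[OF T that] .
  have ne: "p \<noteq> q" "q \<noteq> s" "p \<noteq> s" using pqs irr unfolding cyc3_def by blast+
  have yn: "y \<notin> {p, q, s}" if "y \<in> ?D" for y using that irr pqs by blast
  have "?\<S> = (\<lambda>y. {p, q, s, y}) ` ?D"
  proof (intro equalityI subsetI)
    fix S assume "S \<in> ?\<S>"
    then have S: "{p, q, s} \<subseteq> S" "S \<subseteq> V" "card S = 4" "sink4 w S" by (auto simp: fam_def)
    have fS: "finite S" using S(3) by (metis card.infinite zero_neq_numeral)
    have "card (S - {p, q, s}) = 1" using S(1,3) ne by (simp add: card_Diff_subset)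
    then obtain y where y: "S - {p, q, s} = {y}" by (auto simp: card_Suc_eq card_1_singleton_iff)
    then have Sy: "S = {p, q, s, y}" "y \<notin> {p, q, s}" "y \<in> V" using S(1,2) by blast+
    obtain a b c d where abcd: "S = {a, b, c, d}"
      and R: "w a b" "w b c" "w c a" "w a d" "w b d" "w c d" using S(4) by (auto simp: sink4_def)
    have dom: "w z d" if "z \<in> S" "z \<noteq> d" for z using that R abcd by auto
    have "d \<notin> {p, q, s}"
    proof
      assume "d \<in> {p, q, s}"
      then have "\<exists>z \<in> {p, q, s}. w d z" using pqs(4) unfolding cyc3_def by blast
      then obtain z where z: "z \<in> {p, q, s}" "w d z" by blast
      then have "z \<noteq> d" "z \<in> V" "d \<in> V" using irr abcd S(1,2) by auto
      then show False using dom[of z] z S(1) asym by blast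
    qed
    then have "d = y" using abcd Sy(1) by blast
    then have "y \<in> ?D" using dom Sy by auto
    then show "S \<in> (\<lambda>y. {p, q, s, y}) ` ?D" using Sy(1) by blast
  next
    fix S assume "S \<in> (\<lambda>y. {p, q, s, y}) ` ?D"
    then obtain y where y: "y \<in> ?D" "S = {p, q, s, y}" by blast
    have "card S = 4" using y yn[OF y(1)] ne by (auto simp: card_insert_if)
    moreover have "sink4 w S"
      using pqs(4) unfolding cyc3_def
    proof
      assume "w p q \<and> w q s \<and> w s p"
      then show ?thesis unfolding sink4_def using y by blast
    next
      assume "w q p \<and> w s q \<and> w p s"
      then show ?thesis unfolding sink4_def using y
        by (intro exI[of _ p] exI[of _ s] exI[of _ q] exI[of _ y]) auto
    qed
    ultimately show "S \<in> ?\<S>" using y pqs by (auto simp: fam_def)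
  qed
  moreover have "inj_on (\<lambda>y. {p, q, s, y}) ?D"
  proof (rule inj_onI)
    fix y z assume "y \<in> ?D" "z \<in> ?D" "{p, q, s, y} = {p, q, s, z}"
    then show "y = z" using yn[of y] yn[of z] by blast
  qed
  ultimately show ?thesis by (simp add: card_image)
qed

text \<open>If two points of a 3-cycle lie in an interval, the third, lying outside, would dominate
  one and be dominated by the other.\<close>

lemma cycle_meets_interval:
  assumes T: "tour w V" and J: "interval w V J"
    and no: "\<And>a b c. a \<in> J \<Longrightarrow> b \<in> J \<Longrightarrow> c \<in> J \<Longrightarrow> w a b \<Longrightarrow> w b c \<Longrightarrow> w c a \<Longrightarrow> False"
    and cy: "a \<in> J" "b \<in> J" "c \<in> V" "w a b" "w b c" "w c a"
  shows False
proof (cases "c \<in> J")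
  case True
  then show False using no cy by blast
next
  case False
  then have "w c b" using intervalD(1)[OF J cy(3) False cy(1,2)] cy(6) by simp
  then show False using tour_asym[OF T _ cy(3) cy(5)] cy(2) J unfolding interval_def by blast
qed

text \<open>The bound 5 on the counted sets serves configurations with two points \<open>v\<close>,
  \<open>v'\<close> of \<open>J\<close> and three further points; three prescribed points allow for
  \<open>v\<close>, \<open>v'\<close> and one outer point. Dualising both relations keeps all
  assumptions, so each result has a mirror image.\<close>

locale reversed_interval =
  fixes r r' :: "'a arcs" and V J :: "'a set"
  assumes T: "tour r V" "tour r' V" and s3: "same3 r r' V"
    and J: "interval r V J" "interval r' V J" "J \<noteq> V"
    and two: "\<exists>v \<in> J. \<exists>v' \<in> J. v \<noteq> v'"
    and rev: "\<And>v x. v \<in> J \<Longrightarrow> x \<in> V \<Longrightarrow> x \<notin> J \<Longrightarrow> r v x \<Longrightarrow> r' x v"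
    and rev': "\<And>v x. v \<in> J \<Longrightarrow> x \<in> V \<Longrightarrow> x \<notin> J \<Longrightarrow> r x v \<Longrightarrow> r' v x"
    and e: "\<And>Y k. Y \<subseteq> V \<Longrightarrow> card Y \<le> 3 \<Longrightarrow> k \<le> 5 \<Longrightarrow> eqc r r' (fam V Y {} k)"
begin

lemma fin: "finite V" using T(1) by (rule tour_finite)

lemma JV: "J \<subseteq> V" using J(1) by (simp add: interval_def)

lemma dual: "reversed_interval (opp r) (opp r') V J"
proof unfold_locales
  show "same3 (opp r) (opp r') V" using s3 by (simp add: same3_def cyc3_dual)
  show "eqc (opp r) (opp r') (fam V Y {} k)" if "Y \<subseteq> V" "card Y \<le> 3" "k \<le> 5" for Y k
    by (rule eqc_dual[OF finite_fam[OF fin] e[OF that]])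
qed (use T J two rev rev' in auto)

lemma asym: "r x y \<Longrightarrow> x \<in> V \<Longrightarrow> y \<in> V \<Longrightarrow> \<not> r y x" "r' x y \<Longrightarrow> x \<in> V \<Longrightarrow> y \<in> V \<Longrightarrow> \<not> r' y x"
  using tour_asym T by metis+

lemma ex_outside: obtains x where "x \<in> V" "x \<notin> J"
  using J(3) JV by blast

text \<open>A 3-cycle in a common interval forces the outer arcs to agree, whereas here they are
  reversed.\<close>

lemma no_cycle_inside:
  assumes "a \<in> J" "b \<in> J" "c \<in> J" "r a b" "r b c" "r c a" shows False
proof -
  obtain x where x: "x \<in> V" "x \<notin> J" by (rule ex_outside)
  have ag: "r a x \<longleftrightarrow> r' a x"
    by (rule interval_3cycle_agrees[OF T J(1,2) assms x assms(1)]) (rule e; simp)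
  have a: "a \<in> V" "a \<noteq> x" using assms(1) JV x by auto
  show False
  proof (cases "r a x")
    case True
    then show False using rev[OF assms(1) x True] ag asym(2) a x by blast
  next
    case False
    then have "r x a" using tour_flip[OF T(1) a(1) x(1) a(2)] by blast
    then show False using rev'[OF assms(1) x] ag False by blast
  qed
qed

lemma no_cycle_inside':
  assumes "a \<in> J" "b \<in> J" "c \<in> J" "r' a b" "r' b c" "r' c a" shows False
proof -
  have "cyc3 r a b c" using same3D[OF s3, of a b c] assms JV by (auto simp: cyc3_def)
  then show False
    using no_cycle_inside[OF assms(1-3)] no_cycle_inside[OF assms(1,3,2)] by (auto simp: cyc3_def)
qed

lemma cycle_meets_once:
  assumes "a \<in> J" "b \<in> J" "c \<in> V" "r a b" "r b c" "r c a" shows False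
  using cycle_meets_interval[OF T(1) J(1) no_cycle_inside assms] .

lemma cycle_meets_once':
  assumes "a \<in> J" "b \<in> J" "c \<in> V" "r' a b" "r' b c" "r' c a" shows False
  using cycle_meets_interval[OF T(2) J(2) no_cycle_inside' assms] .

text \<open>Two points \<open>v\<close>, \<open>v'\<close> dominate a 3-cycle. In a set of the same
  type for \<open>r'\<close> through \<open>v\<close>, \<open>v'\<close>, \<open>a\<close>, neither
  \<open>v\<close> nor \<open>v'\<close> is on the cycle: if one were, the other would dominate its
  predecessor on the cycle, against the interval property. So they are the two dominating points and
  \<open>v\<close> dominates \<open>a\<close>, against the reversal.\<close>

lemma no_cycle_above:
  assumes v: "v \<in> J" and abc: "a \<in> V" "b \<in> V" "c \<in> V" "a \<notin> J" "b \<notin> J" "c \<notin> J"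
    and va: "r v a" "r v b" "r v c" and cy: "r a b" "r b c" "r c a"
  shows False
proof -
  obtain v' where v': "v' \<in> J" "v' \<noteq> v" using two by blast
  have vV: "v \<in> V" "v' \<in> V" using v v' JV by auto
  have ne: "a \<noteq> b" "b \<noteq> c" "a \<noteq> c" using cy abc tour_irrefl[OF T(1)] by blast+
  have va': "r v' a" "r v' b" "r v' c"
    using intervalD(2)[OF J(1) abc(1,4) v v'(1)] intervalD(2)[OF J(1) abc(2,5) v v'(1)]
      intervalD(2)[OF J(1) abc(3,6) v v'(1)] va by auto
  have jn: "v \<notin> {a, b, c}" "v' \<notin> {a, b, c}" using v v' abc by auto
  have "{v, v', a, b, c} \<in> fam V {v, v', a} {} 5"
    using vV v'(2) ne jn abc by (auto simp: fam_def)
  moreover have "eqc r r' (fam V {v, v', a} {} 5)"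
    by (rule e) (use vV abc in \<open>auto simp: card_insert_if\<close>)
  ultimately obtain S where S: "S \<in> fam V {v, v', a} {} 5" "isom r {v, v', a, b, c} r' S"
    using eqc_ex[OF finite_fam[OF fin]] by blast
  then obtain f where f: "bij_betw f {v, v', a, b, c} S"
    "\<And>p q. p \<in> {v, v', a, b, c} \<Longrightarrow> q \<in> {v, v', a, b, c} \<Longrightarrow> r p q \<longleftrightarrow> r' (f p) (f q)"
    by (auto elim!: isomE)
  have Seq: "S = {f v, f v', f a, f b, f c}" using bij_betw_imp_surj_on[OF f(1)] by auto
  have SV: "S \<subseteq> V" and mem: "v \<in> S" "v' \<in> S" "a \<in> S" using S(1) by (auto simp: fam_def)
  have R: "r' (f a) (f b)" "r' (f b) (f c)" "r' (f c) (f a)" "r' (f v) (f a)" "r' (f v) (f b)"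
    "r' (f v) (f c)" "r' (f v') (f a)" "r' (f v') (f b)" "r' (f v') (f c)"
    using f(2) cy va va' by simp_all
  have av: "r' a v" "r' a v'" using rev[OF v abc(1,4) va(1)] rev[OF v'(1) abc(1,4) va'(1)] by auto
  have H: False
    if h: "u \<in> J" "u' \<in> J" "u' \<noteq> u" "u' \<in> S" "r' u q" "r' q s" "r' s u" "S = {f v, f v', u, q, s}"
      "r' (f v) s" "r' (f v') s" for u u' q s
  proof -
    have V: "u \<in> V" "q \<in> V" "s \<in> V" "u' \<in> V" using h(8,4) SV by auto
    have sJ: "s \<notin> J" using cycle_meets_once'[OF _ h(1) V(2) h(7,5,6)] by blast
    have qJ: "q \<notin> J" using cycle_meets_once'[OF h(1) _ V(3) h(5,6,7)] by blast
    have "u' \<in> {f v, f v'}" using h(2,3,4,8) sJ qJ by auto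
    then have "r' u' s" using h(9,10) by auto
    moreover have "r' s u'" using intervalD(1)[OF J(2) V(3) sJ h(1,2)] h(7) by simp
    ultimately show False using asym(2) V by blast
  qed
  have HC: False if u: "u \<in> J" "u' \<in> J" "u' \<noteq> u" "u' \<in> S" "u \<in> {f a, f b, f c}" for u u'
    using u(5)
  proof (elim insertE emptyE)
    assume "u = f a" then show False using H[OF u(1-4), of "f b" "f c"] R Seq by blast
  next
    assume "u = f b" then show False
      using H[OF u(1-4), of "f c" "f a"] R Seq by (simp add: insert_commute)
  next
    assume "u = f c" then show False
      using H[OF u(1-4), of "f a" "f b"] R Seq by (simp add: insert_commute)
  qed
  have "v \<notin> {f a, f b, f c}" "v' \<notin> {f a, f b, f c}"
    using HC[OF v v'(1) v'(2) mem(2)] HC[OF v'(1) v v'(2)[symmetric] mem(1)] by blast+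
  then have vv: "v \<in> {f v, f v'}" "v' \<in> {f v, f v'}" using mem Seq by auto
  then have "a \<in> {f a, f b, f c}" using mem(3) Seq v'(2) jn by auto
  then have "r' v a" using R vv by auto
  then show False using av(1) asym(2) vV abc by blast
qed

end

text \<open>No element of \<open>B\<close> occurs as a second coordinate, so the set determines the
  ordered pair.\<close>

lemma card_inserted_pairs:
  assumes fin: "finite B" "\<And>b. b \<in> B \<Longrightarrow> finite (D b)"
    and disj: "\<And>b y c z. b \<in> B \<Longrightarrow> y \<in> D b \<Longrightarrow> c \<in> B \<Longrightarrow> z \<in> D c \<Longrightarrow> b \<noteq> z \<and> b \<notin> X \<and> y \<notin> X"
  shows "card ((\<lambda>(b, y). X \<union> {b, y}) ` (SIGMA b:B. D b)) = (\<Sum>b \<in> B. card (D b))"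
proof -
  have "inj_on (\<lambda>(b, y). X \<union> {b, y}) (SIGMA b:B. D b)"
  proof (rule inj_onI)
    fix p q assume p: "p \<in> (SIGMA b:B. D b)" and q: "q \<in> (SIGMA b:B. D b)"
      and eq: "(\<lambda>(b, y). X \<union> {b, y}) p = (\<lambda>(b, y). X \<union> {b, y}) q"
    obtain b y c z where pq: "p = (b, y)" "q = (c, z)" by (cases p, cases q)
    have m: "b \<in> B" "y \<in> D b" "c \<in> B" "z \<in> D c" using p q pq by auto
    have "X \<union> {b, y} = X \<union> {c, z}" using eq pq by simp
    then have "{b, y} = {c, z}" using disj[OF m] disj[OF m(3,4,1,2)] by blast
    then show "p = q" using disj[OF m] pq by (auto simp: doubleton_eq_iff)
  qed
  then show ?thesis using fin by (simp add: card_image card_SigmaI)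
qed

context reversed_interval
begin

lemma card_dominated:
  assumes "p \<in> V" "q \<in> V" "s \<in> V" "cyc3 r p q s"
  shows "card {y \<in> V. r p y \<and> r q y \<and> r s y} = card {y \<in> V. r' p y \<and> r' q y \<and> r' s y}"
proof -
  have c': "cyc3 r' p q s" using same3D[OF s3 assms(1-3)] assms(4) by simp
  have "card {S \<in> fam V {p, q, s} {} 4. sink4 r S} = card {S \<in> fam V {p, q, s} {} 4. sink4 r' S}"
  proof (rule eqc_card[OF finite_fam[OF fin]])
    show "eqc r r' (fam V {p, q, s} {} 4)"
      by (rule e) (use assms in \<open>auto simp: card_insert_if\<close>)
  next
    fix S S' assume "isom r S r' S'"
    then show "sink4 r S \<longleftrightarrow> sink4 r' S'" using sink4_isom isom_sym by metis
  qed
  then show ?thesis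
    unfolding card_sink4[OF T(1) assms] card_sink4[OF T(2) assms(1-3) c'] .
qed

lemma no_cycle_through:
  assumes v: "v \<in> J" and abx: "a \<in> V" "b \<in> V" "x \<in> V" "a \<notin> J" "b \<notin> J" "x \<notin> J"
    and cy: "r v a" "r a b" "r b v" and dom: "r v x" "r a x" "r b x"
  shows False
proof -
  obtain v' where v': "v' \<in> J" "v' \<noteq> v" using two by blast
  have vV: "v \<in> V" "v' \<in> V" using v v' JV by auto
  have cy': "r v' a" "r b v'" "r v' x"
    using intervalD(2)[OF J(1) abx(1,4) v v'(1)] intervalD(1)[OF J(1) abx(2,5) v v'(1)]
      intervalD(2)[OF J(1) abx(3,6) v v'(1)] cy dom by auto
  have xv: "r' x v" "r' x v'" using rev[OF v abx(3,6) dom(1)] rev[OF v'(1) abx(3,6) cy'(3)] by auto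
  txt \<open>Among the 5-sets of type \<open>sink5\<close> through \<open>v\<close>, \<open>v'\<close>, \<open>x\<close>, those in which \<open>x\<close> lies on a 3-cycle with
    \<open>v\<close> are equally many for \<open>r\<close> and \<open>r'\<close>. For \<open>r'\<close> there are no others, as \<open>x\<close> dominates \<open>v\<close> and
    \<open>v'\<close> there; for \<open>r\<close> there is \<open>{v, v', a, b, x}\<close>.\<close>
  let ?F = "fam V {v, v', x} {} 5"
  define B where "B = {b \<in> V. cyc3 r v x b}"
  have B': "B = {b \<in> V. cyc3 r' v x b}"
    using same3D[OF s3 vV(1) abx(3)] by (auto simp: B_def)
  define D where "D w b = {y \<in> V. w v y \<and> w x y \<and> w b y}" for w :: "'a arcs" and b
  define \<B> where "\<B> w = (\<lambda>(b, y). {v, v', x} \<union> {b, y}) ` (SIGMA b:B. D w b)" for w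
  have BJ: "b \<in> V" "b \<notin> J" "b \<noteq> v" "b \<noteq> v'" "b \<noteq> x" "r x b" "r b v" "r' v b" "r' b x" if b: "b \<in> B" for b
  proof -
    show bV: "b \<in> V" using b by (simp add: B_def)
    have c: "cyc3 r v x b" "cyc3 r' v x b" using b B' by (auto simp: B_def)
    show r1: "r x b" "r b v" using c(1) asym(1)[OF dom(1) vV(1) abx(3)] by (auto simp: cyc3_def)
    show r2: "r' v b" "r' b x" using c(2) asym(2)[OF xv(1) abx(3) vV(1)] by (auto simp: cyc3_def)
    show nJ: "b \<notin> J" using cycle_meets_once[OF _ v abx(3) r1(2) dom(1) r1(1)] by blast
    show "b \<noteq> v" "b \<noteq> v'" using nJ v v' by auto
    show "b \<noteq> x" using r1(1) tour_irrefl[OF T(1) abx(3)] by blast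
  qed
  have cardB: "card (\<B> w) = (\<Sum>b \<in> B. card (D w b))" if w: "tour w V" and vx: "w v x \<or> w x v"
    and cb: "\<And>b. b \<in> B \<Longrightarrow> cyc3 w v x b" and J'': "interval w V J" for w
    unfolding \<B>_def
  proof (rule card_inserted_pairs)
    show "finite B" using fin by (simp add: B_def)
    show "finite (D w b)" for b using fin by (simp add: D_def)
    fix b y c z assume b: "b \<in> B" "y \<in> D w b" and c: "c \<in> B" "z \<in> D w c"
    have as: "\<not> w q p" if "w p q" "p \<in> V" "q \<in> V" for p q using tour_asym[OF w] that by blast
    have ir: "\<not> w p p" if "p \<in> V" for p using tour_irrefl[OF w that] .
    have yz: "y \<in> V" "w v y" "w x y" "z \<in> V" "w v z" "w x z" using b c by (auto simp: D_def)
    have "b \<noteq> z"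
      using cb[OF b(1)] yz as[of v x] as[of x v] as[of v b] as[of x b] BJ(1)[OF b(1)] vV abx
      unfolding cyc3_def by blast
    moreover have "y \<noteq> v" "y \<noteq> x" using yz ir vV abx by auto
    moreover have "y \<noteq> v'"
    proof
      assume "y = v'"
      then have "w x v'" using yz by simp
      then have xv: "w x v" using intervalD(1)[OF J'' abx(3,6) v'(1) v] by simp
      have "w b v'" using b \<open>y = v'\<close> by (simp add: D_def)
      then have "w b v" using intervalD(1)[OF J'' BJ(1,2)[OF b(1)] v'(1) v] by simp
      then show False using xv cb[OF b(1)] as vV abx BJ(1)[OF b(1)] unfolding cyc3_def by blast
    qed
    ultimately show "b \<noteq> z \<and> b \<notin> {v, v', x} \<and> y \<notin> {v, v', x}"
      using BJ(3,4,5)[OF b(1)] by blast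
  qed
  \<comment> \<open>As \<open>v\<close>, \<open>x\<close>, \<open>b\<close> is a 3-cycle of both
    relations, \<open>card_dominated\<close> equates its numbers of common out-neighbours.\<close>
  have "card (D r b) = card (D r' b)" if "b \<in> B" for b
    using card_dominated[OF vV(1) abx(3), of b] that by (simp add: B_def D_def)
  then have "(\<Sum>b \<in> B. card (D r b)) = (\<Sum>b \<in> B. card (D r' b))" by (rule sum.cong[OF refl])
  moreover have "card (\<B> r) = (\<Sum>b \<in> B. card (D r b))"
    by (rule cardB[OF T(1) _ _ J(1)]) (use dom(1) in \<open>auto simp: B_def\<close>)
  moreover have "card (\<B> r') = (\<Sum>b \<in> B. card (D r' b))"
    by (rule cardB[OF T(2) _ _ J(2)]) (use xv(1) B' in auto)
  ultimately have BB: "card (\<B> r) = card (\<B> r')" by simp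
  have S0: "{v, v', a, b, x} \<in> {S \<in> ?F. sink5 r S}"
  proof -
    have ne: "a \<noteq> b" "a \<noteq> x" "b \<noteq> x" using cy dom abx tour_irrefl[OF T(1)] by blast+
    have "card {v, v', a, b, x} = 5" using ne v v' abx by (auto simp: card_insert_if)
    moreover have "sink5 r {v, v', a, b, x}"
      unfolding sink5_def using cy cy' dom by blast
    ultimately show ?thesis using vV abx by (auto simp: fam_def)
  qed
  \<comment> \<open>Members of \<open>B\<close> are dominated by \<open>x\<close>, but
    \<open>a\<close> and \<open>b\<close> dominate \<open>x\<close>.\<close>
  have "{v, v', a, b, x} \<notin> \<B> r"
  proof
    assume "{v, v', a, b, x} \<in> \<B> r"
    then obtain c y where c: "c \<in> B" "{v, v', a, b, x} = {v, v', x} \<union> {c, y}" by (auto simp: \<B>_def)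
    then have "c \<in> {a, b}" using BJ(3,4,5)[OF c(1)] by blast
    then have "r c x" using dom by blast
    then show False using BJ(1,6)[OF c(1)] asym(1) abx by blast
  qed
  moreover have "\<B> r \<subseteq> {S \<in> ?F. sink5 r S}"
  proof
    fix S assume "S \<in> \<B> r"
    then obtain c y where c: "c \<in> B" "y \<in> D r c" "S = {v, v', x} \<union> {c, y}" by (auto simp: \<B>_def)
    have y: "y \<in> V" "r v y" "r x y" "r c y" using c(2) by (auto simp: D_def)
    have yJ: "y \<notin> J"
    proof
      assume "y \<in> J"
      then have "r y x" using intervalD(2)[OF J(1) abx(3,6) v] dom(1) by blast
      then show False using y asym(1) abx by blast
    qed
    have v'y: "r v' y" "r c v'"
      using intervalD(2)[OF J(1) y(1) yJ v v'(1)] intervalD(1)[OF J(1) BJ(1,2)[OF c(1)] v v'(1)]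
        y(2) BJ(7)[OF c(1)] by auto
    have "y \<noteq> x" "y \<noteq> c" using y tour_irrefl[OF T(1)] by blast+
    then have "card S = 5" using c(3) BJ[OF c(1)] yJ v v' abx by (auto simp: card_insert_if)
    moreover have "sink5 r S"
      unfolding sink5_def c(3)
      by (rule exI[of _ v], rule exI[of _ v'], rule exI[of _ x], rule exI[of _ c], rule exI[of _ y])
         (use y v'y cy' dom BJ[OF c(1)] in auto)
    ultimately show "S \<in> {S \<in> ?F. sink5 r S}"
      using c(3) vV abx y BJ(1)[OF c(1)] by (auto simp: fam_def)
  qed
  moreover have fin5: "finite {S \<in> ?F. sink5 r S}" using finite_fam[OF fin] by simp
  ultimately have "card (\<B> r) < card {S \<in> ?F. sink5 r S}"
    using S0 by (intro psubset_card_mono) auto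
  also have "card {S \<in> ?F. sink5 r S} = card {S \<in> ?F. sink5 r' S}"
  proof (rule eqc_card[OF finite_fam[OF fin]])
    show "eqc r r' ?F"
      by (rule e) (use vV abx in \<open>auto simp: card_insert_if\<close>)
  next
    fix S S' assume "isom r S r' S'"
    then show "sink5 r S \<longleftrightarrow> sink5 r' S'" using sink5_isom isom_sym by metis
  qed
  also have "\<dots> \<le> card (\<B> r')"
  proof (rule card_mono)
    show "finite (\<B> r')" using fin by (auto simp: \<B>_def B_def D_def)
    show "{S \<in> ?F. sink5 r' S} \<subseteq> \<B> r'"
    proof
      fix S assume "S \<in> {S \<in> ?F. sink5 r' S}"
      then have S: "{v, v', x} \<subseteq> S" "S \<subseteq> V" "sink5 r' S" by (auto simp: fam_def)
      obtain u u' p q d where Seq: "S = {u, u', p, q, d}"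
        and R: "r' u p" "r' u' p" "r' p q" "r' q u" "r' q u'" "r' u d" "r' u' d" "r' p d" "r' q d"
        using S(3) by (auto simp: sink5_def)
      have V5: "u \<in> V" "u' \<in> V" "p \<in> V" "q \<in> V" "d \<in> V" using S(2) Seq by auto
      have xJ: "r' x z" if "z \<in> J" for z
        using intervalD(1)[OF J(2) abx(3,6) v that] xv by simp
      have dJ: "d \<notin> J"
      proof
        assume d: "d \<in> J"
        \<comment> \<open>With the sink \<open>d\<close> in \<open>J\<close>, an out-neighbour of a
          point of \<open>J\<close> that dominates \<open>d\<close> is itself in \<open>J\<close>.
          Following the cycles from \<open>v\<close> or \<open>v'\<close> would draw all of
          \<open>S\<close> into \<open>J\<close>, including \<open>x\<close>.\<close>
        have nxt: "w \<in> J" if "z \<in> J" "r' z w" "r' w d" "w \<in> V" for z w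
        proof (rule ccontr)
          assume "w \<notin> J"
          then have "r' w z" using intervalD(1)[OF J(2) that(4) _ d that(1)] that(3) by blast
          then show False using asym(2) that JV by blast
        qed
        have "\<exists>z \<in> {u, u', p, q}. z \<in> J" using v v' S(1) Seq by auto
        then have "p \<in> J"
          using nxt[of u p] nxt[of u' p] nxt[of q u] R V5 by blast
        then have "q \<in> J" using nxt[of p q] R V5 by blast
        then have "u \<in> J" "u' \<in> J" using nxt[of q u] nxt[of q u'] R V5 by blast+
        then have "x \<in> J" using S(1) Seq \<open>p \<in> J\<close> \<open>q \<in> J\<close> d by auto
        then show False using abx by blast
      qed
      \<comment> \<open>A 3-cycle has at most one point in \<open>J\<close>, so the only two of the
        four non-sinks that can both lie in \<open>J\<close> are the doubled pair.\<close>
      have n: "\<not> (u \<in> J \<and> p \<in> J)" "\<not> (u' \<in> J \<and> p \<in> J)" "\<not> (p \<in> J \<and> q \<in> J)"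
        "\<not> (q \<in> J \<and> u \<in> J)" "\<not> (q \<in> J \<and> u' \<in> J)"
        using cycle_meets_once'[OF _ _ V5(4) R(1,3,4)] cycle_meets_once'[OF _ _ V5(4) R(2,3,5)]
          cycle_meets_once'[OF _ _ V5(1) R(3,4,1)] cycle_meets_once'[OF _ _ V5(3) R(4,1,3)]
          cycle_meets_once'[OF _ _ V5(3) R(5,2,3)] by blast+
      have vm: "v \<in> {u, u', p, q}" "v' \<in> {u, u', p, q}" "x \<in> {u, u', p, q, d}" using S(1) Seq dJ v v' by auto
      have xd: "x \<noteq> d"
      proof
        assume "x = d"
        then have "r' v x" using vm(1) R by auto
        then show False using xv(1) asym(2) vV abx by blast
      qed
      have uu: "{v, v'} = {u, u'}" using vm v v' n by auto
      then have uJ: "u \<in> J" "u' \<in> J" using v v'(1) by (auto simp: doubleton_eq_iff)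
      have xpq: "x \<in> {p, q}" using vm(3) xd uJ abx(6) by auto
      define c where "c = (if x = p then q else p)"
      have xc: "{x, c} = {p, q}" using xpq by (auto simp: c_def)
      have cV: "c \<in> V" using V5 by (simp add: c_def)
      have vc: "r' v p" "r' q v" "r' v d" using uu R by auto
      have "cyc3 r' v x c" using xpq vc R(3) unfolding cyc3_def c_def by auto
      then have "c \<in> B" using B' cV by simp
      moreover have "d \<in> D r' c" using xpq vc R V5 by (auto simp: D_def c_def)
      moreover have "S = {v, v', x} \<union> {c, d}" using Seq uu xc by auto
      ultimately show "S \<in> \<B> r'" unfolding \<B>_def by force
    qed
  qed
  also have "\<dots> = card (\<B> r)" using BB by simp
  finally show False by simp
qed

text \<open>A cycle meeting \<open>J\<close> is handled by \<open>no_cycle_through\<close>. A cycle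
  outside \<open>J\<close> can neither be dominated by \<open>v\<close> nor dominate
  \<open>v\<close>, so somewhere along it the direction towards \<open>v\<close> changes, which
  yields a new 3-cycle through \<open>v\<close>.\<close>

lemma no_sink_of_cycle: "out3 r V"
  unfolding out3_def
proof (intro ballI impI notI)
  fix a b c x assume V: "a \<in> V" "b \<in> V" "c \<in> V" "x \<in> V" and cy: "r a b" "r b c" "r c a"
    and d: "r a x \<and> r b x \<and> r c x"
  interpret D: reversed_interval "opp r" "opp r'" V J by (rule dual)
  obtain v where v: "v \<in> J" using two by blast
  have vV: "v \<in> V" using v JV by blast
  have one: False
    if h: "p \<in> V" "q \<in> V" "s \<in> V" "r p q" "r q s" "r s p" "r p x" "r q x" "r s x" "p \<in> J" for p q s
  proof -
    have q: "q \<notin> J" using cycle_meets_once[OF h(10) _ h(3) h(4,5,6)] by blast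
    have s: "s \<notin> J" using cycle_meets_once[OF _ h(10) h(2) h(6,4,5)] by blast
    show False
    proof (cases "x \<in> J")
      case True
      then have "r q p" using intervalD(1)[OF J(1) h(2) q True h(10)] h(8) by simp
      then show False using asym(1) h by blast
    next
      case False
      then show False using no_cycle_through[OF h(10,2,3) V(4) q s False h(4-9)] by blast
    qed
  qed
  have aJ: "a \<notin> J" "b \<notin> J" "c \<notin> J"
    using one[OF V(1-3) cy] one[OF V(2,3,1) cy(2,3,1)] one[OF V(3,1,2) cy(3,1,2)] d by blast+
  have flip: "r v y \<longleftrightarrow> \<not> r y v" if "y \<in> V" "y \<notin> J" for y
    using tour_flip[OF T(1) that(1) vV] that v by blast
  have up: "\<not> (r v a \<and> r v b \<and> r v c)" using no_cycle_above[OF v V(1-3) aJ] cy by blast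
  have down: "\<not> (r a v \<and> r b v \<and> r c v)"
    using D.no_cycle_above[OF v V(3,2,1) aJ(3,2,1)] cy by auto
  have xJ: "x \<notin> J"
  proof
    assume x: "x \<in> J"
    have "r a v" "r b v" "r c v"
      using intervalD(1)[OF J(1) V(1) aJ(1) x v] intervalD(1)[OF J(1) V(2) aJ(2) x v]
        intervalD(1)[OF J(1) V(3) aJ(3) x v] d by auto
    then show False using down by blast
  qed
  have mix: False
    if h: "p \<in> V" "q \<in> V" "p \<notin> J" "q \<notin> J" "r p q" "r v p" "r q v" "r p x" "r q x" "r v x" for p q
    using no_cycle_through[OF v h(1,2) V(4) h(3,4) xJ h(6,5,7,10,8,9)] .
  \<comment> \<open>Here \<open>v\<close>, \<open>p\<close>, \<open>x\<close> form the 3-cycle and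
    \<open>q\<close> dominates it, so the dual statement applies.\<close>
  have mix': False
    if h: "p \<in> V" "q \<in> V" "p \<notin> J" "q \<notin> J" "r q p" "r v p" "r q v" "r p x" "r q x" "r x v" for p q
    using D.no_cycle_through[of v x p q] v h V(4) xJ by auto
  show False
  proof (cases "r v x")
    case True
    then show False
      using mix[OF V(1,2) aJ(1,2) cy(1)] mix[OF V(2,3) aJ(2,3) cy(2)] mix[OF V(3,1) aJ(3,1) cy(3)]
        up down d flip[OF V(1) aJ(1)] flip[OF V(2) aJ(2)] flip[OF V(3) aJ(3)] by blast
  next
    case False
    then have "r x v" using flip[OF V(4) xJ] by blast
    then show False
      using mix'[OF V(2,1) aJ(2,1) cy(1)] mix'[OF V(3,2) aJ(3,2) cy(2)] mix'[OF V(1,3) aJ(1,3) cy(3)]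
        up down d flip[OF V(1) aJ(1)] flip[OF V(2) aJ(2)] flip[OF V(3) aJ(3)] by blast
  qed
qed

lemma no_source_of_cycle: "out3 (opp r) V"
proof -
  interpret D: reversed_interval "opp r" "opp r'" V J by (rule dual)
  show ?thesis by (rule D.no_sink_of_cycle)
qed

end

section \<open>Locally transitive tournaments\<close>

definition acyc :: "'a arcs \<Rightarrow> 'a set \<Rightarrow> bool" where
  "acyc r S \<longleftrightarrow> (\<forall>a \<in> S. \<forall>b \<in> S. \<forall>c \<in> S. r a b \<longrightarrow> r b c \<longrightarrow> \<not> r c a)"

text \<open>On a transitive tournament this is the position in the linear order, starting with 0 at
  the source.\<close>

definition rk :: "'a arcs \<Rightarrow> 'a set \<Rightarrow> 'a \<Rightarrow> nat" where
  "rk r S x = card {y \<in> S. r y x}"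

lemma acyc_trans:
  assumes "tour r S" "acyc r S" "x \<in> S" "y \<in> S" "z \<in> S" "r x y" "r y z" shows "r x z"
proof -
  have "x \<noteq> z" using assms tour_asym[of r S x y] by blast
  then show ?thesis using assms tour_flip[of r S x z] unfolding acyc_def by blast
qed

lemma acyc_subset: "acyc r S \<Longrightarrow> S' \<subseteq> S \<Longrightarrow> acyc r S'"
  unfolding acyc_def by blast

lemma acyc_dual: "acyc r S \<Longrightarrow> acyc (opp r) S"
  unfolding acyc_def conversep_iff by blast

lemma rk_less:
  assumes "tour r S" "acyc r S" "x \<in> S" "y \<in> S"
  shows "r x y \<longleftrightarrow> rk r S x < rk r S y"
proof -
  have imp: "rk r S u < rk r S v" if "r u v" "u \<in> S" "v \<in> S" for u v
    unfolding rk_def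
  proof (rule psubset_card_mono)
    show "finite {w \<in> S. r w v}" using tour_finite[OF assms(1)] by simp
    have "{w \<in> S. r w u} \<subseteq> {w \<in> S. r w v}"
      using acyc_trans[OF assms(1,2)] that by blast
    moreover have "u \<in> {w \<in> S. r w v}" "u \<notin> {w \<in> S. r w u}"
      using that tour_irrefl[OF assms(1)] by auto
    ultimately show "{w \<in> S. r w u} \<subset> {w \<in> S. r w v}" by blast
  qed
  show ?thesis
  proof
    show "r x y \<Longrightarrow> rk r S x < rk r S y" using imp assms by blast
    assume l: "rk r S x < rk r S y"
    then have "x \<noteq> y" by auto
    then show "r x y" using l imp[of y x] tour_flip[OF assms(1,3,4)] assms by (metis less_asym)
  qed
qed

lemma rk_bij:
  assumes "tour r S" "acyc r S" shows "bij_betw (rk r S) S {..<card S}"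
proof -
  have fin: "finite S" using assms(1) by (rule tour_finite)
  have inj: "inj_on (rk r S) S"
  proof (rule inj_onI)
    fix x y assume xy: "x \<in> S" "y \<in> S" "rk r S x = rk r S y"
    show "x = y"
    proof (rule ccontr)
      assume "x \<noteq> y"
      then have "r x y \<or> r y x" using tour_flip[OF assms(1) xy(1,2)] by blast
      then show False using rk_less[OF assms] xy by auto
    qed
  qed
  have "rk r S ` S \<subseteq> {..<card S}"
  proof (intro image_subsetI, unfold lessThan_iff)
    fix x assume x: "x \<in> S"
    have "{y \<in> S. r y x} \<subset> S" using x tour_irrefl[OF assms(1) x] by blast
    then show "rk r S x < card S" unfolding rk_def by (rule psubset_card_mono[OF fin])
  qed
  then have "rk r S ` S = {..<card S}"
    by (rule card_subset_eq[OF finite_lessThan]) (simp add: card_image[OF inj])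
  then show ?thesis using inj by (simp add: bij_betw_def)
qed

lemma rk_ex:
  assumes "tour r S" "acyc r S" "k < card S"
  obtains x where "x \<in> S" "rk r S x = k"
proof -
  have "k \<in> rk r S ` S"
    using bij_betw_imp_surj_on[OF rk_bij[OF assms(1,2)]] assms(3) by simp
  then show thesis using that by (metis imageE)
qed

lemma rk_upper: "tour r S \<Longrightarrow> acyc r S \<Longrightarrow> x \<in> S \<Longrightarrow> rk r S x < card S"
  using bij_betwE[OF rk_bij[of r S]] by simp

lemma rk_inj: "tour r S \<Longrightarrow> acyc r S \<Longrightarrow> x \<in> S \<Longrightarrow> y \<in> S \<Longrightarrow> rk r S x = rk r S y \<Longrightarrow> x = y"
  using inj_onD[OF bij_betw_imp_inj_on[OF rk_bij[of r S]]] by simp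

text \<open>A set closed under predecessors is an initial segment, hence determined by its size;
  domination of chain elements thereby becomes a comparison of numbers.\<close>

lemma rk_initial:
  assumes T: "tour r S" "acyc r S" and P: "P \<subseteq> S" "\<And>p q. p \<in> P \<Longrightarrow> q \<in> S \<Longrightarrow> r q p \<Longrightarrow> q \<in> P"
    and x: "x \<in> S"
  shows "x \<in> P \<longleftrightarrow> rk r S x < card P"
proof -
  have fin: "finite S" "finite P" using tour_finite[OF T(1)] P(1) finite_subset by auto
  have imp: "rk r S p < card P" if "p \<in> P" for p
    unfolding rk_def
  proof (rule psubset_card_mono[OF fin(2)])
    show "{y \<in> S. r y p} \<subset> P" using P(2)[OF that] that tour_irrefl[OF T(1), of p] P(1) by blast
  qed
  have "P = {y \<in> S. rk r S y < card P}"
  proof (rule card_subset_eq)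
    show "finite {y \<in> S. rk r S y < card P}" using fin by simp
    show "P \<subseteq> {y \<in> S. rk r S y < card P}" using imp P(1) by blast
    have "card {y \<in> S. rk r S y < card P} = card (rk r S ` {y \<in> S. rk r S y < card P})"
      by (rule card_image[symmetric], rule inj_on_subset[of _ S])
         (use rk_bij[OF T] in \<open>auto simp: bij_betw_def\<close>)
    also have "rk r S ` {y \<in> S. rk r S y < card P} = {..<card P}"
    proof (intro equalityI subsetI)
      fix k assume k: "k \<in> {..<card P}"
      moreover have "card P \<le> card S" using P(1) fin(1) by (rule card_mono[rotated])
      ultimately have "k < card S" by simp
      then obtain z where "z \<in> S" "rk r S z = k" by (rule rk_ex[OF T])
      then show "k \<in> rk r S ` {y \<in> S. rk r S y < card P}" using k by auto
    qed auto
    finally show "card P = card {y \<in> S. rk r S y < card P}" by simp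
  qed
  then show ?thesis using x by blast
qed

lemma reversal_ex:
  assumes T: "tour r S" "acyc r S"
  obtains h where "bij_betw h S S" "\<And>x. x \<in> S \<Longrightarrow> rk r S (h x) = card S - 1 - rk r S x"
    "\<And>x y. x \<in> S \<Longrightarrow> y \<in> S \<Longrightarrow> r x y \<longleftrightarrow> r (h y) (h x)"
proof -
  let ?m = "card S"
  define h where "h x = inv_into S (rk r S) (?m - 1 - rk r S x)" for x
  have im: "rk r S ` S = {..<?m}" using rk_bij[OF T] by (simp add: bij_betw_def)
  have h: "h x \<in> S" "rk r S (h x) = ?m - 1 - rk r S x" if x: "x \<in> S" for x
  proof -
    have "?m - 1 - rk r S x \<in> rk r S ` S" unfolding im using rk_upper[OF T x] by simp
    then show "h x \<in> S" "rk r S (h x) = ?m - 1 - rk r S x"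
      unfolding h_def by (rule inv_into_into, rule f_inv_into_f)
  qed
  have inj: "inj_on h S"
  proof (rule inj_onI)
    fix x y assume xy: "x \<in> S" "y \<in> S" "h x = h y"
    then have "?m - 1 - rk r S x = ?m - 1 - rk r S y" using h by metis
    then have "rk r S x = rk r S y" using rk_upper[OF T xy(1)] rk_upper[OF T xy(2)] by linarith
    then show "x = y" by (rule rk_inj[OF T xy(1,2)])
  qed
  have "h ` S = S" by (rule endo_inj_surj[OF tour_finite[OF T(1)] _ inj]) (use h in auto)
  then have "bij_betw h S S" using inj by (simp add: bij_betw_def)
  moreover have "r x y \<longleftrightarrow> r (h y) (h x)" if xy: "x \<in> S" "y \<in> S" for x y
    unfolding rk_less[OF T xy] rk_less[OF T h(1)[OF xy(2)] h(1)[OF xy(1)]] h(2)[OF xy(1)] h(2)[OF xy(2)]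
    using rk_upper[OF T xy(1)] rk_upper[OF T xy(2)] by linarith
  ultimately show thesis using that h(2) by blast
qed

lemma isom_of_acyc:
  assumes T: "tour r S" "acyc r S" and T': "tour r' S'" "acyc r' S'" and c: "card S = card S'"
  shows "isom r S r' S'"
proof -
  let ?f = "inv_into S' (rk r' S') \<circ> rk r S"
  have b: "bij_betw ?f S S'"
    by (rule bij_betw_trans[OF rk_bij[OF T]]) (unfold c, rule bij_betw_inv_into[OF rk_bij[OF T']])
  have rf: "rk r' S' (?f x) = rk r S x" if "x \<in> S" for x
    using rk_upper[OF T that] rk_bij[OF T'] c by (simp add: bij_betw_inv_into_right)
  show ?thesis
  proof (rule isomI[OF b])
    fix x y assume xy: "x \<in> S" "y \<in> S"
    have "?f x \<in> S'" "?f y \<in> S'" using bij_betwE[OF b] xy by auto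
    then show "r x y \<longleftrightarrow> r' (?f x) (?f y)"
      using rk_less[OF T xy] rk_less[OF T', of "?f x" "?f y"] rf[OF xy(1)] rf[OF xy(2)] by simp
  qed
qed

text \<open>Reversing both parts is an isomorphism onto the dual.\<close>

lemma self_dual_of_two_chains:
  assumes T: "tour r (A \<union> C)" and disj: "A \<inter> C = {}" and ac: "acyc r C"
    and ini: "\<And>a c c'. a \<in> A \<Longrightarrow> c \<in> C \<Longrightarrow> c' \<in> C \<Longrightarrow> r a c \<Longrightarrow> r c' c \<Longrightarrow> r a c'"
    and g: "bij_betw g A A" "\<And>a b. a \<in> A \<Longrightarrow> b \<in> A \<Longrightarrow> r a b \<longleftrightarrow> r (g b) (g a)"
    and sum: "\<And>a. a \<in> A \<Longrightarrow> card {c \<in> C. r a c} + card {c \<in> C. r (g a) c} = card C"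
  shows "isom r (A \<union> C) (opp r) (A \<union> C)"
proof -
  have TC: "tour r C" using T by (rule tour_subset) simp
  obtain h where h: "bij_betw h C C" "\<And>x. x \<in> C \<Longrightarrow> rk r C (h x) = card C - 1 - rk r C x"
    "\<And>x y. x \<in> C \<Longrightarrow> y \<in> C \<Longrightarrow> r x y \<longleftrightarrow> r (h y) (h x)"
    by (rule reversal_ex[OF TC ac]) blast
  define f where "f x = (if x \<in> A then g x else h x)" for x
  have fA: "f a = g a" if "a \<in> A" for a using that by (simp add: f_def)
  have fC: "f c = h c" if "c \<in> C" for c using that disj by (auto simp: f_def)
  have gA: "g a \<in> A" if "a \<in> A" for a using bij_betwE[OF g(1)] that by blast
  have hC: "h c \<in> C" if "c \<in> C" for c using bij_betwE[OF h(1)] that by blast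
  have b: "bij_betw f (A \<union> C) (A \<union> C)"
  proof (rule bij_betw_combine)
    show "bij_betw f A A" using g(1) fA bij_betw_cong[of A f g A] by blast
    show "bij_betw f C C" using h(1) fC bij_betw_cong[of C f h C] by blast
  qed (rule disj)
  \<comment> \<open>The out-neighbours of \<open>a\<close> in \<open>C\<close> form an initial
    segment, so a single number describes all arcs between \<open>a\<close> and
    \<open>C\<close>.\<close>
  have seg: "r a c \<longleftrightarrow> rk r C c < card {c \<in> C. r a c}" if a: "a \<in> A" and c: "c \<in> C" for a c
  proof -
    have "c \<in> {c \<in> C. r a c} \<longleftrightarrow> rk r C c < card {c \<in> C. r a c}"
      by (rule rk_initial[OF TC ac _ _ c]) (use ini[OF a] in auto)
    then show ?thesis using c by simp
  qed
  have neq: "a \<noteq> c" if "a \<in> A" "c \<in> C" for a c using that disj by blast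
  have cross: "r a c \<longleftrightarrow> r (f c) (f a)" if a: "a \<in> A" and c: "c \<in> C" for a c
  proof -
    have "r (h c) (g a) \<longleftrightarrow> \<not> r (g a) (h c)"
      using tour_flip[OF T, of "g a" "h c"] gA[OF a] hC[OF c] neq by auto
    also have "\<dots> \<longleftrightarrow> \<not> card C - 1 - rk r C c < card C - card {c \<in> C. r a c}"
      using seg[OF gA[OF a] hC[OF c]] h(2)[OF c] sum[OF a] by auto
    also have "\<dots> \<longleftrightarrow> rk r C c < card {c \<in> C. r a c}"
      using rk_upper[OF TC ac c] sum[OF a] by linarith
    also have "\<dots> \<longleftrightarrow> r a c" using seg[OF a c] by simp
    finally show ?thesis using fA[OF a] fC[OF c] by simp
  qed
  show ?thesis
  proof (rule isomI[OF b], unfold conversep_iff)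
    fix x y assume xy: "x \<in> A \<union> C" "y \<in> A \<union> C"
    have bV: "f z \<in> A \<union> C" if "z \<in> A \<union> C" for z using bij_betwE[OF b] that by blast
    consider "x \<in> A" "y \<in> A" | "x \<in> C" "y \<in> C" | "x \<in> A" "y \<in> C" | "x \<in> C" "y \<in> A" using xy by blast
    then show "r x y \<longleftrightarrow> r (f y) (f x)"
    proof cases
      case 1 then show ?thesis using g(2) fA by simp
    next
      case 2 then show ?thesis using h(3) fC by simp
    next
      case 3 then show ?thesis by (rule cross)
    next
      case 4
      have "f x \<noteq> f y"
        using neq[OF 4(2,1)] bij_betw_imp_inj_on[OF b] xy by (auto dest: inj_onD)
      then have "r (f y) (f x) \<longleftrightarrow> \<not> r (f x) (f y)"
        using tour_flip[OF T bV[OF xy(1)] bV[OF xy(2)]] by blast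
      also have "\<dots> \<longleftrightarrow> \<not> r y x" using cross[OF 4(2,1)] by simp
      also have "\<dots> \<longleftrightarrow> r x y" using tour_flip[OF T xy(2,1)] neq[OF 4(2,1)] by blast
      finally show ?thesis by simp
    qed
  qed
qed

text \<open>Out-neighbourhoods are written as in-neighbourhoods of the converse relation.\<close>

definition ins :: "'a arcs \<Rightarrow> 'a set \<Rightarrow> 'a \<Rightarrow> 'a set" where
  "ins r V v = {w \<in> V. r w v}"

lemma ins_subset: "ins r V v \<subseteq> V"
  by (auto simp: ins_def)

definition self_dual_cards :: "'a arcs \<Rightarrow> 'a set \<Rightarrow> nat \<Rightarrow> bool" where
  "self_dual_cards r V q \<longleftrightarrow> (\<forall>X \<subseteq> V. card X = q \<longrightarrow> isom r (V - X) (opp r) (V - X))"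

lemma self_dual_cardsD:
  "self_dual_cards r V q \<Longrightarrow> X \<subseteq> V \<Longrightarrow> card X = q \<Longrightarrow> isom r (V - X) (opp r) (V - X)"
  by (simp add: self_dual_cards_def)

lemma self_dual_cards_dual: "self_dual_cards r V q \<Longrightarrow> self_dual_cards (opp r) V q"
  unfolding self_dual_cards_def conversep_conversep
proof (intro allI impI)
  fix X assume "\<forall>X \<subseteq> V. card X = q \<longrightarrow> isom r (V - X) (opp r) (V - X)" "X \<subseteq> V" "card X = q"
  then have "isom r (V - X) (opp r) (V - X)" by simp
  then show "isom (opp r) (V - X) r (V - X)" by (rule isom_sym)
qed

text \<open>A common lower bound for in- and out-degrees is kept so that the locale is closed under
  duality; that it is attained is assumed only where needed.\<close>

locale loc_trans =
  fixes r :: "'a arcs" and V :: "'a set" and d :: nat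
  assumes T: "tour r V" and o3: "out3 r V" and i3: "out3 (opp r) V"
    and d1: "d \<ge> 1" and din: "\<And>v. v \<in> V \<Longrightarrow> d \<le> card (ins r V v)"
    and dout: "\<And>v. v \<in> V \<Longrightarrow> d \<le> card (ins (opp r) V v)"

lemma (in loc_trans) dual: "loc_trans (opp r) V d"
  by unfold_locales (use T o3 i3 d1 din dout in simp_all)

lemma (in loc_trans) fin: "finite V"
  using T by (rule tour_finite)

lemma (in loc_trans) acyc_ins: "acyc r (ins r V x)" if "x \<in> V"
  unfolding acyc_def
proof (intro ballI impI notI)
  fix a b c assume "a \<in> ins r V x" "b \<in> ins r V x" "c \<in> ins r V x" "r a b" "r b c" "r c a"
  then show False using out3D[OF o3, of a b c x] that by (auto simp: ins_def)
qed

text \<open>The partner is the sink of the transitive out-neighbourhood: its out-neighbours lie in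
  \<open>ins r V x\<close>, and equality holds because \<open>d\<close> is the minimum degree.\<close>

lemma (in loc_trans) partner:
  assumes x: "x \<in> V" "card (ins r V x) = d"
  obtains y where "y \<in> V" "ins (opp r) V y = ins r V x"
proof -
  interpret D: loc_trans "opp r" V d by (rule dual)
  let ?O = "ins (opp r) V x"
  have ac: "acyc r ?O" using acyc_dual[OF D.acyc_ins[OF x(1)]] by simp
  have TO: "tour r ?O" by (rule tour_subset[OF T ins_subset])
  have "card ?O > 0" using dout[OF x(1)] d1 by linarith
  then obtain y where y: "y \<in> ?O" "rk r ?O y = card ?O - 1"
    using rk_ex[OF TO ac, of "card ?O - 1"] by auto
  have yV: "y \<in> V" "r x y" using y by (auto simp: ins_def)
  have "ins (opp r) V y \<subseteq> ins r V x"
  proof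
    fix w assume "w \<in> ins (opp r) V y"
    then have w: "w \<in> V" "r y w" by (auto simp: ins_def)
    have "w \<notin> ?O" using rk_less[OF TO ac y(1), of w] rk_upper[OF TO ac, of w] y(2) w(2) by auto
    moreover have "w \<noteq> x" using w yV tour_asym[OF T] x(1) by blast
    ultimately show "w \<in> ins r V x" using tour_flip[OF T x(1) w(1)] w(1) by (auto simp: ins_def)
  qed
  then have "ins (opp r) V y = ins r V x"
    by (intro card_seteq) (use dout[OF yV(1)] x(2) fin in \<open>auto simp: ins_def\<close>)
  then show thesis using that yV by blast
qed

text \<open>\<open>C\<close> turns out to be a chain with source \<open>x\<close> and sink
  \<open>y\<close>, and every point of \<open>A\<close> dominates \<open>x\<close> and is dominated
  by \<open>y\<close>. Dualising exchanges \<open>x\<close> and \<open>y\<close> and keeps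
  \<open>A\<close> and \<open>C\<close>.\<close>

locale polar_pair = loc_trans +
  fixes x y :: 'a and A C :: "'a set"
  assumes x: "x \<in> V" and y: "y \<in> V" and Ax: "A = ins r V x" and Ay: "A = ins (opp r) V y"
    and cA: "card A = d" and Cdef: "C = V - A"
begin

lemma pdual: "polar_pair (opp r) V d y x A C"
  by (intro polar_pair.intro dual polar_pair_axioms.intro) (use x y Ax Ay cA Cdef in auto)

definition p :: "'a \<Rightarrow> nat" where "p a = card {c \<in> C. r a c}"

lemma AV: "A \<subseteq> V" using Ax by (auto simp: ins_def)
lemma CV: "C \<subseteq> V" using Cdef by auto
lemma AC: "A \<inter> C = {}" using Cdef by auto
lemma VAC: "V = A \<union> C" using Cdef AV by auto
lemma finA: "finite A" using AV fin finite_subset by blast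
lemma finC: "finite C" using CV fin finite_subset by blast
lemma Ane: "A \<noteq> {}" using cA d1 by auto
lemma Axr: "a \<in> A \<Longrightarrow> r a x" using Ax by (simp add: ins_def)
lemma Ayr: "a \<in> A \<Longrightarrow> r y a" using Ay by (simp add: ins_def)
lemma xC: "x \<in> C" using x tour_irrefl[OF T x] Ax Cdef by (auto simp: ins_def)
lemma yC: "y \<in> C" using y tour_irrefl[OF T y] Ay Cdef by (auto simp: ins_def)

lemma xy: "x \<noteq> y"
  using Ane Axr Ayr tour_asym[OF T] AV x by blast

lemma x_first: "c \<in> C \<Longrightarrow> c \<noteq> x \<Longrightarrow> r x c"
  using tour_flip[OF T, of c x] x Ax Cdef by (auto simp: ins_def)

lemma y_last: "c \<in> C \<Longrightarrow> c \<noteq> y \<Longrightarrow> r c y"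
  using tour_flip[OF T, of y c] y Ay Cdef by (auto simp: ins_def)

lemma flip: "u \<in> V \<Longrightarrow> v \<in> V \<Longrightarrow> u \<noteq> v \<Longrightarrow> \<not> r u v \<longleftrightarrow> r v u"
  using tour_flip[OF T] .

lemma asym: "r u v \<Longrightarrow> u \<in> V \<Longrightarrow> v \<in> V \<Longrightarrow> \<not> r v u"
  using tour_asym[OF T] by blast

lemma TA: "tour r A" and TC: "tour r C"
  using tour_subset[OF T] AV CV by auto

lemma acA: "acyc r A" using acyc_ins[OF x] Ax by simp

text \<open>Points dominating \<open>x\<close> are in \<open>A\<close>, so a 3-cycle inside
  \<open>C\<close> would avoid \<open>x\<close> and be dominated by it.\<close>

lemma acC: "acyc r C"
  unfolding acyc_def
proof (intro ballI impI notI)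
  fix a b c assume C: "a \<in> C" "b \<in> C" "c \<in> C" and cy: "r a b" "r b c" "r c a"
  have ne: "z \<noteq> x" if "w \<in> C" "z \<in> C" "r w z" for w z
  proof
    assume "z = x"
    then have "w \<in> A" using that CV Ax by (auto simp: ins_def)
    then show False using that AC by blast
  qed
  have "r x a" "r x b" "r x c" using x_first ne C cy by blast+
  then show False using out3D[OF i3, of c b a x] C CV cy x by auto
qed

text \<open>Otherwise \<open>a\<close>, \<open>x\<close>, \<open>c'\<close> is a 3-cycle dominating
  \<open>c\<close>.\<close>

lemma ini:
  assumes "a \<in> A" "c \<in> C" "c' \<in> C" "r a c" "r c' c" shows "r a c'"
proof (rule ccontr)
  assume n: "\<not> r a c'"
  have V: "a \<in> V" "c \<in> V" "c' \<in> V" "a \<noteq> c'" using assms AV CV AC by auto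
  have c'a: "r c' a" using n flip V by blast
  have "c' \<noteq> x" using n Axr assms(1) by blast
  then have xc': "r x c'" using x_first assms(3) by blast
  have "c \<noteq> x" using xc' assms(5) asym x V by blast
  then have "r x c" using x_first assms(2) by blast
  then show False using out3D[OF o3 V(1) x V(3,2)] Axr[OF assms(1)] xc' c'a assms(4,5) by blast
qed

text \<open>Otherwise \<open>b\<close>, \<open>x\<close>, \<open>c\<close> is a 3-cycle dominated by
  \<open>a\<close>.\<close>

lemma nested:
  assumes "a \<in> A" "b \<in> A" "r a b" "c \<in> C" "r a c" shows "r b c"
proof (rule ccontr)
  assume n: "\<not> r b c"
  have V: "a \<in> V" "b \<in> V" "c \<in> V" "b \<noteq> c" using assms AV CV AC by auto
  have cb: "r c b" using n flip V by blast
  have "c \<noteq> x" using n Axr assms(2) by blast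
  then have "r x c" using x_first assms(4) by blast
  then show False
    using out3D[OF i3, of c x b a] V x cb Axr[OF assms(1)] Axr[OF assms(2)] assms by auto
qed

lemma p_mono:
  assumes "a \<in> A" "b \<in> A" "r a b" shows "p a \<le> p b"
  unfolding p_def
proof (rule card_mono)
  show "{c \<in> C. r a c} \<subseteq> {c \<in> C. r b c}" using nested[OF assms] by blast
qed (use finC in simp)

lemma p_bounds: "a \<in> A \<Longrightarrow> 1 \<le> p a" "a \<in> A \<Longrightarrow> p a + 1 \<le> card C"
proof -
  assume a: "a \<in> A"
  have "{x} \<subseteq> {c \<in> C. r a c}" using Axr[OF a] xC by blast
  then show "1 \<le> p a" unfolding p_def using card_mono[of "{c \<in> C. r a c}" "{x}"] finC by simp
  have "\<not> r a y" using asym[OF Ayr[OF a] y] a AV by blast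
  then have "{c \<in> C. r a c} \<subset> C" using yC by blast
  from psubset_card_mono[OF finC this] show "p a + 1 \<le> card C" unfolding p_def by simp
qed

lemma card_co: "a \<in> A \<Longrightarrow> card {c \<in> C. r c a} = card C - p a"
proof -
  assume a: "a \<in> A"
  have "r c a \<longleftrightarrow> \<not> r a c" if "c \<in> C" for c
    using flip[of a c] that a AV CV AC by blast
  then have "{c \<in> C. r c a} = C - {c \<in> C. r a c}" by blast
  then show ?thesis unfolding p_def by (simp add: card_Diff_subset finC)
qed

lemma cardV: "card V = d + card C"
  using VAC card_Un_disjoint[OF finA finC AC] cA by simp

text \<open>Reduces self-duality to the numbers \<open>p\<close>: they encode all arcs between the
  two chains.\<close>

lemma self_dualI:
  assumes g: "bij_betw g A A" "\<And>a b. a \<in> A \<Longrightarrow> b \<in> A \<Longrightarrow> r a b \<longleftrightarrow> r (g b) (g a)"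
    and sum: "\<And>a. a \<in> A \<Longrightarrow> p a + p (g a) = card C"
  shows "isom r V (opp r) V"
proof -
  have "isom r (A \<union> C) (opp r) (A \<union> C)"
  proof (rule self_dual_of_two_chains[where g = g])
    show "tour r (A \<union> C)" using T VAC by simp
    show "r a c'" if "a \<in> A" "c \<in> C" "c' \<in> C" "r a c" "r c' c" for a c c' using ini[OF that] .
    show "card {c \<in> C. r a c} + card {c \<in> C. r (g a) c} = card C" if "a \<in> A" for a
      using sum[OF that] by (simp add: p_def)
  qed (rule AC acC g; assumption?)+
  then show ?thesis using VAC by simp
qed

end

section \<open>Self-dual cards and trimming for small minimum degree\<close>

lemma isom_ins:
  assumes f: "bij_betw f W W" "\<And>u v. u \<in> W \<Longrightarrow> v \<in> W \<Longrightarrow> r u v \<longleftrightarrow> (opp r) (f u) (f v)" and w: "w \<in> W"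
  shows "f ` ins r W w = ins (opp r) W (f w)" "card (ins r W w) = card (ins (opp r) W (f w))"
proof -
  have im: "f ` W = W" and inj: "inj_on f W" using f(1) by (auto simp: bij_betw_def)
  have fW: "f u \<in> W" if "u \<in> W" for u using im that by blast
  show "f ` ins r W w = ins (opp r) W (f w)"
  proof (intro equalityI subsetI)
    fix z assume "z \<in> ins (opp r) W (f w)"
    then have z: "z \<in> W" "r (f w) z" by (auto simp: ins_def)
    then obtain u where "u \<in> W" "z = f u" using im by blast
    then show "z \<in> f ` ins r W w" using z f(2)[of u w] w by (auto simp: ins_def)
  qed (use f(2) w fW in \<open>auto simp: ins_def\<close>)
  then show "card (ins r W w) = card (ins (opp r) W (f w))"
    using card_image[OF inj_on_subset[OF inj ins_subset], of r w] by simp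
qed

text \<open>Of the \<open>m\<close> points of \<open>C\<close>, \<open>p\<close> are dominated by
  \<open>a\<close>; \<open>j\<close> of them and \<open>K - j\<close> others are deleted, sparing
  \<open>x\<close> and \<open>y\<close> and leaving two or more on each side. For
  \<open>K = 0\<close> parity prevents balance. If \<open>p = 2\<close> or \<open>p + 2 = m\<close>,
  a side of size 2 is left against a total of at least 5; otherwise two consecutive \<open>j\<close>
  are admissible and cannot both balance.\<close>

lemma trim_arith:
  fixes p m K :: nat
  assumes "2 \<le> p" "p + 2 \<le> m" "(1 \<le> K \<and> K + 5 \<le> m) \<or> (K = 0 \<and> odd m)"
  obtains j where "j \<le> K" "j + 1 \<le> p" "K - j + 1 \<le> m - p" "2 \<le> p - j" "p - j + 2 \<le> m - K"
    "2 * (p - j) \<noteq> m - K"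
proof (cases "K = 0")
  case True
  show thesis by (rule that[of 0]) (use True assms in \<open>auto elim: oddE\<close>)
next
  case False
  then have K: "1 \<le> K" "K + 5 \<le> m" using assms(3) by auto
  define lo where "lo = (p + K + 2) - m"
  define hi where "hi = min K (p - 2)"
  show thesis
  proof (cases "p = 2")
    case True
    show thesis by (rule that[of 0]) (use True K in auto)
  next
    case p2: False
    show thesis
    proof (cases "p + 2 = m")
      case True
      show thesis by (rule that[of K]) (use True K assms in auto)
    next
      case False
      then have h: "lo + 1 \<le> hi" using p2 assms K unfolding lo_def hi_def by auto
      have ok: "j \<le> K \<and> j + 1 \<le> p \<and> K - j + 1 \<le> m - p \<and> 2 \<le> p - j \<and> p - j + 2 \<le> m - K"
        if "lo \<le> j" "j \<le> hi" for j
        using that assms K unfolding lo_def hi_def by auto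
      show thesis
      proof (cases "2 * (p - lo) = m - K")
        case True
        then have "2 * (p - (lo + 1)) \<noteq> m - K" using ok[of "lo + 1"] h by auto
        then show thesis using that[of "lo + 1"] ok[of "lo + 1"] h by auto
      next
        case False
        then show thesis using that[of lo] ok[of lo] h by auto
      qed
    qed
  qed
qed

context polar_pair
begin

text \<open>After the deletion \<open>x\<close> is the only vertex of in-degree at most 1 and \<open>y\<close> the only one of
  out-degree at most 1, so an isomorphism onto the dual maps \<open>x\<close> to \<open>y\<close> and fixes \<open>a\<close>.\<close>

lemma balanced_after_trimming:
  assumes a: "a \<in> A" and X: "X \<subseteq> C" "x \<notin> X" "y \<notin> X"
    and sd: "isom r (V - ((A - {a}) \<union> X)) (opp r) (V - ((A - {a}) \<union> X))"
    and two: "2 \<le> card {c \<in> C - X. r a c}" "card {c \<in> C - X. r a c} + 2 \<le> card (C - X)"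
  shows "2 * card {c \<in> C - X. r a c} = card (C - X)"
proof -
  let ?D = "C - X"
  let ?P = "{c \<in> ?D. r a c}" and ?Q = "{c \<in> ?D. r c a}"
  define W where "W = insert a ?D"
  have aV: "a \<in> V" "a \<notin> C" using a AV AC by auto
  have W: "V - ((A - {a}) \<union> X) = W" using a X AV Cdef unfolding W_def by blast
  obtain f where f: "bij_betw f W W" "\<And>u v. u \<in> W \<Longrightarrow> v \<in> W \<Longrightarrow> r u v \<longleftrightarrow> (opp r) (f u) (f v)"
    using sd unfolding W by (auto elim: isomE)
  have finW: "finite W" using finC by (simp add: W_def)
  have D: "x \<in> ?D" "y \<in> ?D" using xC yC X by auto
  then have xW: "x \<in> W" and yW: "y \<in> W" and aW: "a \<in> W" by (auto simp: W_def)
  have WV: "W \<subseteq> V" using aV CV by (auto simp: W_def)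
  have insx: "ins r W x = {a}"
  proof -
    have "\<not> r c x" if "c \<in> ?D" for c
      using x_first[of c] that asym[of x c] x CV tour_irrefl[OF T x] by (cases "c = x") auto
    then show ?thesis using Axr[OF a] by (auto simp: ins_def W_def)
  qed
  have outy: "ins (opp r) W y = {a}"
  proof -
    have "\<not> r y c" if "c \<in> ?D" for c
      using y_last[of c] that asym[of c y] y CV tour_irrefl[OF T y] by (cases "c = y") auto
    then show ?thesis using Ayr[OF a] by (auto simp: ins_def W_def)
  qed
  have PQ: "?Q = ?D - ?P"
  proof -
    have "r c a \<longleftrightarrow> \<not> r a c" if "c \<in> ?D" for c
      using flip[of a c] that aV CV by blast
    then show ?thesis by blast
  qed
  have cPQ: "card ?P + card ?Q = card ?D"
  proof -
    have "card (?D - ?P) = card ?D - card ?P" using finC by (intro card_Diff_subset) auto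
    moreover have "card ?P \<le> card ?D" using finC by (intro card_mono) auto
    ultimately show ?thesis unfolding PQ by linarith
  qed
  have uniq: "w = y" if w: "w \<in> W" "card (ins (opp r) W w) \<le> 1" for w
  proof (rule ccontr)
    assume wy: "w \<noteq> y"
    have fO: "finite (ins (opp r) W w)" by (rule finite_subset[OF ins_subset finW])
    have "w = a \<or> w \<in> ?D" using w(1) by (simp add: W_def)
    moreover have "r a w \<or> r w a" if "w \<in> ?D" using flip[of a w] that aV CV by blast
    ultimately consider "w = a" | "w \<in> ?P" | "w \<in> ?Q" by auto
    then show False
    proof cases
      case 1
      have "?P \<subseteq> ins (opp r) W w" using 1 by (auto simp: ins_def W_def)
      from card_mono[OF fO this] show False using two(1) w(2) by linarith
    next
      case 2
      have "r w q" if q: "q \<in> ?Q" for q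
      proof (rule ccontr)
        assume n: "\<not> r w q"
        have ww: "w \<in> C" "q \<in> C" "r a w" using 2 q by auto
        have "w \<noteq> q" using 2 q PQ by auto
        then have "r q w" using n flip[of w q] ww CV by blast
        then have "r a q" using ini[OF a ww(1,2,3)] by blast
        then show False using q asym[of a q] aV CV by blast
      qed
      then have "?Q \<subseteq> ins (opp r) W w" by (auto simp: ins_def W_def)
      from card_mono[OF fO this] have "card ?Q \<le> 1" using w(2) by linarith
      then show False using cPQ two(2) by linarith
    next
      case 3
      then have "{a, y} \<subseteq> ins (opp r) W w" using y_last[of w] wy yW aW by (auto simp: ins_def)
      from card_mono[OF fO this] have "card {a, y} \<le> 1" using w(2) by linarith
      moreover have "a \<noteq> y" using aV yC by blast
      then have "card {a, y} = 2" by simp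
      ultimately show False by simp
    qed
  qed
  have fx: "f x \<in> W" using bij_betwE[OF f(1)] xW by blast
  have "card (ins (opp r) W (f x)) = 1" using isom_ins(2)[OF f xW] insx by simp
  then have "f x = y" using uniq[OF fx] by simp
  then have "f a = a" using isom_ins(1)[OF f xW] insx outy by auto
  then have "card (ins r W a) = card (ins (opp r) W a)" using isom_ins(2)[OF f aW] by simp
  moreover have "ins r W a = ?Q" "ins (opp r) W a = ?P"
    using tour_irrefl[OF T aV(1)] by (auto simp: ins_def W_def)
  ultimately have "card ?Q = card ?P" by simp
  then show ?thesis using cPQ by linarith
qed

text \<open>Deleting \<open>A - {a}\<close> and \<open>K\<close> points of \<open>C\<close> removes
  \<open>d - 1 + K = q\<close> points. The points are chosen to leave \<open>a\<close> unbalanced,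
  which a self-dual card forbids.\<close>

lemma p_extreme:
  assumes a: "a \<in> A" and H: "self_dual_cards r V q" and q: "q + 1 = d + K"
    and K: "(1 \<le> K \<and> K + 5 \<le> card C) \<or> (K = 0 \<and> odd (card C))"
  shows "p a = 1 \<or> p a + 1 = card C"
proof (rule ccontr)
  assume n: "\<not> ?thesis"
  let ?P = "{c \<in> C. r a c}"
  have P: "2 \<le> p a" "p a + 2 \<le> card C" using n p_bounds[OF a] by auto
  obtain j where j: "j \<le> K" "j + 1 \<le> p a" "K - j + 1 \<le> card C - p a" "2 \<le> p a - j"
    "p a - j + 2 \<le> card C - K" "2 * (p a - j) \<noteq> card C - K"
    by (rule trim_arith[OF P K])
  have xP: "x \<in> ?P" using xC Axr[OF a] by simp
  have yP: "y \<in> C - ?P" using yC Ayr[OF a] asym[of y a] y a AV by blast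
  have cP: "card ?P = p a" by (simp add: p_def)
  have cQ: "card (C - ?P) = card C - p a" using finC by (simp add: card_Diff_subset p_def)
  have "j \<le> card (?P - {x})" using j(2) cP xP finC by simp
  then obtain X1 where X1: "X1 \<subseteq> ?P - {x}" "card X1 = j" "finite X1"
    by (rule obtain_subset_with_card_n)
  have "K - j \<le> card (C - ?P - {y})" using j(3) cQ yP finC by simp
  then obtain X2 where X2: "X2 \<subseteq> C - ?P - {y}" "card X2 = K - j" "finite X2"
    by (rule obtain_subset_with_card_n)
  let ?X = "X1 \<union> X2"
  have disj: "X1 \<inter> X2 = {}" using X1 X2 by blast
  have cX: "card ?X = K" using card_Un_disjoint[OF X1(3) X2(3) disj] X1(2) X2(2) j(1) by simp
  have XC: "?X \<subseteq> C" using X1 X2 by blast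
  have Pj: "{c \<in> C - ?X. r a c} = ?P - X1" using X2 by blast
  have cPj: "card {c \<in> C - ?X. r a c} = p a - j"
    unfolding Pj using X1 finC cP by (subst card_Diff_subset) auto
  have cCX: "card (C - ?X) = card C - K" using cX XC X1(3) X2(3) by (simp add: card_Diff_subset)
  have "2 * card {c \<in> C - ?X. r a c} = card (C - ?X)"
  proof (rule balanced_after_trimming[OF a XC])
    show "x \<notin> ?X" "y \<notin> ?X" using X1 X2 xP yP by blast+
    have "(A - {a}) \<inter> ?X = {}" using XC AC by blast
    then have "card ((A - {a}) \<union> ?X) = card (A - {a}) + card ?X"
      using finA X1(3) X2(3) by (intro card_Un_disjoint) auto
    also have "\<dots> = q" using cA a finA cX q d1 by simp
    finally have c: "card ((A - {a}) \<union> ?X) = q" .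
    show "isom r (V - ((A - {a}) \<union> ?X)) (opp r) (V - ((A - {a}) \<union> ?X))"
      by (rule self_dual_cardsD[OF H _ c]) (use XC CV AV in blast)
    show "2 \<le> card {c \<in> C - ?X. r a c}" "card {c \<in> C - ?X. r a c} + 2 \<le> card (C - ?X)"
      unfolding cPj cCX using j by auto
  qed
  then show False unfolding cPj cCX using j(6) by simp
qed

text \<open>The second point of the chain \<open>C\<close> has only \<open>x\<close> as in-neighbour
  inside \<open>C\<close>; its other in-neighbours, at least \<open>d - 1\<close>, are in
  \<open>A\<close> and dominate two points of \<open>C\<close>.\<close>

lemma many_large: "d \<le> 1 + card {a \<in> A. 2 \<le> p a}"
proof -
  have m: "1 < card C" using p_bounds Ane by fastforce
  obtain c where c: "c \<in> C" "rk r C c = 1" by (rule rk_ex[OF TC acC m])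
  have cx: "c \<noteq> x"
  proof
    assume "c = x"
    then have none: "{z \<in> C. r z c} = {}"
      using x_first asym[of x] x CV tour_irrefl[OF T x] by blast
    show False using c(2) unfolding rk_def none by simp
  qed
  have "ins r V c \<subseteq> {z \<in> C. r z c} \<union> {a \<in> A. 2 \<le> p a}"
  proof
    fix w assume w: "w \<in> ins r V c"
    show "w \<in> {z \<in> C. r z c} \<union> {a \<in> A. 2 \<le> p a}"
    proof (cases "w \<in> C")
      case True
      then show ?thesis using w by (simp add: ins_def)
    next
      case False
      then have wA: "w \<in> A" using w VAC by (auto simp: ins_def)
      have "{x, c} \<subseteq> {z \<in> C. r w z}" using xC c Axr[OF wA] w by (auto simp: ins_def)
      from card_mono[OF _ this] have "2 \<le> p w" using finC cx by (simp add: p_def)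
      then show ?thesis using wA by simp
    qed
  qed
  from card_mono[OF _ this] have "card (ins r V c) \<le> card ({z \<in> C. r z c} \<union> {a \<in> A. 2 \<le> p a})"
    using finA finC by simp
  also have "\<dots> \<le> 1 + card {a \<in> A. 2 \<le> p a}"
    using card_Un_le[of "{z \<in> C. r z c}" "{a \<in> A. 2 \<le> p a}"] c(2) by (simp add: rk_def)
  finally show ?thesis using din[of c] c(1) CV by (meson le_trans subsetD)
qed

lemma p_dual: "a \<in> A \<Longrightarrow> polar_pair.p (opp r) C a = card C - p a"
  using card_co polar_pair.p_def[OF pdual] by simp

lemma many_small: "d \<le> 1 + card {a \<in> A. p a + 2 \<le> card C}"
proof -
  interpret D: polar_pair "opp r" V d y x A C by (rule pdual)
  have "2 \<le> D.p a \<longleftrightarrow> p a + 2 \<le> card C" if "a \<in> A" for a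
    using p_dual[OF that] p_bounds[OF that] by linarith
  then have "{a \<in> A. 2 \<le> D.p a} = {a \<in> A. p a + 2 \<le> card C}" by blast
  then show ?thesis using D.many_large by simp
qed

text \<open>The points with the largest and those with the smallest \<open>p\<close> are disjoint
  parts of \<open>A\<close>, each with at least \<open>d - 1\<close> points; hence \<open>d\<close>
  is 1 or 2.\<close>

lemma self_dual_extreme:
  assumes ext: "\<And>a. a \<in> A \<Longrightarrow> p a = 1 \<or> p a + 1 = card C" and m: "3 \<le> card C"
  shows "isom r V (opp r) V"
proof -
  have "{a \<in> A. 2 \<le> p a} \<inter> {a \<in> A. p a + 2 \<le> card C} = {}" using ext m by fastforce
  then have "card {a \<in> A. 2 \<le> p a} + card {a \<in> A. p a + 2 \<le> card C} \<le> card A"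
    using finA by (subst card_Un_disjoint[symmetric]) (auto intro: card_mono)
  then have d2: "d \<le> 2" using many_large many_small cA by linarith
  show ?thesis
  proof (cases "d = 1")
    case True
    then obtain a where a: "A = {a}" using cA by (auto simp: card_1_singleton_iff)
    have aA: "a \<in> A" using a by simp
    have aV: "a \<in> V" "a \<notin> C" using aA AV AC by auto
    \<comment> \<open>\<open>V\<close> is a 3-cycle with one vertex replaced by the chain
      \<open>C - {z}\<close>; that chain and the pair \<open>{a, z}\<close> serve as the two
      chains.\<close>
    have core: "isom r V (opp r) V"
      if z: "z \<in> C" and ne: "\<And>c. c \<in> C - {z} \<Longrightarrow>
        (r c a \<and> r z c \<and> r a z) \<or> (r a c \<and> r c z \<and> r z a)" for z
    proof -
      have Tz: "tour r (C - {z})" and acz: "acyc r (C - {z})"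
        using TC acC by (auto intro: tour_subset acyc_subset)
      obtain h where h: "bij_betw h (C - {z}) (C - {z})"
        "\<And>u v. u \<in> C - {z} \<Longrightarrow> v \<in> C - {z} \<Longrightarrow> r u v \<longleftrightarrow> r (h v) (h u)"
        by (rule reversal_ex[OF Tz acz]) blast
      have ir: "\<not> r a a" "\<not> r z z" using tour_irrefl[OF T] aV z CV by blast+
      have az: "a \<noteq> z" using aV z by blast
      have one: "card {c \<in> {a, z}. r w c} = 1" if w: "w \<in> C - {z}" for w
      proof -
        have wV: "w \<in> V" "z \<in> V" using w z CV by auto
        have "{c \<in> {a, z}. r w c} = {a} \<or> {c \<in> {a, z}. r w c} = {z}"
          using ne[OF w] asym[of z w] asym[of a w] wV aV by blast
        then show ?thesis by auto
      qed
      have "isom r ((C - {z}) \<union> {a, z}) (opp r) ((C - {z}) \<union> {a, z})"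
      proof (rule self_dual_of_two_chains[where g = h])
        have e: "(C - {z}) \<union> {a, z} = V" using VAC a z by blast
        show "tour r ((C - {z}) \<union> {a, z})" unfolding e by (rule T)
        show "(C - {z}) \<inter> {a, z} = {}" using aV by blast
        show "acyc r {a, z}" unfolding acyc_def using ir asym[of a z] asym[of z a] aV z CV by blast
        show "r w c'" if w: "w \<in> C - {z}" "c \<in> {a, z}" "c' \<in> {a, z}" "r w c" "r c' c" for w c c'
          using ne[OF w(1)] w ir asym[of z a] asym[of a z] asym[of z w] asym[of a w] aV z CV by blast
        show "card {c \<in> {a, z}. r w c} + card {c \<in> {a, z}. r (h w) c} = card {a, z}"
          if "w \<in> C - {z}" for w
          using one[OF that] one[of "h w"] bij_betwE[OF h(1)] that az by simp
      qed (rule h, (assumption+)?)+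
      moreover have "(C - {z}) \<union> {a, z} = V" using VAC a z by blast
      ultimately show ?thesis by simp
    qed
    from ext[OF aA] show ?thesis
    proof
      assume "p a = 1"
      then obtain z where z: "{c \<in> C. r a c} = {z}" by (auto simp: p_def card_1_singleton_iff)
      moreover have "x \<in> {c \<in> C. r a c}" using xC Axr[OF aA] by blast
      ultimately have zx: "z = x" by simp
      show ?thesis
      proof (rule core[OF xC])
        fix c assume c: "c \<in> C - {x}"
        then have "\<not> r a c" using z zx by blast
        then have "r c a" using flip[of a c] c aV CV by blast
        then show "(r c a \<and> r x c \<and> r a x) \<or> (r a c \<and> r c x \<and> r x a)"
          using x_first c Axr[OF aA] by blast
      qed
    next
      assume "p a + 1 = card C"
      then have "card {c \<in> C. r c a} = 1" using card_co[OF aA] by simp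
      then obtain z where z: "{c \<in> C. r c a} = {z}" by (auto simp: card_1_singleton_iff)
      moreover have "y \<in> {c \<in> C. r c a}" using yC Ayr[OF aA] by blast
      ultimately have zy: "z = y" by simp
      show ?thesis
      proof (rule core[OF yC])
        fix c assume c: "c \<in> C - {y}"
        then have "\<not> r c a" using z zy by blast
        then have "r a c" using flip[of c a] c aV CV by blast
        then show "(r c a \<and> r y c \<and> r a y) \<or> (r a c \<and> r c y \<and> r y a)"
          using y_last c Ayr[OF aA] by blast
      qed
    qed
  next
    case False
    then have d: "d = 2" using d2 d1 by simp
    \<comment> \<open>For \<open>d = 2\<close> both extremes occur, and exchanging the two points of
      \<open>A\<close> makes their values add up to \<open>card C\<close>.\<close>
    have "0 < card {a \<in> A. 2 \<le> p a}" "0 < card {a \<in> A. p a + 2 \<le> card C}"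
      using many_large many_small d by linarith+
    then have "{a \<in> A. 2 \<le> p a} \<noteq> {}" "{a \<in> A. p a + 2 \<le> card C} \<noteq> {}"
      by (metis card.empty less_irrefl)+
    then obtain b a where ab: "b \<in> A" "2 \<le> p b" "a \<in> A" "p a + 2 \<le> card C" by blast
    then have pb: "p b + 1 = card C" "p a = 1" using ext[of a] ext[of b] by auto
    then have ne: "a \<noteq> b" using ab by auto
    have "card {a, b} = card A" using ne d cA by simp
    then have A: "A = {a, b}" using card_subset_eq[OF finA, of "{a, b}"] ab by auto
    define g where "g z = (if z = a then b else a)" for z
    have "bij_betw g A A" unfolding A g_def bij_betw_def using ne by (auto simp: inj_on_def)
    moreover have "r u v \<longleftrightarrow> r (g v) (g u)" if "u \<in> A" "v \<in> A" for u v
      using that ne tour_irrefl[OF T] ab AV unfolding A g_def by auto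
    moreover have "p u + p (g u) = card C" if "u \<in> A" for u
      using that pb ne unfolding A g_def by auto
    ultimately show ?thesis by (rule self_dualI)
  qed
qed

section \<open>Minimum degree at least 4: excess of out- over in-neighbours within
  \<open>C\<close>\<close>

definition e :: "'a \<Rightarrow> int" where "e a = 2 * int (p a) - int (card C)"

lemma unique_in_set:
  assumes "w \<in> V" "A \<subseteq> ins r V w" "card (ins r V w) = d" shows "w = x"
proof (rule ccontr)
  assume n: "w \<noteq> x"
  have "finite (ins r V w)" by (rule finite_subset[OF ins_subset fin])
  then have eq: "A = ins r V w" using assms(2,3) cA card_subset_eq by metis
  have "w \<notin> A" using eq tour_irrefl[OF T assms(1)] by (auto simp: ins_def)
  then have "r x w" using x_first[of w] n assms(1) Cdef by blast
  then have "x \<in> A" using eq x by (auto simp: ins_def)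
  then show False using xC AC by blast
qed

text \<open>Otherwise \<open>w\<close>, \<open>a\<close>, \<open>v\<close> is a 3-cycle dominated by
  \<open>u\<close>.\<close>

lemma convex:
  assumes "w \<in> V" "w \<notin> A" "u \<in> A" "a \<in> A" "v \<in> A" "r u a" "r a v" "r u w" "r v w"
  shows "r a w"
proof (rule ccontr)
  assume n: "\<not> r a w"
  have V: "u \<in> V" "a \<in> V" "v \<in> V" "a \<noteq> w" using assms AV by auto
  have "r w a" using n flip V assms(1) by blast
  moreover have "r u v" using acyc_trans[OF TA acA] assms by blast
  ultimately show False using out3D[OF i3, of w v a u] V assms by auto
qed

text \<open>After deleting \<open>X\<close>, only \<open>x\<close> has in-degree \<open>d - 3\<close>, so an isomorphism onto the dual maps it to
  \<open>y\<close>. Then it preserves \<open>A - X\<close> and \<open>C\<close> and changes the sign of \<open>e\<close>.\<close>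

lemma excess_sum_zero:
  assumes X: "X \<subseteq> A" "card X = 3" and H: "self_dual_cards r V 3"
    and uniq: "\<And>w. w \<in> V \<Longrightarrow> X \<subseteq> ins r V w \<Longrightarrow> card (ins r V w) = d \<Longrightarrow> w = x"
  shows "(\<Sum>a \<in> A - X. e a) = 0"
proof -
  define W where "W = V - X"
  have "isom r W (opp r) W" unfolding W_def by (rule self_dual_cardsD[OF H _ X(2)]) (use X AV in blast)
  then obtain f where f: "bij_betw f W W" "\<And>u v. u \<in> W \<Longrightarrow> v \<in> W \<Longrightarrow> r u v \<longleftrightarrow> (opp r) (f u) (f v)"
    by (auto elim: isomE)
  have fX: "finite X" using X(1) finA finite_subset by blast
  have WAC: "W = (A - X) \<union> C" "(A - X) \<inter> C = {}" using VAC AC X(1) unfolding W_def by blast+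
  have xW: "x \<in> W" and yW: "y \<in> W" using WAC xC yC by auto
  have cAX: "card (A - X) = d - 3" using X fX cA by (simp add: card_Diff_subset)
  have insx: "ins r W x = A - X" using Ax by (auto simp: ins_def W_def)
  have outy: "ins (opp r) W y = A - X" using Ay by (auto simp: ins_def W_def)
  have d3: "3 \<le> d" using X cA card_mono[OF finA X(1)] by simp
  have im: "f ` W = W" using f(1) by (simp add: bij_betw_def)
  have inj: "inj_on f W" using f(1) by (simp add: bij_betw_def)
  obtain w0 where w0: "w0 \<in> W" "f w0 = y" using im yW by (metis imageE)
  have cw: "card (ins r W w0) = d - 3" using isom_ins(2)[OF f w0(1)] w0(2) outy cAX by simp
  have w0V: "w0 \<in> V" using w0(1) by (simp add: W_def)
  have split: "ins r V w0 = ins r W w0 \<union> (X \<inter> ins r V w0)"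
    using X(1) AV by (auto simp: ins_def W_def)
  have disj: "ins r W w0 \<inter> (X \<inter> ins r V w0) = {}" by (auto simp: ins_def W_def)
  have finI: "finite (ins r W w0)" using fin by (auto simp: ins_def W_def)
  have "card (ins r V w0) = card (ins r W w0 \<union> (X \<inter> ins r V w0))" using split by simp
  also have "\<dots> = card (ins r W w0) + card (X \<inter> ins r V w0)"
    by (rule card_Un_disjoint[OF finI _ disj]) (use fX in simp)
  finally have c1: "card (ins r V w0) = (d - 3) + card (X \<inter> ins r V w0)" using cw by simp
  have c2: "card (X \<inter> ins r V w0) \<le> 3" using card_mono[OF fX, of "X \<inter> ins r V w0"] X(2) by simp
  \<comment> \<open>The in-degree is at least \<open>d\<close> in \<open>V\<close> and
    \<open>d - 3\<close> in \<open>W\<close>, so all three deleted points are in-neighbours.\<close>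
  have c3: "card (X \<inter> ins r V w0) = 3" using c1 c2 din[OF w0V] d3 by linarith
  then have "X \<inter> ins r V w0 = X" using X(2) card_subset_eq[OF fX, of "X \<inter> ins r V w0"] by simp
  then have "w0 = x" using uniq[OF w0V] c1 c3 d3 by auto
  then have fx: "f x = y" using w0 by simp
  have fA: "f ` (A - X) = A - X" using isom_ins(1)[OF f xW] insx outy fx by simp
  have "f ` C = C"
  proof -
    have "C = W - (A - X)" using WAC by blast
    moreover have "f ` (W - (A - X)) = f ` W - f ` (A - X)"
      by (rule inj_on_image_set_diff[OF inj]) (use WAC in auto)
    ultimately show ?thesis using im fA by simp
  qed
  have ef: "e a = - e (f a)" if a: "a \<in> A - X" for a
  proof -
    have fa: "f a \<in> A" using fA a by blast
    have aW: "a \<in> W" using a WAC by blast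
    have CW: "C \<subseteq> W" using WAC by blast
    have img: "f ` {c \<in> C. r a c} = {c \<in> C. r c (f a)}"
    proof (intro equalityI subsetI)
      fix c assume "c \<in> f ` {c \<in> C. r a c}"
      then obtain b where b: "b \<in> C" "r a b" "c = f b" by blast
      then show "c \<in> {c \<in> C. r c (f a)}" using f(2)[OF aW, of b] CW \<open>f ` C = C\<close> by auto
    next
      fix c assume c: "c \<in> {c \<in> C. r c (f a)}"
      then obtain b where b: "b \<in> C" "c = f b" using \<open>f ` C = C\<close> by blast
      then show "c \<in> f ` {c \<in> C. r a c}" using f(2)[OF aW, of b] CW c by auto
    qed
    have "p a = card (f ` {c \<in> C. r a c})"
      unfolding p_def by (rule card_image[symmetric], rule inj_on_subset[OF inj]) (use CW in auto)
    also have "\<dots> = card C - p (f a)" unfolding img by (rule card_co[OF fa])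
    finally show ?thesis using p_bounds[OF fa] unfolding e_def by linarith
  qed
  have "bij_betw f (A - X) (A - X)"
    using fA inj_on_subset[OF inj, of "A - X"] WAC by (auto simp: bij_betw_def)
  then have r: "(\<Sum>a \<in> A - X. e (f a)) = (\<Sum>a \<in> A - X. e a)" by (rule sum.reindex_bij_betw)
  have "(\<Sum>a \<in> A - X. e a) = (\<Sum>a \<in> A - X. - e (f a))" by (rule sum.cong[OF refl ef])
  also have "\<dots> = - (\<Sum>a \<in> A - X. e a)" using r by (simp add: sum_negf)
  finally show ?thesis by simp
qed

lemma less: "b \<in> A \<Longrightarrow> c \<in> A \<Longrightarrow> r b c \<longleftrightarrow> rk r A b < rk r A c"
  by (rule rk_less[OF TA acA])

lemma ub: "b \<in> A \<Longrightarrow> rk r A b < d"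
  using rk_upper[OF TA acA] cA by simp

text \<open>Delete the first, the last and one interior point \<open>k\<close> of \<open>A\<close>.
  By \<open>convex\<close>, a point dominated by both ends is dominated by all of \<open>A\<close>,
  so \<open>excess_sum_zero\<close> applies. Each interior excess thus equals the total over the
  \<open>d - 2\<close> interior points, and the total is multiplied by \<open>d - 2\<close> when
  summed; as \<open>d - 2\<close> is not 1, it vanishes.\<close>

lemma excess_interior:
  assumes d4: "4 \<le> d" and H: "self_dual_cards r V 3" and a: "a \<in> A" "1 \<le> rk r A a" "rk r A a + 2 \<le> d"
  shows "e a = 0"
proof -
  have "0 < card A" "d - 1 < card A" using cA d4 by auto
  then obtain u v where u: "u \<in> A" "rk r A u = 0" and v: "v \<in> A" "rk r A v = d - 1"
    using rk_ex[OF TA acA, of 0] rk_ex[OF TA acA, of "d - 1"] by metis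
  define I where "I = {a \<in> A. 1 \<le> rk r A a \<and> rk r A a + 2 \<le> d}"
  have uv: "u \<noteq> v" using u v d4 by auto
  have cases: "b = u \<or> b = v \<or> b \<in> I" if b: "b \<in> A" for b
  proof -
    consider "rk r A b = 0" | "rk r A b = d - 1" | "b \<in> I" using b ub[OF b] unfolding I_def by force
    then show ?thesis using rk_inj[OF TA acA b] u v by cases auto
  qed
  have nI: "u \<notin> I" "v \<notin> I" using u v d4 by (auto simp: I_def)
  have AI: "A = insert u (insert v I)" using cases u v by (auto simp: I_def)
  have finI: "finite I" using finA by (simp add: I_def)
  have cI: "card I = d - 2" using cA AI nI uv finI by simp
  have S: "(\<Sum>b \<in> I - {k}. e b) = 0" if k: "k \<in> I" for k
  proof -
    have kA: "k \<in> A" "k \<noteq> u" "k \<noteq> v" using k nI by (auto simp: I_def)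
    have "(\<Sum>b \<in> A - {u, k, v}. e b) = 0"
    proof (rule excess_sum_zero[OF _ _ H])
      show "{u, k, v} \<subseteq> A" using u v kA by simp
      show "card {u, k, v} = 3" using kA uv by auto
      fix w assume w: "w \<in> V" "{u, k, v} \<subseteq> ins r V w" "card (ins r V w) = d"
      have ruw: "r u w" "r v w" using w(2) by (auto simp: ins_def)
      have wA: "w \<notin> A"
      proof
        assume "w \<in> A"
        then show False using less[OF v(1)] ruw(2) rk_upper[OF TA acA, of w] cA v(2) by auto
      qed
      have "r b w" if b: "b \<in> A" for b
      proof (cases "b = u \<or> b = v")
        case True then show ?thesis using ruw by blast
      next
        case False
        then have "b \<in> I" using cases b by blast
        then have "r u b" "r b v" using less u v b by (auto simp: I_def)
        then show ?thesis using convex[OF w(1) wA u(1) b v(1)] ruw by blast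
      qed
      then have "A \<subseteq> ins r V w" using AV by (auto simp: ins_def)
      then show "w = x" by (rule unique_in_set[OF w(1) _ w(3)])
    qed
    moreover have "A - {u, k, v} = I - {k}" using AI nI by blast
    ultimately show ?thesis by simp
  qed
  have all: "e k = sum e I" if "k \<in> I" for k
    using S[OF that] sum.remove[OF finI that, of e] by simp
  have "sum e I = (\<Sum>k \<in> I. sum e I)" by (rule sum.cong[OF refl all])
  then have "sum e I = int (d - 2) * sum e I" using cI by simp
  then have "(int (d - 2) - 1) * sum e I = 0" by (simp add: algebra_simps)
  then have "sum e I = 0" using d4 by auto
  moreover have "a \<in> I" using a by (simp add: I_def)
  ultimately show ?thesis using all[of a] by simp
qed

lemma cardC_lower: "d + 1 \<le> card C"
proof -
  have "ins (opp r) V x \<subseteq> C - {x}"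
  proof
    fix w assume "w \<in> ins (opp r) V x"
    then have w: "w \<in> V" "r x w" by (auto simp: ins_def)
    then show "w \<in> C - {x}"
      using Axr[of w] asym[of x w] tour_irrefl[OF T x] x Cdef by auto
  qed
  from card_mono[OF _ this] have "card (ins (opp r) V x) \<le> card C - 1" using finC xC by simp
  moreover have "0 < card C" using finC xC by (auto simp: card_gt_0_iff)
  ultimately show ?thesis using dout[OF x] by linarith
qed

text \<open>Deleting points of ranks 0, 1 and \<open>d - 2\<close> leaves \<open>v\<close> as the
  only remaining point not known to have excess 0.\<close>

lemma excess_last:
  assumes d4: "4 \<le> d" and H: "self_dual_cards r V 3" and v: "v \<in> A" "rk r A v = d - 1"
  shows "e v = 0"
proof -
  have "0 < card A" "1 < card A" "d - 2 < card A" using cA d4 by auto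
  then obtain u a b where u: "u \<in> A" "rk r A u = 0" and a: "a \<in> A" "rk r A a = 1"
    and b: "b \<in> A" "rk r A b = d - 2"
    using rk_ex[OF TA acA, of 0] rk_ex[OF TA acA, of 1] rk_ex[OF TA acA, of "d - 2"] by metis
  have ne: "u \<noteq> a" "u \<noteq> b" "a \<noteq> b" "u \<noteq> v" "a \<noteq> v" "b \<noteq> v" using u a b v d4 by auto
  have ea: "e a = 0" by (rule excess_interior[OF d4 H a(1)]) (use a d4 in auto)
  have pv: "p a \<le> p v" by (rule p_mono[OF a(1) v(1)]) (use less[OF a(1) v(1)] a v d4 in simp)
  have big: "5 \<le> card C" using cardC_lower d4 by linarith
  have below: "r c v" if "c \<in> A" "c \<noteq> v" for c
  proof -
    have "rk r A c \<noteq> d - 1" using rk_inj[OF TA acA that(1) v(1)] that(2) v(2) by auto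
    then show ?thesis using less[OF that(1) v(1)] ub[OF that(1)] v(2) by linarith
  qed
  \<comment> \<open>Otherwise \<open>v\<close> starts a second polar pair, whose set is
    \<open>A\<close> with \<open>v\<close> replaced by \<open>y\<close>. There \<open>a\<close> has
    rank 2, still interior, hence excess 0; but it now dominates one more point, \<open>v\<close>,
    of a complement of the same size.\<close>
  have notd: "card (ins r V v) \<noteq> d"
  proof
    assume dv: "card (ins r V v) = d"
    have vV: "v \<in> V" using v AV by blast
    obtain y' where y': "y' \<in> V" "ins (opp r) V y' = ins r V v" by (rule partner[OF vV dv])
    interpret Q: polar_pair r V d v y' "ins r V v" "V - ins r V v"
      by unfold_locales (use vV y' dv in auto)
    have yA: "y \<notin> A" using yC AC by blast
    have fI: "finite (ins r V v)" by (rule finite_subset[OF ins_subset fin])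
    have sub: "insert y (A - {v}) \<subseteq> ins r V v"
      using below Ayr[OF v(1)] y AV by (auto simp: ins_def)
    have "card (insert y (A - {v})) = d" using yA finA v(1) cA d4 by simp
    then have I: "ins r V v = insert y (A - {v})" using card_subset_eq[OF fI sub] dv by simp
    have ra: "{z \<in> A. r z a} = {u}"
    proof -
      have "u \<in> {z \<in> A. r z a}" using u a less by simp
      moreover have "card {z \<in> A. r z a} = 1" using a(2) by (simp add: rk_def)
      ultimately show ?thesis by (metis card_1_singletonE singletonD)
    qed
    have "{z \<in> ins r V v. r z a} = {y, u}"
    proof -
      have "{z \<in> ins r V v. r z a} = insert y ({z \<in> A. r z a} - {v})"
        unfolding I using Ayr[OF a(1)] by auto
      then show ?thesis unfolding ra using ne by auto
    qed
    moreover have "y \<noteq> u" using yA u by blast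
    ultimately have rk2: "rk r (ins r V v) a = 2" by (simp add: rk_def)
    have aI: "a \<in> ins r V v" unfolding I using a ne by blast
    have "Q.e a = 0" by (rule Q.excess_interior[OF d4 H aI]) (use rk2 d4 in auto)
    moreover have "card (V - ins r V v) = card C"
      using dv cardV fI by (simp add: card_Diff_subset ins_subset)
    moreover have "Q.p a = p a + 1"
    proof -
      have ay: "\<not> r a y" using asym[OF Ayr[OF a(1)] y] a AV by blast
      have av: "r a v" using below a ne by blast
      have "{c \<in> V - ins r V v. r a c} = insert v {c \<in> C. r a c}"
        unfolding I using ay av v AV Cdef yC by auto
      moreover have "v \<notin> {c \<in> C. r a c}" using v AC by blast
      ultimately show ?thesis using finC by (simp add: Q.p_def p_def)
    qed
    ultimately show False using ea by (simp add: e_def Q.e_def)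
  qed
  have "(\<Sum>c \<in> A - {u, a, b}. e c) = 0"
  proof (rule excess_sum_zero[OF _ _ H])
    show "{u, a, b} \<subseteq> A" using u a b by simp
    show "card {u, a, b} = 3" using ne by auto
    fix w assume w: "w \<in> V" "{u, a, b} \<subseteq> ins r V w" "card (ins r V w) = d"
    have rw: "r u w" "r a w" "r b w" using w(2) by (auto simp: ins_def)
    have wv: "w \<noteq> v" using notd w(3) by blast
    have wA: "w \<notin> A"
    proof
      assume wA: "w \<in> A"
      then have "d - 2 < rk r A w" using less[OF b(1) wA] rw(3) b(2) by simp
      then have "rk r A w = rk r A v" using ub[OF wA] v(2) by linarith
      then show False using rk_inj[OF TA acA wA v(1)] wv by blast
    qed
    have low: "r c w" if c: "c \<in> A" "c \<noteq> v" for c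
    proof (cases "c = u \<or> c = b")
      case True then show ?thesis using rw by blast
    next
      case False
      then have "rk r A c \<noteq> 0" "rk r A c \<noteq> d - 2" "rk r A c \<noteq> d - 1"
        using rk_inj[OF TA acA c(1) u(1)] rk_inj[OF TA acA c(1) b(1)] rk_inj[OF TA acA c(1) v(1)] u b v c
        by auto
      then have "r u c" "r c b"
        using less[OF u(1) c(1)] less[OF c(1) b(1)] u(2) b(2) ub[OF c(1)] by linarith+
      then show ?thesis using convex[OF w(1) wA u(1) c(1) b(1)] rw by blast
    qed
    show "w = x"
    proof (cases "r v w")
      case True
      then have "A \<subseteq> ins r V w" using low AV by (auto simp: ins_def)
      then show ?thesis by (rule unique_in_set[OF w(1) _ w(3)])
    next
      case False
      \<comment> \<open>The \<open>p v\<close> points of \<open>C\<close> dominated by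
        \<open>v\<close> precede \<open>w\<close>. Together with \<open>A - {v}\<close> they give
        \<open>w\<close> in-degree above \<open>d\<close>, since \<open>p v\<close> is at least
        \<open>p a\<close>, half of \<open>card C\<close>, and so at least 3.\<close>
      have wC: "w \<in> C" using w(1) wA Cdef by blast
      have "{c \<in> C. r v c} \<subseteq> ins r V w"
      proof
        fix c assume "c \<in> {c \<in> C. r v c}"
        then have c: "c \<in> C" "r v c" by auto
        have "\<not> r w c" using ini[OF v(1) c(1) wC c(2)] False by blast
        moreover have "w \<noteq> c" using c False by blast
        ultimately have "r c w" using flip[of w c] wC c CV by blast
        then show "c \<in> ins r V w" using c CV by (auto simp: ins_def)
      qed
      then have sub: "(A - {v}) \<union> {c \<in> C. r v c} \<subseteq> ins r V w" using low AV by (auto simp: ins_def)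
      have "card ((A - {v}) \<union> {c \<in> C. r v c}) = card (A - {v}) + card {c \<in> C. r v c}"
        by (rule card_Un_disjoint) (use finA finC AC in auto)
      also have "\<dots> = d - 1 + p v" using v cA finA by (simp add: p_def)
      finally have "d - 1 + p v \<le> d"
        using card_mono[OF finite_subset[OF ins_subset fin] sub] w(3) by simp
      then show ?thesis using pv ea big d4 unfolding e_def by linarith
    qed
  qed
  moreover have "(\<Sum>c \<in> A - {u, a, b}. e c) = e v + (\<Sum>c \<in> A - {u, a, b} - {v}. e c)"
    by (rule sum.remove) (use finA v ne in auto)
  moreover have "(\<Sum>c \<in> A - {u, a, b} - {v}. e c) = 0"
  proof (rule sum.neutral, rule ballI)
    fix c assume c: "c \<in> A - {u, a, b} - {v}"
    then have cA: "c \<in> A" "c \<noteq> u" "c \<noteq> v" by auto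
    then have "rk r A c \<noteq> 0" "rk r A c \<noteq> d - 1"
      using rk_inj[OF TA acA cA(1) u(1)] rk_inj[OF TA acA cA(1) v(1)] u v by auto
    then have "1 \<le> rk r A c" "rk r A c + 2 \<le> d" using ub[OF cA(1)] by linarith+
    then show "e c = 0" by (rule excess_interior[OF d4 H cA(1)])
  qed
  ultimately show ?thesis by simp
qed

text \<open>With every excess 0, each point of \<open>A\<close> splits \<open>C\<close> evenly and
  reversing \<open>A\<close> meets the criterion. The first point of \<open>A\<close> is the last
  one for the converse.\<close>

lemma self_dual_large:
  assumes d4: "4 \<le> d" and H: "self_dual_cards r V 3"
  shows "isom r V (opp r) V"
proof -
  interpret D: polar_pair "opp r" V d y x A C by (rule pdual)
  have zero: "e a = 0" if a: "a \<in> A" for a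
  proof -
    consider "rk r A a = 0" | "rk r A a = d - 1" | "1 \<le> rk r A a" "rk r A a + 2 \<le> d"
      using ub[OF a] by linarith
    then show ?thesis
    proof cases
      case 1
      have "{z \<in> A. r a z} = A - {a}"
      proof -
        have "{z \<in> A. r z a} = {}" using 1 finA by (simp add: rk_def)
        then show ?thesis using tour_flip[OF TA a] tour_irrefl[OF TA a] by blast
      qed
      then have "rk (opp r) A a = d - 1" using a finA cA by (simp add: rk_def)
      then have "D.e a = 0" using D.excess_last[OF d4 self_dual_cards_dual[OF H] a] by simp
      then show ?thesis using p_dual[OF a] p_bounds[OF a] unfolding e_def D.e_def by linarith
    next
      case 2 then show ?thesis by (rule excess_last[OF d4 H a])
    next
      case 3 then show ?thesis by (rule excess_interior[OF d4 H a])
    qed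
  qed
  obtain g where g: "bij_betw g A A" "\<And>a b. a \<in> A \<Longrightarrow> b \<in> A \<Longrightarrow> r a b \<longleftrightarrow> r (g b) (g a)"
    by (rule reversal_ex[OF TA acA]) blast
  show ?thesis
  proof (rule self_dualI[OF g])
    fix a assume a: "a \<in> A"
    then have "g a \<in> A" using bij_betwE[OF g(1)] by blast
    then show "p a + p (g a) = card C" using zero[OF a] zero[of "g a"] unfolding e_def by linarith
  qed
qed

text \<open>The tournament is regular of degree 3, which forces the values of \<open>p\<close> along
  \<open>A\<close> to be 1, 2, 3; trimming fails here because \<open>card C\<close> is even.\<close>

lemma self_dual_seven:
  assumes d: "d = 3" "card C = 4" shows "isom r V (opp r) V"
proof -
  have prk: "p a = rk r A a + 1" if a: "a \<in> A" for a
  proof -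
    have aV: "a \<in> V" using a AV by blast
    have ub: "rk r A a < 3" using rk_upper[OF TA acA a] cA d by simp
    have "ins r V a = {z \<in> A. r z a} \<union> {c \<in> C. r c a}" using VAC by (auto simp: ins_def)
    then have "card (ins r V a) \<le> rk r A a + (card C - p a)"
      using card_Un_le[of "{z \<in> A. r z a}" "{c \<in> C. r c a}"] card_co[OF a] by (simp add: rk_def)
    then have 1: "3 \<le> rk r A a + (4 - p a)" using din[OF aV] d by linarith
    have "A - {z \<in> A. r z a} - {a} = {z \<in> A. r a z}"
      using tour_flip[OF TA a] tour_irrefl[OF TA a] tour_asym[OF TA] a by blast
    moreover have "a \<in> A - {z \<in> A. r z a}" using a tour_irrefl[OF TA a] by blast
    moreover have "card (A - {z \<in> A. r z a}) = 3 - rk r A a"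
      using finA cA d by (simp add: card_Diff_subset rk_def)
    ultimately have c: "card {z \<in> A. r a z} = 3 - rk r A a - 1"
      using finA by (metis card_Diff_singleton)
    have "ins (opp r) V a = {z \<in> A. r a z} \<union> {c \<in> C. r a c}" using VAC by (auto simp: ins_def)
    then have "card (ins (opp r) V a) \<le> 3 - rk r A a - 1 + p a"
      using card_Un_le[of "{z \<in> A. r a z}" "{c \<in> C. r a c}"] c by (simp add: p_def)
    then have 2: "3 \<le> 3 - rk r A a - 1 + p a" using dout[OF aV] d by linarith
    show ?thesis using 1 2 ub p_bounds[OF a] d by linarith
  qed
  obtain g where g: "bij_betw g A A" "\<And>a. a \<in> A \<Longrightarrow> rk r A (g a) = card A - 1 - rk r A a"
    "\<And>a b. a \<in> A \<Longrightarrow> b \<in> A \<Longrightarrow> r a b \<longleftrightarrow> r (g b) (g a)"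
    by (rule reversal_ex[OF TA acA]) blast
  show ?thesis
  proof (rule self_dualI[OF g(1,3)])
    fix a assume a: "a \<in> A"
    then have "g a \<in> A" using bij_betwE[OF g(1)] by blast
    then show "p a + p (g a) = card C"
      using prk[OF a] prk[of "g a"] g(2)[OF a] rk_upper[OF TA acA a] cA d by auto
  qed
qed

text \<open>For \<open>d\<close> at most 3, \<open>K = q + 1 - d\<close> points of \<open>C\<close>
  are trimmed, with \<open>q\<close> equal to 3, 2, 1 for at least 9, exactly 8, exactly 7 points.
  The bound \<open>K + 5\<close> on \<open>card C\<close> holds whenever \<open>K\<close> is
  positive. \<open>K = 0\<close> occurs with 8 points and \<open>d = 3\<close> or 7 points and
  \<open>d = 2\<close>, where \<open>card C\<close> is 5, and with 7 points and
  \<open>d = 3\<close>, which is treated separately.\<close>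

lemma self_dual:
  assumes N: "7 \<le> card V" and H: "self_dual_cards r V 3"
    and H2: "card V = 8 \<Longrightarrow> self_dual_cards r V 2" and H1: "card V = 7 \<Longrightarrow> self_dual_cards r V 1"
  shows "isom r V (opp r) V"
proof (cases "4 \<le> d")
  case True
  then show ?thesis using H by (rule self_dual_large)
next
  case d3: False
  have m: "card C = card V - d" "d + 1 \<le> card C" using cardV cardC_lower by auto
  show ?thesis
  proof (cases "card V = 7 \<and> d = 3")
    case True
    then show ?thesis using m by (intro self_dual_seven) auto
  next
    case False
    have ext: "p a = 1 \<or> p a + 1 = card C" if a: "a \<in> A" for a
    proof -
      consider "9 \<le> card V" | "card V = 8" | "card V = 7" using N by linarith
      then show ?thesis
      proof cases
        case 1
        show ?thesis by (rule p_extreme[OF a H, where K = "4 - d"]) (use d3 d1 1 m in auto)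
      next
        case 2
        show ?thesis by (rule p_extreme[OF a H2[OF 2], where K = "3 - d"]) (use d3 d1 2 m in auto)
      next
        case 3
        then have "d = 1 \<or> d = 2" using False d3 d1 by auto
        then show ?thesis
          by (intro p_extreme[OF a H1[OF 3], where K = "2 - d"]) (use 3 m in auto)
      qed
    qed
    show ?thesis by (rule self_dual_extreme[OF ext]) (use N m d3 in auto)
  qed
qed

end

lemma (in loc_trans) self_dual_of_min:
  assumes x: "x \<in> V" "card (ins r V x) = d" and N: "7 \<le> card V" and H: "self_dual_cards r V 3"
    and H2: "card V = 8 \<Longrightarrow> self_dual_cards r V 2" and H1: "card V = 7 \<Longrightarrow> self_dual_cards r V 1"
  shows "isom r V (opp r) V"
proof -
  obtain y where y: "y \<in> V" "ins (opp r) V y = ins r V x" by (rule partner[OF x])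
  interpret polar_pair r V d x y "ins r V x" "V - ins r V x"
    by unfold_locales (use x y in auto)
  show ?thesis by (rule self_dual[OF N H H2 H1])
qed

text \<open>The minimum is taken over in- and out-degrees together; if an out-degree attains it, the
  dual tournament is used.\<close>

lemma loc_trans_self_dual:
  assumes T: "tour r V" "out3 r V" "out3 (opp r) V"
    and deg: "\<And>v. v \<in> V \<Longrightarrow> ins r V v \<noteq> {}" "\<And>v. v \<in> V \<Longrightarrow> ins (opp r) V v \<noteq> {}"
    and N: "7 \<le> card V" and H: "self_dual_cards r V 3"
    and H2: "card V = 8 \<Longrightarrow> self_dual_cards r V 2" and H1: "card V = 7 \<Longrightarrow> self_dual_cards r V 1"
  shows "isom r V (opp r) V"
proof -
  have fin: "finite V" using T(1) by (rule tour_finite)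
  let ?D = "(\<lambda>v. card (ins r V v)) ` V \<union> (\<lambda>v. card (ins (opp r) V v)) ` V"
  define d where "d = Min ?D"
  have finD: "finite ?D" using fin by simp
  have neD: "?D \<noteq> {}" using N by auto
  have dD: "d \<in> ?D" unfolding d_def by (rule Min_in[OF finD neD])
  have le: "d \<le> k" if "k \<in> ?D" for k unfolding d_def by (rule Min_le[OF finD that])
  have fI: "finite (ins q V v)" for q v by (rule finite_subset[OF ins_subset fin])
  have "0 < k" if "k \<in> ?D" for k using that deg fI by (auto simp: card_gt_0_iff)
  then have d1: "1 \<le> d" using dD by fastforce
  interpret loc_trans r V d
    by unfold_locales (use T d1 le in auto)
  interpret D: loc_trans "opp r" V d by (rule dual)
  from dD show ?thesis
  proof
    assume "d \<in> (\<lambda>v. card (ins r V v)) ` V"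
    then obtain x where "x \<in> V" "card (ins r V x) = d" by auto
    then show ?thesis by (rule self_dual_of_min[OF _ _ N H H2 H1])
  next
    assume "d \<in> (\<lambda>v. card (ins (opp r) V v)) ` V"
    then obtain x where "x \<in> V" "card (ins (opp r) V x) = d" by auto
    then have "isom (opp r) V (opp (opp r)) V"
      by (rule D.self_dual_of_min)
         (use N self_dual_cards_dual H H2 H1 in auto)
    then show ?thesis by (simp add: isom_sym)
  qed
qed

section \<open>Hypomorphic tournaments\<close>

lemma cyc3_perm:
  "cyc3 r a b c \<longleftrightarrow> cyc3 r b c a" "cyc3 r a b c \<longleftrightarrow> cyc3 r b a c"
  unfolding cyc3_def by blast+

lemma cyc3_transfer:
  assumes "isom w {a, b, c} w' {a, b, c}" "a \<noteq> b" "b \<noteq> c" "a \<noteq> c" "cyc3 w a b c"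
  shows "cyc3 w' a b c"
proof -
  obtain f where f: "bij_betw f {a, b, c} {a, b, c}"
    "\<And>x y. x \<in> {a, b, c} \<Longrightarrow> y \<in> {a, b, c} \<Longrightarrow> w x y \<longleftrightarrow> w' (f x) (f y)"
    using assms(1) by (rule isomE) blast
  have c: "cyc3 w' (f a) (f b) (f c)"
    using assms(5) f(2)[of a b] f(2)[of b c] f(2)[of c a] f(2)[of b a] f(2)[of c b] f(2)[of a c]
    unfolding cyc3_def by simp
  have "f a \<in> {a, b, c}" "f b \<in> {a, b, c}" "f c \<in> {a, b, c}" using bij_betwE[OF f(1)] by auto
  moreover have "f a \<noteq> f b" "f b \<noteq> f c" "f a \<noteq> f c"
    using bij_betw_imp_inj_on[OF f(1)] assms(2-4) by (auto simp: inj_on_def)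
  ultimately show ?thesis using c unfolding cyc3_def by auto
qed

lemma same3_of_eqc:
  assumes T: "tour r V" "tour r' V"
    and e: "\<And>Y. Y \<subseteq> V \<Longrightarrow> card Y = 3 \<Longrightarrow> eqc r r' (fam V Y {} 3)"
  shows "same3 r r' V"
  unfolding same3_def
proof (intro ballI)
  fix a b c assume abc: "a \<in> V" "b \<in> V" "c \<in> V"
  show "cyc3 r a b c \<longleftrightarrow> cyc3 r' a b c"
  proof (cases "a \<noteq> b \<and> b \<noteq> c \<and> a \<noteq> c")
    case True
    let ?Y = "{a, b, c}"
    have c3: "card ?Y = 3" using True by simp
    have "fam V ?Y {} 3 = {?Y}"
    proof (intro equalityI subsetI)
      fix S assume "S \<in> fam V ?Y {} 3"
      then have S: "?Y \<subseteq> S" "card S = card ?Y" "finite S"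
        using c3 by (auto simp: fam_def intro: card_ge_0_finite)
      then show "S \<in> {?Y}" using card_subset_eq[of S ?Y] by simp
    qed (use abc c3 in \<open>auto simp: fam_def\<close>)
    then have "isom r ?Y r' ?Y" using e[of ?Y] abc c3 by (auto intro: eqc_singleton)
    then show ?thesis using cyc3_transfer[of r a b c r'] cyc3_transfer[of r' a b c r] True isom_sym by blast
  next
    case False
    have "\<not> cyc3 q a b c" if "tour q V" for q
      using False tour_irrefl[OF that] abc unfolding cyc3_def by blast
    then show ?thesis using T by blast
  qed
qed

text \<open>If \<open>x\<close> were between \<open>a\<close> and \<open>b\<close>, then
  \<open>x\<close> would lie on a 3-cycle with both of them, or, whichever way the arc to
  \<open>c\<close> points, with \<open>c\<close> and one of them.\<close>

lemma cycle_forces: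
  assumes T: "tour r N" and m: "a \<in> N" "b \<in> N" "x \<in> N" "c \<in> N" "x \<noteq> a" "x \<noteq> b"
    and cy: "cyc3 r a b c" and n: "\<And>w. w \<in> N \<Longrightarrow> \<not> cyc3 r x a w" "\<And>w. w \<in> N \<Longrightarrow> \<not> cyc3 r x b w"
  shows "r x a \<longleftrightarrow> r x b"
proof -
  have ir: "\<not> r z z" if "z \<in> N" for z using tour_irrefl[OF T that] .
  have ne: "a \<noteq> b" "b \<noteq> c" "a \<noteq> c" using cy ir m unfolding cyc3_def by blast+
  have xc: "x \<noteq> c" using n(1)[OF m(2)] cy unfolding cyc3_def by blast
  have "r b a \<longleftrightarrow> \<not> r a b" "r c a \<longleftrightarrow> \<not> r a c" "r c b \<longleftrightarrow> \<not> r b c" "r a x \<longleftrightarrow> \<not> r x a"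
    "r b x \<longleftrightarrow> \<not> r x b" "r c x \<longleftrightarrow> \<not> r x c"
    using tour_flip[OF T] m ne xc by blast+
  then show ?thesis
    using cy n(1)[OF m(2)] n(1)[OF m(4)] n(2)[OF m(4)] unfolding cyc3_def by auto
qed

lemma connected_subset:
  assumes v: "v \<in> V" and s: "\<And>a b. a \<in> V \<Longrightarrow> b \<in> V \<Longrightarrow> g a b \<Longrightarrow> g b a"
  shows "conn g (cls g V v)"
  unfolding conn_def
proof (intro allI impI)
  let ?N = "cls g V v"
  fix U assume U: "U \<subseteq> ?N" "U \<noteq> {}" "U \<noteq> ?N"
  obtain u where u: "u \<in> U" using U(2) by blast
  then have uN: "u \<in> ?N" using U(1) by blast
  have eq: "cls g V u = ?N" by (rule cls_eq[OF s uN])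
  have uV: "u \<in> V" using cls_subset[OF v] uN by blast
  show "\<exists>u \<in> U. \<exists>w \<in> ?N - U. g u w"
  proof (rule ccontr)
    assume n: "\<not> ?thesis"
    have "w \<in> U" if "w \<in> cls g V u" for w
      using that
    proof (induction rule: cls_induct)
      case (step a b)
      have "b \<in> ?N" using cls_step[OF step(1) uV step(3,4)] eq by simp
      then show ?case using n step by blast
    qed (rule u)
    then show False using eq U by blast
  qed
qed

lemma rvs_blocks:
  assumes T: "tour r V" "tour r' V" and s3: "same3 r r' V"
  shows "blocks r r' V (cls (rvs r r') V ` V)"
proof -
  let ?C = "cls (rvs r r') V"
  have sym: "rvs r r' b a" if "a \<in> V" "b \<in> V" "rvs r r' a b" for a b
    using rvs_sym[OF T that(1,2)] that(3) by simp
  have int: "interval r' V (?C v)" if "v \<in> V" for v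
    using rvs_cls_interval[OF T(2,1) _ that] s3 same3_sym[of r' r V] rvs_commute[of r' r] by simp
  have sub: "?C v \<subseteq> V" if "v \<in> V" for v by (rule cls_subset[OF that])
  show ?thesis
    unfolding blocks_def
  proof (intro conjI ballI impI)
    show "\<Union> (?C ` V) = V" by (rule cls_Union)
    fix B D assume BD: "B \<in> ?C ` V" "D \<in> ?C ` V" "B \<noteq> D"
    obtain u v where uv: "u \<in> V" "B = ?C u" "v \<in> V" "D = ?C v" using BD by blast
    have "?C u \<noteq> ?C v" using BD(3) uv by simp
    from cls_disjoint[OF sym this] show no: "B \<inter> D = {}" using uv by simp
    fix x x' y y' assume m: "x \<in> B" "x' \<in> B" "y \<in> D" "y' \<in> D"
    have V: "x \<in> V" "x' \<in> V" "y \<in> V" "y' \<in> V" using m uv sub by blast+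
    have xy: "x \<noteq> y" "y \<notin> B" "x' \<notin> D" using m no by blast+
    have "\<not> rvs r r' x y" using cls_step[OF _ uv(1) V(3), of x] m(1) xy(2) uv(2) by blast
    then have "r x y \<longleftrightarrow> r' x y" using xy(1) by (simp add: rvs_def)
    also have "\<dots> \<longleftrightarrow> r' x' y"
      using intervalD(2)[OF int[OF uv(1)] V(3)] xy(2) m uv by blast
    also have "\<dots> \<longleftrightarrow> r' x' y'"
      using intervalD(1)[OF int[OF uv(3)] V(2)] xy(3) m uv by blast
    finally show "r x y \<longleftrightarrow> r' x' y'" .
  qed
qed

lemma fam_whole:
  assumes "finite B" "Z \<subseteq> B" shows "fam B {} Z (card (B - Z)) = {B - Z}"
proof (intro equalityI subsetI)
  fix S assume "S \<in> fam B {} Z (card (B - Z))"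
  then have "S \<subseteq> B - Z" "card S = card (B - Z)" by (auto simp: fam_def)
  then show "S \<in> {B - Z}" using card_subset_eq[of "B - Z" S] assms(1) by simp
qed (auto simp: fam_def)

lemma acyc_same3:
  assumes "same3 r r' V" "acyc r V" shows "acyc r' V"
  unfolding acyc_def
proof (intro ballI impI notI)
  fix a b c assume m: "a \<in> V" "b \<in> V" "c \<in> V" and cy: "r' a b" "r' b c" "r' c a"
  then have "cyc3 r a b c" using same3D[OF assms(1) m] by (simp add: cyc3_def)
  then show False using assms(2) m unfolding cyc3_def acyc_def by blast
qed

text \<open>Some interval is reversed against the rest of \<open>N\<close>, so \<open>r\<close> is locally transitive on \<open>N\<close> and
  \<open>r'\<close> is a copy of its dual.\<close>

lemma isom_of_disconnected_agreement:
  assumes T: "tour r N" "tour r' N" and s3: "same3 r r' N" and st: "strong r N"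
    and nc: "\<not> conn (agr r r') N" and N: "7 \<le> card N"
    and e: "\<And>Y k. Y \<subseteq> N \<Longrightarrow> card Y \<le> 3 \<Longrightarrow> k \<le> 5 \<Longrightarrow> eqc r r' (fam N Y {} k)"
    and cards: "\<And>X. X \<subseteq> N \<Longrightarrow> card X = 3 \<or> (card X = 2 \<and> card N = 8) \<or> (card X = 1 \<and> card N = 7)
      \<Longrightarrow> isom r (N - X) r' (N - X)"
    and J: "interval r N J" "J \<noteq> {}" "J \<noteq> N" "\<And>x. J \<noteq> {x}"
  shows "isom r N r' N"
proof -
  let ?C = "cls (agr r r') N"
  have fin: "finite N" using T(1) by (rule tour_finite)
  have sym: "agr r r' b a" if "a \<in> N" "b \<in> N" "agr r r' a b" for a b
    using agr_sym[OF T that(1,2)] that(3) by simp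
  have CN: "?C v \<noteq> N" if "v \<in> N" for v
  proof
    assume "?C v = N"
    from cls_conn[OF that this sym] show False using nc by simp
  qed
  have sub: "?C v \<subseteq> N" if "v \<in> N" for v by (rule cls_subset[OF that])
  have int: "interval r N (?C v)" "interval r' N (?C v)" if "v \<in> N" for v
    using agr_cls_interval[OF T s3 that] agr_cls_interval[OF T(2,1) _ that] s3
      same3_sym[of r' r N] agr_commute[of r' r] by simp_all
  have out: "r' x z \<longleftrightarrow> r z x" "r' z x \<longleftrightarrow> r x z"
    if "v \<in> N" "z \<in> ?C v" "x \<in> N" "x \<notin> ?C v" for v z x
  proof -
    have zN: "z \<in> N" "z \<noteq> x" using that sub by blast+
    have "\<not> agr r r' z x" using cls_step[OF that(2,1,3)] that(4) by blast
    then have "r z x \<longleftrightarrow> \<not> r' z x" using zN by (simp add: agr_def)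
    moreover have "\<not> r z x \<longleftrightarrow> r x z" "\<not> r' z x \<longleftrightarrow> r' x z"
      using tour_flip[OF T(1) zN(1) that(3) zN(2)] tour_flip[OF T(2) zN(1) that(3) zN(2)] .
    ultimately show "r' x z \<longleftrightarrow> r z x" "r' z x \<longleftrightarrow> r x z" by blast+
  qed
  have RC: "reversed_interval r r' N (?C v)" if v: "v \<in> N" and w: "w \<in> ?C v" "w \<noteq> v" for v w
  proof unfold_locales
    show "\<exists>a \<in> ?C v. \<exists>b \<in> ?C v. a \<noteq> b" using w cls_self[of v] by blast
    show "r' x a" if "a \<in> ?C v" "x \<in> N" "x \<notin> ?C v" "r a x" for a x using out[OF v that(1-3)] that(4) by simp
    show "r' a x" if "a \<in> ?C v" "x \<in> N" "x \<notin> ?C v" "r x a" for a x using out[OF v that(1-3)] that(4) by simp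
  qed (use T s3 int[OF v] CN[OF v] e in auto)
  have acC: "acyc r (?C v)" if v: "v \<in> N" for v
    unfolding acyc_def
  proof (intro ballI impI notI)
    fix a b c assume m: "a \<in> ?C v" "b \<in> ?C v" "c \<in> ?C v" and cy: "r a b" "r b c" "r c a"
    have "a \<noteq> b" using cy(1) tour_irrefl[OF T(1)] m sub[OF v] by blast
    then obtain w where "w \<in> ?C v" "w \<noteq> v" using m by blast
    from reversed_interval.no_cycle_inside[OF RC[OF v this] m cy] show False .
  qed
  have "\<exists>J. reversed_interval r r' N J"
  proof (cases "\<exists>v \<in> N. ?C v \<noteq> {v}")
    case True
    then obtain v where v: "v \<in> N" "?C v \<noteq> {v}" by blast
    then obtain w where "w \<in> ?C v" "w \<noteq> v" using cls_self[of v "agr r r'" N] by blast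
    then show ?thesis using RC[OF v(1)] by blast
  next
    \<comment> \<open>No two points agree, so \<open>r'\<close> is the converse of \<open>r\<close>
      on \<open>N\<close> and every interval is reversed, in particular the given
      \<open>J\<close>.\<close>
    case False
    then have single: "?C v = {v}" if "v \<in> N" for v using that by blast
    have opp: "r' x z \<longleftrightarrow> r z x" if "x \<in> N" "z \<in> N" "x \<noteq> z" for x z
      using out(1)[of z z x] single[of z] that by simp
    have JN: "J \<subseteq> N" using J(1) by (simp add: interval_def)
    have J': "interval r' N J"
    proof (rule intervalI[OF T(2) JN])
      fix x a b assume x: "x \<in> N" "x \<notin> J" and ab: "a \<in> J" "b \<in> J" and "r' x a"
      then have "r a x" using opp[of x a] JN by blast
      then have "r b x" using intervalD(2)[OF J(1) x ab] by simp
      then show "r' x b" using opp[of x b] JN x ab by blast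
    qed
    have "reversed_interval r r' N J"
    proof unfold_locales
      obtain a where a: "a \<in> J" using J(2) by blast
      then obtain b where "b \<in> J" "b \<noteq> a" using J(4)[of a] by blast
      then show "\<exists>a \<in> J. \<exists>b \<in> J. a \<noteq> b" using a by blast
      show "r' x a" if "a \<in> J" "x \<in> N" "x \<notin> J" "r a x" for a x using opp[of x a] that JN by blast
      show "r' a x" if "a \<in> J" "x \<in> N" "x \<notin> J" "r x a" for a x using opp[of a x] that JN by blast
    qed (use T s3 J J' e in auto)
    then show ?thesis by blast
  qed
  then obtain J' where "reversed_interval r r' N J'" ..
  then interpret R: reversed_interval r r' N J' .
  have Tinv: "tour (opp r) N" using T(1) by simp
  have bl: "blocks r' (opp r) N (?C ` N)"
    unfolding blocks_def
  proof (intro conjI ballI impI)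
    show "\<Union> (?C ` N) = N" by (rule cls_Union)
    fix B D assume BD: "B \<in> ?C ` N" "D \<in> ?C ` N" "B \<noteq> D"
    obtain u v where uv: "u \<in> N" "B = ?C u" "v \<in> N" "D = ?C v" using BD by blast
    have "?C u \<noteq> ?C v" using BD(3) uv by simp
    from cls_disjoint[OF sym this] show no: "B \<inter> D = {}" using uv by simp
    fix x x' y y' assume m: "x \<in> B" "x' \<in> B" "y \<in> D" "y' \<in> D"
    have V: "x \<in> N" "x' \<in> N" "y \<in> N" "y' \<in> N" using m uv sub by blast+
    have no': "y \<notin> B" "x' \<notin> D" using m no by blast+
    have "r' x y \<longleftrightarrow> r y x" using out(2)[OF uv(1) _ V(3)] m uv no' by blast
    also have "\<dots> \<longleftrightarrow> r y x'" using intervalD(1)[OF int(1)[OF uv(1)] V(3)] m uv no' by blast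
    also have "\<dots> \<longleftrightarrow> r y' x'" using intervalD(2)[OF int(1)[OF uv(3)] V(2)] m uv no' by blast
    finally show "r' x y \<longleftrightarrow> (opp r) x' y'" by simp
  qed
  \<comment> \<open>Between agreement classes \<open>r'\<close> is the converse of \<open>r\<close>
    already; inside a class both are chains, and chains of equal size are isomorphic.\<close>
  have rev: "isom r' S (opp r) S" if S: "S \<subseteq> N" for S
  proof (rule blocks_glue[OF bl S S])
    fix B assume "B \<in> ?C ` N"
    then obtain v where v: "v \<in> N" "B = ?C v" by blast
    have ac: "acyc r B" using acC[OF v(1)] v(2) by simp
    have BN: "B \<subseteq> N" using sub[OF v(1)] v(2) by simp
    have ac': "acyc r' B" by (rule acyc_same3[OF same3_subset[OF s3 BN] ac])
    show "isom r' (S \<inter> B) (opp r) (S \<inter> B)"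
    proof (rule isom_of_acyc)
      have SB: "S \<inter> B \<subseteq> N" "S \<inter> B \<subseteq> B" using S by auto
      show "tour r' (S \<inter> B)" by (rule tour_subset[OF T(2) SB(1)])
      show "tour (opp r) (S \<inter> B)" by (rule tour_subset[OF Tinv SB(1)])
      show "acyc r' (S \<inter> B)" by (rule acyc_subset[OF ac' SB(2)])
      show "acyc (opp r) (S \<inter> B)" by (rule acyc_subset[OF acyc_dual[OF ac] SB(2)])
    qed simp
  qed
  have sd: "self_dual_cards r N q"
    if "q = 3 \<or> (q = 2 \<and> card N = 8) \<or> (q = 1 \<and> card N = 7)" for q
    unfolding self_dual_cards_def
  proof (intro allI impI)
    fix X assume X: "X \<subseteq> N" "card X = q"
    show "isom r (N - X) (opp r) (N - X)"
      by (rule isom_trans[OF cards[OF X(1)] rev]) (use X that in auto)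
  qed
  have "isom r N (opp r) N"
  proof (rule loc_trans_self_dual[OF T(1) R.no_sink_of_cycle R.no_source_of_cycle _ _ N])
    fix v assume v: "v \<in> N"
    have "N \<noteq> {v}" using N by auto
    then have ne: "N - {v} \<noteq> {}" "{v} \<noteq> N" using v by blast+
    have "\<exists>u \<in> {v}. \<exists>w \<in> N - {v}. r w u" by (rule strongD[OF st]) (use v ne in auto)
    then show "ins r N v \<noteq> {}" by (auto simp: ins_def)
    have "\<exists>u \<in> N - {v}. \<exists>w \<in> N - (N - {v}). r w u"
      by (rule strongD[OF st]) (use v ne in auto)
    then show "ins (opp r) N v \<noteq> {}" by (auto simp: ins_def)
  qed (use sd in auto)
  then show ?thesis using isom_trans[OF _ isom_sym[OF rev[OF subset_refl]]] by blast
qed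


text \<open>\<open>prime\<close> is the reconstruction hypothesis, required only for indecomposable
  sets missing at most two points.\<close>

lemma isom_of_hypomorphic:
  assumes T: "tour r V" "tour r' V" and V: "9 \<le> card V"
    and hyp: "\<And>X. X \<subseteq> V \<Longrightarrow> card X = 3 \<Longrightarrow> isom r (V - X) r' (V - X)"
    and prime: "\<And>N. N \<subseteq> V \<Longrightarrow> card V \<le> card N + 2 \<Longrightarrow>
      (\<And>J. interval r N J \<Longrightarrow> J = {} \<or> J = N \<or> (\<exists>x. J = {x})) \<Longrightarrow>
      (\<And>X. X \<subseteq> N \<Longrightarrow> card X = 3 \<Longrightarrow> isom r (N - X) r' (N - X)) \<Longrightarrow> isom r N r' N"
  shows "isom r V r' V"
proof -
  have fin: "finite V" using T(1) by (rule tour_finite)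
  have e: "eqc r r' (fam V Y {} k)" if "Y \<subseteq> V" "card Y \<le> 3" "k \<le> card V - 3" for Y k
    by (rule kelly[OF fin hyp]) (use that V in auto)
  have s3: "same3 r r' V"
    by (rule same3_of_eqc[OF T]) (rule e, use V in auto)
  let ?P = "cls (rvs r r') V ` V"
  have bl: "blocks r r' V ?P" by (rule rvs_blocks[OF T s3])
  show ?thesis
  proof (rule blocks_isom[OF bl])
    fix N assume NP: "N \<in> ?P"
    then obtain v where v: "v \<in> V" and Nv: "N = cls (rvs r r') V v" by blast
    have sym: "rvs r r' b a" if "a \<in> V" "b \<in> V" "rvs r r' a b" for a b
      using rvs_sym[OF T that(1,2)] that(3) by simp
    have NV: "N \<subseteq> V" unfolding Nv by (rule cls_subset[OF v])
    have finN: "finite N" using NV fin finite_subset by blast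
    have TN: "tour r N" "tour r' N" and s3N: "same3 r r' N"
      using tour_subset[OF T(1) NV] tour_subset[OF T(2) NV] same3_subset[OF s3 NV] .
    have s3': "same3 r' r V" using s3 same3_sym[of r r' V] by simp
    have iN: "interval r V N" "interval r' V N"
      using rvs_cls_interval[OF T s3 v] rvs_cls_interval[OF T(2,1) s3' v] rvs_commute[of r' r]
      unfolding Nv by simp_all
    have eN: "eqc r r' (fam N Y {} k)" if "Y \<subseteq> N" "card Y \<le> 3" "k \<le> card V - 3" for Y k
      by (rule blocks_eqc[OF fin bl e NP that])
    \<comment> \<open>Counts of sets avoiding \<open>X\<close> follow by inclusion-exclusion from
      those through its at most three points; \<open>N - X\<close> is the only such set of its
      size.\<close>
    have cards: "isom r (N - X) r' (N - X)"
      if X: "X \<subseteq> N" "card X \<le> 3" "card (N - X) \<le> card V - 3" for X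
    proof -
      have fX: "finite X" using X(1) finN finite_subset by blast
      have "eqc r r' (fam N {} X (card (N - X)))"
      proof (rule eqc_avoid[OF finN])
        fix Y assume "{} \<subseteq> Y" "Y \<subseteq> {} \<union> X"
        then have Y: "Y \<subseteq> X" by simp
        then have "card Y \<le> card X" using fX by (intro card_mono) auto
        then show "eqc r r' (fam N Y {} (card (N - X)))" using Y X by (intro eN) auto
      qed (use X fX in auto)
      then show ?thesis unfolding fam_whole[OF finN X(1)] by (rule eqc_singleton)
    qed
    show "isom r N r' N"
    proof (rule ccontr)
      assume n: "\<not> isom r N r' N"
      have big: "card V \<le> card N + 2"
      proof (rule ccontr)
        assume "\<not> ?thesis"
        then have "isom r (N - {}) r' (N - {})" by (intro cards) auto
        then show False using n by simp
      qed
      have cNV: "card N \<le> card V" using card_mono[OF fin NV] .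
      have cX: "card (N - X) = card N - card X" if "X \<subseteq> N" for X
        using that finN finite_subset[OF that finN] by (simp add: card_Diff_subset)
      have "\<not> acyc r N"
        using n isom_of_acyc[OF TN(1) _ TN(2)] acyc_same3[OF s3N] by blast
      then obtain a b c where abc: "a \<in> N" "b \<in> N" "c \<in> N" "r a b" "r b c" "r c a"
        unfolding acyc_def by blast
      txt \<open>Points lying on a common 3-cycle generate an interval all of whose outer arcs agree; as \<open>N\<close>
        is a class of the difference graph, this interval is \<open>N\<close>.\<close>
      define g where "g x y \<longleftrightarrow> (\<exists>w \<in> N. cyc3 r x y w)" for x y
      have gs: "g y x" if "g x y" for x y
        using that unfolding g_def cyc3_perm(2)[of r x y] .
      have g': "g x y \<longleftrightarrow> (\<exists>w \<in> N. cyc3 r' x y w)" if "x \<in> N" "y \<in> N" for x y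
        using same3D[OF s3N that] unfolding g_def by blast
      let ?D = "cls g N a"
      have iD: "interval r N ?D"
      proof (rule cls_interval[OF TN(1) abc(1)])
        fix p q x assume m: "p \<in> N" "q \<in> N" "x \<in> N" "x \<noteq> p" "x \<noteq> q" and h: "g p q" "\<not> g x p" "\<not> g x q"
        obtain w where "w \<in> N" "cyc3 r p q w" using h(1) by (auto simp: g_def)
        then show "r x p \<longleftrightarrow> r x q"
          by (intro cycle_forces[OF TN(1) m(1,2,3) _ m(4,5)]) (use h in \<open>auto simp: g_def\<close>)
      qed (rule gs)
      have iD': "interval r' N ?D"
      proof (rule cls_interval[OF TN(2) abc(1)])
        fix p q x assume m: "p \<in> N" "q \<in> N" "x \<in> N" "x \<noteq> p" "x \<noteq> q" and h: "g p q" "\<not> g x p" "\<not> g x q"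
        obtain w where "w \<in> N" "cyc3 r' p q w" using h(1) g'[OF m(1,2)] by blast
        then show "r' x p \<longleftrightarrow> r' x q"
          by (intro cycle_forces[OF TN(2) m(1,2,3) _ m(4,5)])
             (use h(2,3) g'[OF m(3,1)] g'[OF m(3,2)] in auto)
      qed (rule gs)
      have DN: "?D \<subseteq> N" by (rule cls_subset[OF abc(1)])
      have abcD: "a \<in> ?D" "b \<in> ?D" "c \<in> ?D"
      proof -
        have "g a b" "g a c" using abc unfolding g_def cyc3_def by blast+
        then show "a \<in> ?D" "b \<in> ?D" "c \<in> ?D"
          using cls_self[of a g N] cls_step[OF cls_self abc(1)] abc by auto
      qed
      have k4: "eqc r r' (fam V Y {} 4)" if "Y \<subseteq> V" "card Y \<le> 3" for Y
        using e[OF that, of 4] V by simp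
      have ag: "r z x \<longleftrightarrow> r' z x" if "z \<in> ?D" "x \<in> V" "x \<notin> ?D" for z x
        by (rule interval_3cycle_agrees[OF T interval_trans[OF iN(1) iD] interval_trans[OF iN(2) iD']
              abcD abc(4-6) that(2,3,1) k4])
      have aV: "a \<in> V" using abc NV by blast
      have "a \<in> cls (rvs r r') V v" using abc(1) unfolding Nv .
      from cls_eq[OF sym this] have clsa: "cls (rvs r r') V a = N" unfolding Nv .
      have "w \<in> ?D" if "w \<in> cls (rvs r r') V a" for w
        using that
      proof (induction rule: cls_induct)
        case (step p q)
        then show ?case using ag[of p q] by (auto simp: rvs_def)
      qed (rule abcD(1))
      then have DeqN: "?D = N" using clsa DN by blast
      have cg: "conn g N" by (rule cls_conn[OF abc(1) DeqN gs])
      \<comment> \<open>Connectedness gives a 3-cycle through both sides of the cut, and such a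
        cycle enters \<open>U\<close>.\<close>
      have st: "strong r N"
        unfolding strong_def
      proof (intro allI impI)
        fix U assume U: "U \<subseteq> N" "U \<noteq> {}" "U \<noteq> N"
        then obtain u w where uw: "u \<in> U" "w \<in> N - U" "g u w" using connD[OF cg] by blast
        then obtain z where z: "z \<in> N" "cyc3 r u w z" by (auto simp: g_def)
        then show "\<exists>u \<in> U. \<exists>w \<in> N - U. r w u"
          using uw unfolding cyc3_def by (cases "z \<in> U") blast+
      qed
      have cr: "conn (rvs r r') N" unfolding Nv by (rule connected_subset[OF v sym])
      have N7: "7 \<le> card N" using big V by linarith
      have nc: "\<not> conn (agr r r') N"
        using not_both_connected[OF TN s3N st] N7 cr by auto
      have cards3: "isom r (N - X) r' (N - X)" if "X \<subseteq> N" "card X = 3" for X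
        by (rule cards[OF that(1)]) (use cX[OF that(1)] that(2) cNV in auto)
      obtain J where J: "interval r N J" "J \<noteq> {}" "J \<noteq> N" "\<And>x. J \<noteq> {x}"
        using prime[OF NV big _ cards3] n by blast
      have "isom r N r' N"
      proof (rule isom_of_disconnected_agreement[OF TN s3N st nc N7 _ _ J])
        show "eqc r r' (fam N Y {} k)" if "Y \<subseteq> N" "card Y \<le> 3" "k \<le> 5" for Y k
          by (rule eN) (use that V in auto)
        \<comment> \<open>Deleting 2 of 8 or 1 of 7 points leaves 6, within the counting range
          because \<open>card V\<close> is at least 9.\<close>
        show "isom r (N - X) r' (N - X)"
          if "X \<subseteq> N" "card X = 3 \<or> (card X = 2 \<and> card N = 8) \<or> (card X = 1 \<and> card N = 7)" for X
          by (rule cards[OF that(1)]) (use cX[OF that(1)] that(2) cNV V in auto)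
      qed
      then show False using n by simp
    qed
  qed
qed

section \<open>Transfer to digraphs\<close>

definition arc_rel :: "'a pair_pre_digraph \<Rightarrow> 'a \<Rightarrow> 'a \<Rightarrow> bool" where
  "arc_rel T x y \<longleftrightarrow> (x, y) \<in> parcs T"

lemma tour_arc:
  assumes "tournament T" shows "tour (arc_rel T) (pverts T)"
proof -
  interpret tournament T by fact
  show ?thesis
    unfolding tour_def arc_rel_def
  proof (intro conjI ballI impI)
    show "(x, x) \<notin> parcs T" for x using pair_no_loops[of "(x, x)"] by auto
    show "(x, y) \<in> parcs T \<longleftrightarrow> (y, x) \<notin> parcs T"
      if "x \<in> pverts T" "y \<in> pverts T" "x \<noteq> y" for x y
      by (rule exactly_one_arc[OF that])
  qed (rule pair_finite_verts)
qed

lemma tournament_wf: "tournament T \<Longrightarrow> pair_wf_digraph T"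
  by (simp add: tournament_def pair_digraph_def pair_fin_digraph_def)

lemma digraph_iso_arc:
  assumes "tournament T" "tournament T'"
  shows "digraph_iso (with_proj T) (with_proj T') \<longleftrightarrow> isom (arc_rel T) (pverts T) (arc_rel T') (pverts T')"
  unfolding digraph_iso_with_proj_iff[OF assms[THEN tournament_wf]] isom_def arc_rel_def ..

lemma digraph_iso_induced:
  fixes T :: "'a pair_pre_digraph" and T' :: "'b pair_pre_digraph"
  shows "digraph_iso (with_proj T \<restriction> W) (with_proj T' \<restriction> W') \<longleftrightarrow> isom (arc_rel T) W (arc_rel T') W'"
proof -
  \<comment> \<open>Induced subdigraphs are rewritten as pair digraphs to fit the isomorphism
    criterion. The same construction appears twice since a local definition has one fixed vertex
    type.\<close>
  define R where "R G U = \<lparr>pverts = U, parcs = {e \<in> parcs G. fst e \<in> U \<and> snd e \<in> U}\<rparr>"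
    for G :: "'a pair_pre_digraph" and U
  define R' where "R' G U = \<lparr>pverts = U, parcs = {e \<in> parcs G. fst e \<in> U \<and> snd e \<in> U}\<rparr>"
    for G :: "'b pair_pre_digraph" and U
  have eq: "with_proj T \<restriction> W = with_proj (R T W)" "with_proj T' \<restriction> W' = with_proj (R' T' W')"
    by (simp_all add: induce_subgraph_def with_proj_def R_def R'_def)
  have wf: "pair_wf_digraph (R T W)" "pair_wf_digraph (R' T' W')"
    by (unfold_locales; simp add: R_def R'_def)+
  show ?thesis
    unfolding eq digraph_iso_with_proj_iff[OF wf] isom_def
    by (intro ex_cong1 conj_cong ball_cong) (auto simp: R_def R'_def arc_rel_def dest: bij_betwE)
qed

lemma minus3_hypomorphic_iff:
  "minus3_hypomorphic T T' \<longleftrightarrow> pverts T = pverts T' \<and>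
     (\<forall>X. X \<subseteq> pverts T \<and> card X = 3 \<longrightarrow> isom (arc_rel T) (pverts T - X) (arc_rel T') (pverts T - X))"
  unfolding minus3_hypomorphic_def digraph_iso_induced ..

text \<open>The hypothesis of the theorem speaks of tournaments on natural numbers; this moves a
  subtournament there along an injection.\<close>

definition image_digraph :: "'a arcs \<Rightarrow> 'a set \<Rightarrow> ('a \<Rightarrow> 'b) \<Rightarrow> 'b pair_pre_digraph" where
  "image_digraph r N f = \<lparr>pverts = f ` N, parcs = {(f x, f y) |x y. x \<in> N \<and> y \<in> N \<and> r x y}\<rparr>"

lemma arc_image:
  assumes "inj_on f N" "x \<in> N" "y \<in> N"
  shows "arc_rel (image_digraph r N f) (f x) (f y) \<longleftrightarrow> r x y"
  using assms unfolding arc_rel_def image_digraph_def by (auto dest: inj_onD)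

lemma isom_image:
  assumes "inj_on f N" "W \<subseteq> N"
  shows "isom r W (arc_rel (image_digraph r N f)) (f ` W)"
proof (rule isomI[of f])
  show "bij_betw f W (f ` W)" using inj_on_subset[OF assms] by (rule inj_on_imp_bij_betw)
  fix x y assume "x \<in> W" "y \<in> W"
  then show "r x y \<longleftrightarrow> arc_rel (image_digraph r N f) (f x) (f y)"
    using arc_image[OF assms(1), of x y r] assms(2) by blast
qed

lemma tournament_image:
  assumes T: "tour r N" and f: "inj_on f N"
  shows "tournament (image_digraph r N f)"
proof -
  have fin: "finite N" using T by (rule tour_finite)
  have "parcs (image_digraph r N f) \<subseteq> f ` N \<times> f ` N" by (auto simp: image_digraph_def)
  then have finA: "finite (parcs (image_digraph r N f))" using fin finite_subset by blast
  have loop: "u \<noteq> v" if arc: "(u, v) \<in> parcs (image_digraph r N f)" for u v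
  proof
    assume uv: "u = v"
    obtain x y where xy: "u = f x" "v = f y" "x \<in> N" "y \<in> N" "r x y"
      using arc by (auto simp: image_digraph_def)
    then have "x = y" using f uv by (auto dest: inj_onD)
    then show False using xy tour_irrefl[OF T] by blast
  qed
  show ?thesis
  proof unfold_locales
    fix u v assume "u \<in> pverts (image_digraph r N f)" "v \<in> pverts (image_digraph r N f)" "u \<noteq> v"
    then obtain x y where xy: "x \<in> N" "y \<in> N" "u = f x" "v = f y" "x \<noteq> y"
      by (auto simp: image_digraph_def)
    show "(u, v) \<in> parcs (image_digraph r N f) \<longleftrightarrow> (v, u) \<notin> parcs (image_digraph r N f)"
      using arc_image[OF f xy(1,2), of r] arc_image[OF f xy(2,1), of r] tour_flip[OF T xy(2,1)] xy(3,4,5)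
      unfolding arc_rel_def by blast
  next
    fix e assume "e \<in> parcs (image_digraph r N f)"
    then show "fst e \<noteq> snd e" using loop[of "fst e" "snd e"] by simp
  qed (use fin finA in \<open>auto simp: image_digraph_def\<close>)
qed

lemma indecomposable_image:
  assumes T: "tour r N" and f: "inj_on f N"
    and prime: "\<And>J. interval r N J \<Longrightarrow> J = {} \<or> J = N \<or> (\<exists>x. J = {x})"
  shows "indecomposable (image_digraph r N f)"
  unfolding indecomposable_def
proof (intro allI impI)
  let ?G = "image_digraph r N f"
  fix I assume I: "tournament_interval ?G I"
  have V: "pverts ?G = f ` N" by (simp add: image_digraph_def)
  define J where "J = {x \<in> N. f x \<in> I}"
  have IJ: "I = f ` J" using I V by (auto simp: tournament_interval_def J_def)
  have JN: "J \<subseteq> N" by (auto simp: J_def)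
  have "interval r N J"
  proof (rule intervalI[OF T JN])
    fix x a b assume x: "x \<in> N" "x \<notin> J" and ab: "a \<in> J" "b \<in> J" and xa: "r x a"
    have abN: "a \<in> N" "b \<in> N" using ab JN by auto
    have "f x \<in> pverts ?G - I" using x V by (auto simp: J_def)
    then consider "\<forall>y \<in> I. (f x, y) \<in> parcs ?G" | "\<forall>y \<in> I. (y, f x) \<in> parcs ?G"
      using I unfolding tournament_interval_def by blast
    then show "r x b"
    proof cases
      case 1
      then have "arc_rel ?G (f x) (f b)" using ab by (simp add: arc_rel_def J_def)
      then show ?thesis using arc_image[OF f x(1) abN(2)] by simp
    next
      case 2
      then have "arc_rel ?G (f a) (f x)" using ab by (simp add: arc_rel_def J_def)
      then have "r a x" using arc_image[OF f abN(1) x(1)] by simp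
      then show ?thesis using xa tour_asym[OF T x(1) abN(1)] by blast
    qed
  qed
  from prime[OF this] show "trivial_interval ?G I"
    unfolding trivial_interval_def V IJ using JN by auto
qed

theorem corollary8:
  fixes n0 :: nat
  assumes "n0 \<ge> 7"
    and "\<forall>T :: nat pair_pre_digraph.
      tournament T \<and> indecomposable T \<and> card (pverts T) \<ge> n0 \<longrightarrow> minus3_reconstructible T"
  shows "\<forall>T :: 'a pair_pre_digraph.
      tournament T \<and> card (pverts T) \<ge> n0 + 2 \<longrightarrow> minus3_reconstructible T"
proof (intro allI impI, elim conjE)
  fix T :: "'a pair_pre_digraph"
  assume T: "tournament T" and n: "card (pverts T) \<ge> n0 + 2"
  show "minus3_reconstructible T"
    unfolding minus3_reconstructible_def
  proof (intro allI impI, elim conjE)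
    fix T' assume T': "tournament T'" and h: "minus3_hypomorphic T T'"
    have V: "pverts T' = pverts T" and hyp: "\<And>X. X \<subseteq> pverts T \<Longrightarrow> card X = 3 \<Longrightarrow>
        isom (arc_rel T) (pverts T - X) (arc_rel T') (pverts T - X)"
      using h unfolding minus3_hypomorphic_iff by auto
    note t = tour_arc[OF T] and t' = tour_arc[OF T', unfolded V]
    have "isom (arc_rel T) (pverts T) (arc_rel T') (pverts T)"
    proof (rule isom_of_hypomorphic[OF t t' _ hyp])
      show "9 \<le> card (pverts T)" using n assms(1) by simp
      fix N assume N: "N \<subseteq> pverts T" "card (pverts T) \<le> card N + 2"
        and prime: "\<And>J. interval (arc_rel T) N J \<Longrightarrow> J = {} \<or> J = N \<or> (\<exists>x. J = {x})"
        and sub: "\<And>X. X \<subseteq> N \<Longrightarrow> card X = 3 \<Longrightarrow> isom (arc_rel T) (N - X) (arc_rel T') (N - X)"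
      note tN = tour_subset[OF t N(1)] and tN' = tour_subset[OF t' N(1)]
      obtain f :: "'a \<Rightarrow> nat" where "bij_betw f N {0..<card N}"
        using ex_bij_betw_finite_nat[OF tour_finite[OF tN]] by blast
      then have f: "inj_on f N" by (simp add: bij_betw_def)
      let ?G = "image_digraph (arc_rel T) N f" and ?G' = "image_digraph (arc_rel T') N f"
      have G: "pverts ?G = f ` N" "pverts ?G' = f ` N" by (simp_all add: image_digraph_def)
      have tG: "tournament ?G" "tournament ?G'"
        using tournament_image[OF tN f] tournament_image[OF tN' f] .
      \<comment> \<open>The loss of at most two vertices in passing to \<open>N\<close> is paid for
        by the bound \<open>n0 + 2\<close>.\<close>
      have "card (pverts ?G) \<ge> n0" using N(2) n card_image[OF f] G by simp
      then have rec: "minus3_reconstructible ?G"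
        using assms(2) tG(1) indecomposable_image[OF tN f prime] by blast
      have "minus3_hypomorphic ?G ?G'"
        unfolding minus3_hypomorphic_iff G
      proof (intro conjI refl allI impI, elim conjE)
        fix Y assume Y: "Y \<subseteq> f ` N" "card Y = 3"
        then obtain X where X: "X \<subseteq> N" "Y = f ` X" by (meson subset_imageE)
        have cX: "card X = 3" using Y(2) X card_image[OF inj_on_subset[OF f X(1)]] by simp
        have e: "f ` N - Y = f ` (N - X)" using inj_on_image_set_diff[OF f _ X(1), of N] X(2) by simp
        show "isom (arc_rel ?G) (f ` N - Y) (arc_rel ?G') (f ` N - Y)"
          unfolding e
          by (rule isom_trans[OF isom_sym[OF isom_image[OF f]] isom_trans[OF sub isom_image[OF f]]])
             (use X cX in auto)
      qed
      then have "digraph_iso (with_proj ?G') (with_proj ?G)"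
        using rec tG(2) unfolding minus3_reconstructible_def by blast
      then have "isom (arc_rel ?G') (f ` N) (arc_rel ?G) (f ` N)"
        unfolding digraph_iso_arc[OF tG(2,1)] G .
      then show "isom (arc_rel T) N (arc_rel T') N"
        by (intro isom_trans[OF isom_image[OF f subset_refl]
              isom_trans[OF isom_sym isom_sym[OF isom_image[OF f subset_refl]]]])
    qed
    then have "isom (arc_rel T') (pverts T') (arc_rel T) (pverts T)" unfolding V by (rule isom_sym)
    then show "digraph_iso (with_proj T') (with_proj T)"
      unfolding digraph_iso_arc[OF T' T] .
  qed
qed

end
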